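(* Let $N\in\mathbb{N}$ and $p\in\{0\}\cup[1,\infty)$. The Knothe--Rosenblatt distance $\mathcal{KR}_p$ metrizes the $p$-adapted weak topology on $\mathcal{P}_p(\mathbb{R}^N)$.
   Context: $\lambda$ is Lebesgue measure on $(0,1)$ and $\lambda^N$ the product measure on $(0,1)^N$. For $p\in[1,\infty)$, $|x|_p^p:=\sum_i|x_i|^p$ and $\mathcal{P}_p(\mathbb{R}^N)$ is the set of Borel probability measures on $\mathbb{R}^N$ with finite $p$-th moment; $\mathcal{P}_0(\mathbb{R}^N)$ is the set of all Borel probability measures on $\mathbb{R}^N$. A (measurable) map $T=(T_k)_{k=1}^N:(0,1)^N\to\mathbb{R}^N$ is triangular if each $T_k$ depends only on the first $k$ variables. A triangular $Q=(Q_k)_{k=1}^N:(0,1)^N\to\mathbb{R}^N$ is a quantile process if for all $k\le m\le N$ and $u_1,\dots,u_m,u_k'\in(0,1)$ with $u_k\le u_k'$: (inc) $Q_k(u_1,\dots,u_k)\le Q_k(u_1,\dots,u_{k-1},u_k')$; (con) if $Q_k(u_1,\dots,u_k)=Q_k(u_1,\dots,u_{k-1},u_k')$ then $Q_m(u_1,\dots,u_k,\dots,u_m)=Q_m(u_1,\dots,u_k',\dots,u_m)$. For every $\mu\in\mathcal{P}_0(\mathbb{R}^N)$ there is a $\lambda^N$-a.s. unique quantile process $Q^\mu$ with $Q^\mu_\#\lambda^N=\mu$. Explicitly, writing $\mu(dx)=\mu_1(dx_1)\mu_2^{x_1}(dx_2)\cdots\mu_N^{x_1,\dots,x_{N-1}}(dx_N)$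 for the successive disintegration, $Q^\mu_k(u_1,\dots,u_k)$ is the value at $u_k$ of the quantile function of $\mu_k^{Q^\mu_1(u_1),\dots,Q^\mu_{k-1}(u_1,\dots,u_{k-1})}$. The Knothe--Rosenblatt distance is $\mathcal{KR}_p(\mu,\nu):=\big(\int|Q^\mu-Q^\nu|_p^p\,d\lambda^N\big)^{1/p}$ for $p\ge1$ and $\mathcal{KR}_0(\mu,\nu):=\int(|Q^\mu-Q^\nu|\wedge1)\,d\lambda^N$. A coupling $\pi$ of $\mu$ and $\nu$ on $\mathbb{R}^N\times\mathbb{R}^N$ is bicausal, $\pi\in\Pi_{\rm bc}(\mu,\nu)$, if its successive disintegration $\pi=\pi_1(dx_1,dy_1)\,\pi_2^{x_1,y_1}(dx_2,dy_2)\cdots$ satisfies, $\pi$-a.s. and for all $k\le N$, that $\pi_k^{x_1,\dots,x_{k-1},y_1,\dots,y_{k-1}}$ is a coupling of $\mu_k^{x_1,\dots,x_{k-1}}$ and $\nu_k^{y_1,\dots,y_{k-1}}$. The adapted Wasserstein distance is $\mathcal{AW}_p(\mu,\nu):=\inf_{\pi\in\Pi_{\rm bc}(\mu,\nu)}\big(\int|x-y|_p^p\,d\pi\big)^{1/p}$ for $p\ge1$ and $\mathcal{AW}_0(\mu,\nu):=\inf_{\pi\in\Pi_{\rm bc}(\mu,\nu)}\int(|x-y|\wedge1)\,d\pi$. The $p$-adapted weak topology on $\mathcal{P}_p(\mathbb{R}^N)$ is the topology induced by $\mathcal{AW}_p$. *)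

theory Defs
  imports "HOL-Probability.Probability"
begin

text \<open>
  Points of \<open>\<real>\<^sup>N\<close> are functions on the index set \<open>{0..<N}\<close> (extended by \<open>undefined\<close>), so coordinates
  are numbered from 0; the Borel \<open>\<sigma>\<close>-algebra is the finite product one.
\<close>

abbreviation RN :: "nat \<Rightarrow> (nat \<Rightarrow> real) measure" where
  "RN N \<equiv> PiM {0..<N} (\<lambda>_. borel)"

definition unit_cube :: "nat \<Rightarrow> (nat \<Rightarrow> real) measure" where
  "unit_cube N = PiM {0..<N} (\<lambda>_. restrict_space lborel {0<..<1})"

definition prob_measures :: "real \<Rightarrow> nat \<Rightarrow> (nat \<Rightarrow> real) measure set" where
  "prob_measures p N =
     {\<mu>. prob_space \<mu> \<and> sets \<mu> = sets (RN N) \<and>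
         (p \<noteq> 0 \<longrightarrow> integrable \<mu> (\<lambda>x. \<Sum>i = 0..<N. \<bar>x i\<bar> powr p))}"

text \<open>The norm in the truncated cost (\<open>p = 0\<close>) is the Euclidean one.\<close>

definition cost :: "real \<Rightarrow> nat \<Rightarrow> (nat \<Rightarrow> real) \<Rightarrow> (nat \<Rightarrow> real) \<Rightarrow> real" where
  "cost p N x y =
     (if p = 0 then min (L2_set (\<lambda>i. x i - y i) {0..<N}) 1
      else (\<Sum>i = 0..<N. \<bar>x i - y i\<bar> powr p))"

definition root_p :: "real \<Rightarrow> real \<Rightarrow> real" where
  "root_p p c = (if p = 0 then c else c powr (1 / p))"

definition triangular :: "nat \<Rightarrow> ((nat \<Rightarrow> real) \<Rightarrow> nat \<Rightarrow> real) \<Rightarrow> bool" where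
  "triangular N T \<longleftrightarrow>
     T \<in> measurable (unit_cube N) (RN N) \<and>
     (\<forall>k<N. \<forall>u\<in>space (unit_cube N). \<forall>v\<in>space (unit_cube N).
        (\<forall>i\<le>k. u i = v i) \<longrightarrow> T u k = T v k)"

definition quantile_process :: "nat \<Rightarrow> ((nat \<Rightarrow> real) \<Rightarrow> nat \<Rightarrow> real) \<Rightarrow> bool" where
  "quantile_process N Q \<longleftrightarrow>
     triangular N Q \<and>
     (\<forall>u\<in>space (unit_cube N). \<forall>k<N. \<forall>t\<in>{0<..<1}. u k \<le> t \<longrightarrow>
        Q u k \<le> Q (u(k := t)) k \<and>
        (Q u k = Q (u(k := t)) k \<longrightarrow> (\<forall>m. k \<le> m \<and> m < N \<longrightarrow> Q u m = Q (u(k := t)) m)))"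

text \<open>
  \<open>Q\<^sup>\<mu>\<close> is only determined almost surely; since it enters the distance below only under the
  integral, the representative picked here is irrelevant.
\<close>

definition quantile_map :: "nat \<Rightarrow> (nat \<Rightarrow> real) measure \<Rightarrow> (nat \<Rightarrow> real) \<Rightarrow> nat \<Rightarrow> real" where
  "quantile_map N \<mu> = (SOME Q. quantile_process N Q \<and> distr (unit_cube N) (RN N) Q = \<mu>)"

definition KR :: "real \<Rightarrow> nat \<Rightarrow> (nat \<Rightarrow> real) measure \<Rightarrow> (nat \<Rightarrow> real) measure \<Rightarrow> real" where
  "KR p N \<mu> \<nu> =
     root_p p (\<integral>u. cost p N (quantile_map N \<mu> u) (quantile_map N \<nu> u) \<partial>unit_cube N)"

text \<open>
  \<open>\<kappa> k x\<close> is the conditional law of coordinate \<open>k\<close> given that the coordinates in \<open>{0..<k}\<close> equal \<open>x\<close>.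
  The locale predicate says that every \<open>\<kappa> k\<close> is a probability kernel, and the constant
  \<open>Ionescu_Tulcea.C \<kappa> _ 0 N\<close> is the composition of the first \<open>N\<close> kernels; kernels with index at
  least \<open>N\<close> are immaterial. The value type is \<open>real\<close> for measures on \<open>\<real>\<^sup>N\<close> and \<open>real \<times> real\<close> for
  couplings.
\<close>

definition disintegration ::
  "nat \<Rightarrow> (nat \<Rightarrow> 'a) measure \<Rightarrow> (nat \<Rightarrow> (nat \<Rightarrow> 'a) \<Rightarrow> ('a::topological_space) measure) \<Rightarrow> bool" where
  "disintegration N \<mu> \<kappa> \<longleftrightarrow>
     Ionescu_Tulcea \<kappa> (\<lambda>_. borel) \<and>
     \<mu> = Ionescu_Tulcea.C \<kappa> (\<lambda>_. borel) 0 N (\<lambda>_. undefined)"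

definition couplings :: "'a measure \<Rightarrow> 'b measure \<Rightarrow> ('a \<times> 'b) measure set" where
  "couplings \<mu> \<nu> =
     {\<pi>. sets \<pi> = sets (\<mu> \<Otimes>\<^sub>M \<nu>) \<and> distr \<pi> \<mu> fst = \<mu> \<and> distr \<pi> \<nu> snd = \<nu>}"

definition zip_path :: "nat \<Rightarrow> (nat \<Rightarrow> 'a) \<times> (nat \<Rightarrow> 'b) \<Rightarrow> nat \<Rightarrow> 'a \<times> 'b" where
  "zip_path n z = (\<lambda>i\<in>{0..<n}. (fst z i, snd z i))"

text \<open>
  Disintegrations are unique up to null sets, so it does not matter which ones are chosen. That of
  \<open>\<pi>\<close> is taken after identifying \<open>\<real>\<^sup>N \<times> \<real>\<^sup>N\<close> with \<open>(\<real> \<times> \<real>)\<^sup>N\<close>.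
\<close>

definition bicausal_couplings ::
  "nat \<Rightarrow> (nat \<Rightarrow> real) measure \<Rightarrow> (nat \<Rightarrow> real) measure \<Rightarrow> ((nat \<Rightarrow> real) \<times> (nat \<Rightarrow> real)) measure set" where
  "bicausal_couplings N \<mu> \<nu> =
     {\<pi> \<in> couplings \<mu> \<nu>. \<exists>\<kappa> \<alpha> \<beta>.
        disintegration N (distr \<pi> (PiM {0..<N} (\<lambda>_. borel)) (zip_path N)) \<kappa> \<and>
        disintegration N \<mu> \<alpha> \<and> disintegration N \<nu> \<beta> \<and>
        (AE z in \<pi>. \<forall>k<N. \<kappa> k (zip_path k z) \<in>
           couplings (\<alpha> k (restrict (fst z) {0..<k})) (\<beta> k (restrict (snd z) {0..<k})))}"

definition AW :: "real \<Rightarrow> nat \<Rightarrow> (nat \<Rightarrow> real) measure \<Rightarrow> (nat \<Rightarrow> real) measure \<Rightarrow> real" where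
  "AW p N \<mu> \<nu> =
     (INF \<pi>\<in>bicausal_couplings N \<mu> \<nu>. root_p p (\<integral>z. cost p N (fst z) (snd z) \<partial>\<pi>))"

text \<open>
  The topology induced by a distance, written so that the definition can be used without first
  establishing the metric axioms; under those it is \<open>Metric_space.mtopology\<close>.
\<close>

definition dist_topology :: "'a set \<Rightarrow> ('a \<Rightarrow> 'a \<Rightarrow> real) \<Rightarrow> 'a topology" where
  "dist_topology S d =
     topology (\<lambda>U. U \<subseteq> S \<and> (\<forall>x\<in>U. \<exists>r>0. \<forall>y\<in>S. d x y < r \<longrightarrow> y \<in> U))"

lemma openin_dist_topology:
  "openin (dist_topology S d) U \<longleftrightarrow> U \<subseteq> S \<and> (\<forall>x\<in>U. \<exists>r>0. \<forall>y\<in>S. d x y < r \<longrightarrow> y \<in> U)"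
proof -
  let ?P = "\<lambda>U. U \<subseteq> S \<and> (\<forall>x\<in>U. \<exists>r>0. \<forall>y\<in>S. d x y < r \<longrightarrow> y \<in> U)"
  have "?P (U \<inter> V)" if "?P U" "?P V" for U V
  proof -
    have "\<exists>r>0. \<forall>y\<in>S. d x y < r \<longrightarrow> y \<in> U \<inter> V" if x: "x \<in> U \<inter> V" for x
    proof -
      obtain r s where "r > 0" "\<forall>y\<in>S. d x y < r \<longrightarrow> y \<in> U" "s > 0" "\<forall>y\<in>S. d x y < s \<longrightarrow> y \<in> V"
        using x \<open>?P U\<close> \<open>?P V\<close> by blast
      then show ?thesis by (intro exI[of _ "min r s"]) auto
    qed
    then show ?thesis using \<open>?P U\<close> by blast
  qed
  moreover have "?P (\<Union>K)" if K: "\<forall>U\<in>K. ?P U" for K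
  proof (intro conjI ballI)
    show "\<Union>K \<subseteq> S" using K by blast
  next
    fix x assume "x \<in> \<Union>K"
    then obtain U where U: "U \<in> K" "x \<in> U" by blast
    then obtain r where "r > 0" "\<forall>y\<in>S. d x y < r \<longrightarrow> y \<in> U" using K by blast
    then show "\<exists>r>0. \<forall>y\<in>S. d x y < r \<longrightarrow> y \<in> \<Union>K" using U(1) by blast
  qed
  ultimately have "istopology ?P" unfolding istopology_def by simp
  then show ?thesis by (simp add: dist_topology_def topology_inverse')
qed

lemma dist_topology_eq_mtopology:
  assumes "Metric_space S d"
  shows "dist_topology S d = Metric_space.mtopology S d"
proof -
  interpret Metric_space S d by fact
  have "(U \<subseteq> S \<and> (\<forall>x\<in>U. \<exists>r>0. \<forall>y\<in>S. d x y < r \<longrightarrow> y \<in> U)) \<longleftrightarrow>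
        (U \<subseteq> S \<and> (\<forall>x\<in>U. \<exists>r>0. mball x r \<subseteq> U))" for U
    by (intro conj_cong refl ball_cong ex_cong1) (auto simp: subset_iff)
  then show ?thesis
    by (simp add: topology_eq openin_dist_topology openin_mtopology) blast
qed

definition adapted_weak_topology :: "real \<Rightarrow> nat \<Rightarrow> (nat \<Rightarrow> real) measure topology" where
  "adapted_weak_topology p N = dist_topology (prob_measures p N) (AW p N)"

end

theory Submission
  imports Defs
begin

text \<open>
  Every quantile process can be written recursively as \<open>Q\<^sub>k = q\<^sub>k(Q\<^sub>0, \<dots>, Q\<^sub>k\<^sub>-\<^sub>1; u\<^sub>k)\<close> with \<open>q\<^sub>k\<close>
  measurable and monotone in \<open>u\<^sub>k\<close>, and then \<open>q\<^sub>k(x; \<cdot>)\<close> is the quantile function of a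
  disintegration kernel. Hence the joint law of \<open>(Q\<^sup>\<mu>, Q\<^sup>\<nu>)\<close> is a bicausal coupling, which gives
  \<open>AW \<le> KR\<close>.

  Conversely, let \<open>\<pi>\<close> be a bicausal coupling of \<open>\<mu>\<close> and \<open>\<nu>\<close> with small cost, and measure all
  distances after applying \<open>arctan\<close>. Given \<open>\<mu>\<close>, approximate \<open>q\<^sup>\<mu>\<^sub>k\<close> in \<open>L\<^sup>1\<close> by a function \<open>\<phi>\<close> that is
  Lipschitz in \<open>x\<close>. One-dimensional optimality of the monotone coupling, applied conditionally under
  \<open>\<pi>\<close>, shows that \<open>q\<^sup>\<nu>\<^sub>k\<close> is also close to \<open>\<phi>\<close> in \<open>L\<^sup>1\<close>. This statement involves the marginal \<open>\<nu>\<close>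
  only, so it may be transported to the coupling \<open>(Q\<^sup>\<mu>, Q\<^sup>\<nu>)\<close>, where induction on \<open>k\<close> yields
  \<open>Q\<^sup>\<nu> \<rightarrow> Q\<^sup>\<mu>\<close> in probability. For \<open>p \<ge> 1\<close> convergence of the \<open>p\<close>-th moments upgrades this to
  convergence in \<open>L\<^sup>p\<close>.
\<close>

text \<open>The obstacle is that quantile kernels need not be continuous in the past, while
  \<open>\<pi>\<close> and the joint law of the two quantile processes couple the pasts in different
  ways. Hence no bound of \<open>KR\<close> in terms of \<open>AW\<close> that is uniform in both
  measures is sought: \<open>\<mu>\<close> stays fixed, and the Lipschitz constant comes from an
  approximation chosen for \<open>\<mu>\<close> alone. This one-sided control is enough, because
  openness in \<open>dist_topology\<close> is tested by balls around points of the set, so only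
  balls with the same centre \<open>\<mu>\<close> have to be compared.

  A single quantile process and a pair of them driven by the same uniforms are both instances of one
  recursion, \<open>path\<close>, whose law comes with an explicit disintegration. Bicausality of
  the pair is then read off from the recursion, and every measure in \<open>prob_measures\<close>
  may be replaced by a monotone recursion that generates it.\<close>

abbreviation unif01 :: "real measure" where
  "unif01 \<equiv> restrict_space lborel {0<..<1}"

subsection \<open>Recursively generated processes\<close>

abbreviation seq_space :: "nat \<Rightarrow> (nat \<Rightarrow> 'a::topological_space) measure" where
  "seq_space k \<equiv> PiM {0..<k} (\<lambda>_. borel)"

lemma prob_space_unif01: "prob_space unif01"
  by (rule prob_spaceI) (simp add: emeasure_restrict_space space_restrict_space)

lemma product_prob_space_unif01: "product_prob_space (\<lambda>_. unif01)"
  by (intro product_prob_spaceI prob_space_unif01)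

lemma prob_space_unit_cube: "prob_space (unit_cube n)"
  unfolding unit_cube_def by (intro prob_space_PiM prob_space_unif01)

lemma space_unit_cube: "space (unit_cube n) = ({0..<n} \<rightarrow>\<^sub>E {0<..<1})"
  by (simp add: unit_cube_def space_PiM space_restrict_space)

lemma measurable_unif01_real [measurable]: "(\<lambda>t. t) \<in> borel_measurable unif01"
  by (simp add: measurable_restrict_space1)

lemma measurable_coord_unit_cube [measurable (raw)]:
  "k < n \<Longrightarrow> (\<lambda>u. u k) \<in> measurable (unit_cube n) unif01"
  unfolding unit_cube_def by (rule measurable_component_singleton) simp

lemma distr_unit_cube_restrict:
  assumes "k \<le> n"
  shows "distr (unit_cube n) (unit_cube k) (\<lambda>u. restrict u {0..<k}) = unit_cube k"
proof -
  interpret product_prob_space "\<lambda>_::nat. unif01" by (rule product_prob_space_unif01)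
  show ?thesis unfolding unit_cube_def using assms by (intro distr_restrict[symmetric]) auto
qed

text \<open>Independence of coordinate \<open>k\<close> from the earlier ones, as an equality of
  laws. Through \<open>distr_path_pair\<close> it gives the product form
  \<open>law k \<Otimes>\<^sub>M unif01\<close> on which the computations with paths rest.\<close>

lemma distr_unit_cube_pair:
  assumes "k < n"
  shows "distr (unit_cube n) (unit_cube k \<Otimes>\<^sub>M unif01) (\<lambda>u. (restrict u {0..<k}, u k)) = unit_cube k \<Otimes>\<^sub>M unif01"
proof -
  interpret UC: prob_space "unit_cube n" by (rule prob_space_unit_cube)
  interpret product_prob_space "\<lambda>_::nat. unif01" by (rule product_prob_space_unif01)
  have coord: "distr (unit_cube n) unif01 (\<lambda>u. u i) = unif01" if "i < n" for i
    unfolding unit_cube_def using that by (intro distr_PiM_component) (auto intro: prob_space_unif01)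
  have "UC.indep_vars (\<lambda>_. unif01) (\<lambda>i u. u i) {0..<n}"
  proof (subst UC.indep_vars_iff_distr_eq_PiM')
    show "{0..<n} \<noteq> {}" using assms by auto
    have "distr (unit_cube n) (Pi\<^sub>M {0..<n} (\<lambda>_. unif01)) (\<lambda>x. \<lambda>i\<in>{0..<n}. x i) = unit_cube n"
      using distr_unit_cube_restrict[of n n] unfolding unit_cube_def by simp
    also have "\<dots> = PiM {0..<n} (\<lambda>i. distr (unit_cube n) unif01 (\<lambda>u. u i))"
      unfolding unit_cube_def[of n] by (intro PiM_cong refl) (use coord in \<open>simp add: unit_cube_def\<close>)
    finally show "distr (unit_cube n) (Pi\<^sub>M {0..<n} (\<lambda>_. unif01)) (\<lambda>x. \<lambda>i\<in>{0..<n}. x i) =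
       PiM {0..<n} (\<lambda>i. distr (unit_cube n) unif01 (\<lambda>u. u i))" .
  qed auto
  then have "UC.indep_var (PiM {0..<k} (\<lambda>_. unif01)) (\<lambda>u. restrict (\<lambda>i. u i) {0..<k})
      (PiM {k} (\<lambda>_. unif01)) (\<lambda>u. restrict (\<lambda>i. u i) {k})"
    by (rule UC.indep_var_restrict) (use assms in auto)
  then have eq: "unit_cube k \<Otimes>\<^sub>M PiM {k} (\<lambda>_. unif01) =
      distr (unit_cube n) (unit_cube k \<Otimes>\<^sub>M PiM {k} (\<lambda>_. unif01)) (\<lambda>u. (restrict u {0..<k}, restrict u {k}))"
    using assms distr_unit_cube_restrict[of k n] distr_restrict[of "{k}" "{0..<n}"]
    unfolding UC.indep_var_distribution_eq by (simp add: unit_cube_def)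
  \<comment> \<open>The second block of the independence statement is a product over the single
    index \<open>k\<close>; evaluation at \<open>k\<close> identifies it with
    \<open>unif01\<close>.\<close>
  have single: "distr (PiM {k} (\<lambda>_. unif01)) unif01 (\<lambda>x. x k) = unif01"
    by (intro distr_PiM_component) (auto intro: prob_space_unif01)
  interpret D: prob_space "distr (PiM {k} (\<lambda>_. unif01)) unif01 (\<lambda>x. x k)"
    unfolding single by (rule prob_space_unif01)
  have "unit_cube k \<Otimes>\<^sub>M unif01 = distr (unit_cube k) (unit_cube k) (\<lambda>x. x) \<Otimes>\<^sub>M distr (PiM {k} (\<lambda>_. unif01)) unif01 (\<lambda>x. x k)"
    by (simp add: single distr_id2)
  also have "\<dots> = distr (unit_cube k \<Otimes>\<^sub>M PiM {k} (\<lambda>_. unif01)) (unit_cube k \<Otimes>\<^sub>M unif01) (\<lambda>(x, y). (x, y k))"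
    by (rule pair_measure_distr) (auto intro: D.sigma_finite_measure_axioms)
  also have "\<dots> = distr (unit_cube n) (unit_cube k \<Otimes>\<^sub>M unif01) (\<lambda>u. (restrict u {0..<k}, u k))"
    using assms by (subst eq, subst distr_distr)
      (auto simp: comp_def unit_cube_def intro!: measurable_Pair measurable_restrict_subset)
  finally show ?thesis ..
qed

lemma measurable_fun_upd_Suc:
  "(\<lambda>(w, a). w(k := a)) \<in> measurable (PiM {0..<k} M \<Otimes>\<^sub>M M k) (PiM {0..<Suc k} M)"
  by (subst measurable_split_conv) (auto intro!: measurable_fun_upd[where J="{0..<k}"])

text \<open>Coordinate \<open>k\<close> of the path is \<open>r k (w, u k)\<close>, where \<open>w\<close> consists of the coordinates before \<open>k\<close>.\<close>

primrec path :: "(nat \<Rightarrow> (nat \<Rightarrow> 'a) \<times> real \<Rightarrow> 'a) \<Rightarrow> nat \<Rightarrow> (nat \<Rightarrow> real) \<Rightarrow> nat \<Rightarrow> 'a" where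
  "path r 0 u = (\<lambda>_. undefined)"
| "path r (Suc k) u = (path r k u)(k := r k (path r k u, u k))"

lemma path_cong: "(\<And>i. i < k \<Longrightarrow> u i = v i) \<Longrightarrow> path r k u = path r k v"
  by (induction k) auto

lemma path_restrict: "path r k (restrict u {0..<k}) = path r k u"
  by (rule path_cong) simp

lemma path_outside: "k \<le> i \<Longrightarrow> path r k u i = undefined"
  by (induction k) auto

lemma path_stable: "i < k \<Longrightarrow> path r k u i = path r (Suc i) u i"
  by (induction k) (auto simp: less_Suc_eq)

lemma restrict_path: "k \<le> n \<Longrightarrow> restrict (path r n u) {0..<k} = path r k u"
  by (rule ext) (metis atLeastLessThan_iff le0 not_le order_less_le_trans path_outside path_stable restrict_apply)

lemma path_nth: "k < n \<Longrightarrow> path r n u k = r k (restrict (path r n u) {0..<k}, u k)"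
  using path_stable[of k n r u] by (simp add: restrict_path)

text \<open>A function that satisfies the recursion coordinate by coordinate is the path. This
  identifies both a given quantile process and the zip of two paths as paths.\<close>

lemma path_unique:
  assumes "x \<in> extensional {0..<n}" "\<And>k. k < n \<Longrightarrow> x k = r k (restrict x {0..<k}, u k)"
  shows "x = path r n u"
proof -
  have "restrict x {0..<k} = path r k u" if "k \<le> n" for k
    using that
  proof (induction k)
    case (Suc k)
    have "restrict x {0..<Suc k} = (restrict x {0..<k})(k := x k)"
      by (auto simp: restrict_def fun_eq_iff less_Suc_eq)
    then show ?case using Suc assms(2)[of k] by simp
  qed auto
  from this[of n] show ?thesis using assms(1) by (simp add: extensional_restrict)
qed

text \<open>The value type is general so that two real processes fed by the same uniforms form one
  recursion with values in \<open>real \<times> real\<close>.\<close>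

locale recursive_map =
  fixes r :: "nat \<Rightarrow> (nat \<Rightarrow> 'a::topological_space) \<times> real \<Rightarrow> 'a"
  assumes r_measurable [measurable]:
    "\<And>k. r k \<in> borel_measurable (seq_space k \<Otimes>\<^sub>M unif01)"
begin

lemma path_measurable:
  "k \<le> n \<Longrightarrow> path r k \<in> measurable (unit_cube n) (seq_space k)"
proof (induction k)
  case 0
  then show ?case by (auto simp: space_PiM)
next
  case (Suc k)
  have [measurable]: "path r k \<in> measurable (unit_cube n) (seq_space k)"
    using Suc by simp
  have [measurable]: "(\<lambda>u. u k) \<in> measurable (unit_cube n) unif01"
    using Suc by (intro measurable_coord_unit_cube) simp
  have "(\<lambda>u. (\<lambda>(w, a). w(k := a)) (path r k u, r k (path r k u, u k)))
      \<in> measurable (unit_cube n) (seq_space (Suc k))"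
    by (rule measurable_compose[OF _ measurable_fun_upd_Suc]) measurable
  moreover have "path r (Suc k) = (\<lambda>u. (path r k u)(k := r k (path r k u, u k)))" by (rule ext) simp
  ultimately show ?case by (simp del: fun_upd_apply)
qed

definition law :: "nat \<Rightarrow> (nat \<Rightarrow> 'a) measure" where
  "law k = distr (unit_cube k) (seq_space k) (path r k)"

text \<open>When \<open>r\<close> is monotone in \<open>t\<close>, the section
  \<open>t \<mapsto> r k (w, t)\<close> is a quantile function of \<open>ker k w\<close>, with some
  convention at the jumps.\<close>

definition ker :: "nat \<Rightarrow> (nat \<Rightarrow> 'a) \<Rightarrow> 'a measure" where
  "ker k w = distr unif01 borel (\<lambda>t. r k (w, t))"

lemma prob_space_law: "prob_space (law k)"
  unfolding law_def by (intro prob_space.prob_space_distr prob_space_unit_cube path_measurable) simp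

lemma sets_law [measurable_cong, simp]: "sets (law k) = sets (seq_space k)"
  by (simp add: law_def)

lemma distr_path:
  assumes "k \<le> n"
  shows "distr (unit_cube n) (seq_space k) (path r k) = law k"
proof -
  have "law k = distr (distr (unit_cube n) (unit_cube k) (\<lambda>u. restrict u {0..<k}))
      (seq_space k) (path r k)"
    by (simp add: law_def distr_unit_cube_restrict assms)
  also have "\<dots> = distr (unit_cube n) (seq_space k) (path r k \<circ> (\<lambda>u. restrict u {0..<k}))"
    using assms by (intro distr_distr path_measurable)
      (auto simp: unit_cube_def intro!: measurable_restrict_subset)
  also have "path r k \<circ> (\<lambda>u. restrict u {0..<k}) = path r k"
    by (simp add: fun_eq_iff path_restrict)
  finally show ?thesis by simp
qed

lemma distr_path_pair:
  assumes "k < n"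
  shows "distr (unit_cube n) (seq_space k \<Otimes>\<^sub>M unif01) (\<lambda>u. (path r k u, u k)) = law k \<Otimes>\<^sub>M unif01"
proof -
  interpret U: prob_space unif01 by (rule prob_space_unif01)
  have pm: "path r k \<in> measurable (unit_cube k) (seq_space k)" by (rule path_measurable) simp
  have "law k \<Otimes>\<^sub>M unif01 = distr (unit_cube k) (seq_space k) (path r k) \<Otimes>\<^sub>M distr unif01 unif01 (\<lambda>x. x)"
    by (simp add: law_def distr_id2)
  also have "\<dots> = distr (unit_cube k \<Otimes>\<^sub>M unif01) (seq_space k \<Otimes>\<^sub>M unif01) (\<lambda>(x, y). (path r k x, y))"
    using pm by (intro pair_measure_distr) (auto simp: distr_id2 intro: U.sigma_finite_measure_axioms)
  also have "\<dots> = distr (unit_cube n) (seq_space k \<Otimes>\<^sub>M unif01)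
      (\<lambda>u. (path r k (restrict u {0..<k}), u k))"
    using assms pm
    by (subst distr_unit_cube_pair[OF assms, symmetric], subst distr_distr)
      (auto simp: comp_def unit_cube_def split_beta' intro!: measurable_Pair measurable_restrict_subset
        intro: measurable_compose[OF measurable_fst] )
  also have "(\<lambda>u. path r k (restrict u {0..<k})) = path r k"
    by (simp add: fun_eq_iff path_restrict)
  then have "(\<lambda>u. (path r k (restrict u {0..<k}), u k)) = (\<lambda>u. (path r k u, u k))"
    by (simp add: fun_eq_iff)
  finally show ?thesis ..
qed

lemma nn_integral_path:
  assumes "k < n" and [measurable]: "f \<in> borel_measurable (seq_space k \<Otimes>\<^sub>M unif01)"
  shows "(\<integral>\<^sup>+u. f (path r k u, u k) \<partial>unit_cube n) = (\<integral>\<^sup>+w. \<integral>\<^sup>+t. f (w, t) \<partial>unif01 \<partial>law k)"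
proof -
  interpret U: prob_space unif01 by (rule prob_space_unif01)
  have [measurable]: "(\<lambda>u. (path r k u, u k)) \<in> measurable (unit_cube n) (seq_space k \<Otimes>\<^sub>M unif01)"
    using assms by (intro measurable_Pair path_measurable measurable_coord_unit_cube) auto
  have "(\<integral>\<^sup>+u. f (path r k u, u k) \<partial>unit_cube n) = (\<integral>\<^sup>+z. f z \<partial>(law k \<Otimes>\<^sub>M unif01))"
    by (subst distr_path_pair[OF assms(1), symmetric]) (simp add: nn_integral_distr)
  also have "\<dots> = (\<integral>\<^sup>+w. \<integral>\<^sup>+t. f (w, t) \<partial>unif01 \<partial>law k)"
    by (rule U.nn_integral_fst[symmetric]) (simp cong: measurable_cong_sets)
  finally show ?thesis .
qed

lemma law_Suc: "law (Suc k) = distr (law k \<Otimes>\<^sub>M unif01) (seq_space (Suc k)) (\<lambda>z. (fst z)(k := r k z))"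
proof -
  have m: "(\<lambda>z. (fst z)(k := r k z)) \<in> measurable (seq_space k \<Otimes>\<^sub>M unif01) (seq_space (Suc k))"
    using measurable_compose[OF measurable_Pair[OF measurable_fst r_measurable[of k]] measurable_fun_upd_Suc[of k "\<lambda>_. borel"]]
    by simp
  show ?thesis
    apply (subst distr_path_pair[of k "Suc k", symmetric], simp)
    apply (subst distr_distr[OF m])
    apply (auto simp: law_def comp_def intro!: measurable_Pair path_measurable measurable_coord_unit_cube
      arg_cong[where f="distr _ _"])
    done
qed

lemma r_section_measurable [measurable]:
  "w \<in> space (seq_space k) \<Longrightarrow> (\<lambda>t. r k (w, t)) \<in> borel_measurable unif01"
  by measurable

lemma Ionescu_Tulcea_ker: "Ionescu_Tulcea ker (\<lambda>_. borel)"
proof (rule Ionescu_Tulcea.intro)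
  show "ker i \<in> measurable (seq_space i) (subprob_algebra borel)" for i
    unfolding ker_def[abs_def]
    by (rule measurable_distr2[where M=unif01])
      (auto intro!: measurable_const simp: space_subprob_algebra prob_space_unif01 prob_space_imp_subprob_space)
  show "prob_space (ker i x)" if "x \<in> space (seq_space i)" for i x
    unfolding ker_def using that by (intro prob_space.prob_space_distr prob_space_unif01) auto
qed

text \<open>Both sides satisfy the same recursion: the left one appends a coordinate computed from a
  fresh uniform variable, the right one appends a draw from \<open>ker n\<close> through
  \<open>eP n\<close>, and \<open>ker n\<close> is the law of that computed coordinate.\<close>

lemma law_eq_C: "law n = Ionescu_Tulcea.C ker (\<lambda>_. borel) 0 n (\<lambda>_. undefined)"
proof (induction n)
  interpret I: Ionescu_Tulcea ker "\<lambda>_. borel" by (rule Ionescu_Tulcea_ker)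
  interpret U: prob_space unif01 by (rule prob_space_unif01)
  {
    case 0
    have "space (unit_cube 0) = {\<lambda>_. undefined}" by (simp add: space_unit_cube)
    moreover have "path r 0 = (\<lambda>_ _. undefined)" by (rule ext) simp
    ultimately show ?case
      by (auto simp: law_def unit_cube_def PiM_empty emeasure_distr intro!: measure_eqI dest!: subset_singletonD)
  next
    case (Suc n)
    have [measurable]: "(\<lambda>z. (fst z)(n := r n z)) \<in> measurable (seq_space n \<Otimes>\<^sub>M unif01) (seq_space (Suc n))"
      using measurable_compose[OF measurable_Pair[OF measurable_fst r_measurable[of n]] measurable_fun_upd_Suc[of n "\<lambda>_. borel"]]
      by simp
    have sp: "space (law n) = space (seq_space n)"
      by (rule sets_eq_imp_space_eq) simp
    have emp: "space (law n) \<noteq> {}" by (rule prob_space.not_empty[OF prob_space_law])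
    have mE: "I.eP n \<in> measurable (law n) (subprob_algebra (seq_space (Suc n)))"
      using I.measurable_eP[of n] by (simp cong: measurable_cong_sets)
    have "law (Suc n) = law n \<bind> I.eP n"
    proof (rule measure_eqI)
      show "sets (law (Suc n)) = sets (law n \<bind> I.eP n)"
        by (subst sets_bind[OF _ emp, where N="seq_space (Suc n)"]) (auto simp: sp I.sets_eP)
    next
      fix A assume "A \<in> sets (law (Suc n))"
      then have A[measurable]: "A \<in> sets (seq_space (Suc n))" by simp
      have "emeasure (law (Suc n)) A = (\<integral>\<^sup>+z. indicator A ((fst z)(n := r n z)) \<partial>(law n \<Otimes>\<^sub>M unif01))"
        by (subst law_Suc, subst nn_integral_indicator[symmetric])
          (simp_all add: nn_integral_distr del: nn_integral_indicator cong: measurable_cong_sets)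
      also have "\<dots> = (\<integral>\<^sup>+w. \<integral>\<^sup>+t. indicator A (w(n := r n (w, t))) \<partial>unif01 \<partial>law n)"
        by (subst U.nn_integral_fst[symmetric]) (simp_all cong: measurable_cong_sets)
      also have "\<dots> = (\<integral>\<^sup>+w. emeasure (I.eP n w) A \<partial>law n)"
      proof (rule nn_integral_cong)
        fix w assume "w \<in> space (law n)"
        then have w: "w \<in> space (seq_space n)" by (simp add: sp)
        have m: "fun_upd w n \<in> measurable borel (seq_space (Suc n))"
          using w by (intro measurable_fun_upd[where J="{0..<n}"]) auto
        have "emeasure (I.eP n w) A = (\<integral>\<^sup>+x. indicator A x \<partial>I.eP n w)"
          using w by (simp add: I.sets_eP)
        also have "\<dots> = (\<integral>\<^sup>+a. indicator A (w(n := a)) \<partial>ker n w)"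
          using w by (intro I.nn_integral_eP) auto
        also have "\<dots> = (\<integral>\<^sup>+t. indicator A (w(n := r n (w, t))) \<partial>unif01)"
          unfolding ker_def using w measurable_compose[OF m borel_measurable_indicator[OF A]]
          by (intro nn_integral_distr) auto
        finally show "(\<integral>\<^sup>+t. indicator A (w(n := r n (w, t))) \<partial>unif01) = emeasure (I.eP n w) A" ..
      qed
      also have "\<dots> = emeasure (law n \<bind> I.eP n) A"
        by (rule emeasure_bind[OF emp mE A, symmetric])
      finally show "emeasure (law (Suc n)) A = emeasure (law n \<bind> I.eP n) A" .
    qed
    then show ?case using Suc by simp
  }
qed

lemma disintegration_law: "disintegration n (law n) ker"
  by (simp add: disintegration_def Ionescu_Tulcea_ker flip: law_eq_C)

end

section \<open>Kernels of an arbitrary disintegration\<close>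

lemma disintegration_prob:
  assumes "disintegration N \<mu> \<kappa>"
  shows "prob_space \<mu>" "sets \<mu> = sets (seq_space N)"
    and "\<And>k. \<kappa> k \<in> measurable (seq_space k) (subprob_algebra borel)"
    and "\<And>k w. w \<in> space (seq_space k) \<Longrightarrow> prob_space (\<kappa> k w)"
proof -
  interpret I: Ionescu_Tulcea \<kappa> "\<lambda>_. borel" using assms by (simp add: disintegration_def)
  have mu: "\<mu> = I.C 0 N (\<lambda>_. undefined)" using assms by (simp add: disintegration_def)
  show "prob_space \<mu>" "sets \<mu> = sets (seq_space N)"
    unfolding mu by (auto intro!: I.prob_space_C simp: I.sets_C)
  show "\<And>k. \<kappa> k \<in> measurable (seq_space k) (subprob_algebra borel)" by simp
  show "\<And>k w. w \<in> space (seq_space k) \<Longrightarrow> prob_space (\<kappa> k w)"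
    by (rule I.prob_space_P)
qed

text \<open>The integrand sees only the first \<open>k + 1\<close> coordinates, so the composition
  may be truncated there; its last kernel then splits off as the inner integral. This is how
  conditional laws are extracted from the composition of kernels.\<close>

lemma nn_integral_disintegration:
  assumes "disintegration N \<mu> \<kappa>" "k < N"
    and [measurable]: "g \<in> borel_measurable (seq_space k \<Otimes>\<^sub>M borel)"
  shows "(\<integral>\<^sup>+x. g (restrict x {0..<k}, x k) \<partial>\<mu>) =
     (\<integral>\<^sup>+x. \<integral>\<^sup>+a. g (restrict x {0..<k}, a) \<partial>\<kappa> k (restrict x {0..<k}) \<partial>\<mu>)"
proof -
  interpret I: Ionescu_Tulcea \<kappa> "\<lambda>_. borel" using assms by (simp add: disintegration_def)
  have mu: "\<mu> = I.C 0 N (\<lambda>_. undefined)" using assms by (simp add: disintegration_def)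
  define f where "f = (\<lambda>x. g (restrict x {0..<k}, x k))"
  have f: "f \<in> borel_measurable (seq_space (Suc k))"
    unfolding f_def by measurable
  have [simp]: "(\<lambda>_. undefined) \<in> space (Pi\<^sub>M {0..<0::nat} (\<lambda>_. borel))" by (simp add: space_PiM)
  define h where "h = (\<lambda>w. \<integral>\<^sup>+a. g (w, a) \<partial>\<kappa> k w)"
  have h: "h \<in> borel_measurable (seq_space k)"
    unfolding h_def by (rule nn_integral_measurable_subprob_algebra2[where N=borel]) auto
  have "(\<integral>\<^sup>+x. g (restrict x {0..<k}, x k) \<partial>\<mu>) = (\<integral>\<^sup>+x. f (restrict x {0..<0 + Suc k}) \<partial>I.C 0 N (\<lambda>_. undefined))"
    unfolding mu by (intro nn_integral_cong arg_cong[where f=g]) (auto simp: f_def)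
  also have "\<dots> = (\<integral>\<^sup>+x. f x \<partial>I.C 0 (Suc k) (\<lambda>_. undefined))"
    using assms(2) f by (intro I.nn_integral_C[symmetric]) auto
  also have "\<dots> = (\<integral>\<^sup>+w. \<integral>\<^sup>+x. f x \<partial>I.eP k w \<partial>I.C 0 k (\<lambda>_. undefined))"
    using f I.measurable_eP[of k] I.sets_C[of "\<lambda>_. undefined" 0 k]
    by (simp, intro nn_integral_bind) (auto cong: measurable_cong_sets)
  also have "\<dots> = (\<integral>\<^sup>+w. h w \<partial>I.C 0 k (\<lambda>_. undefined))"
  proof (rule nn_integral_cong)
    fix w assume "w \<in> space (I.C 0 k (\<lambda>_. undefined))"
    then have w: "w \<in> space (seq_space k)" by (simp add: I.space_C)
    then have "restrict (w(k := a)) {0..<k} = w" for a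
      by (auto simp: space_PiM PiE_def extensional_def fun_eq_iff)
    then show "(\<integral>\<^sup>+x. f x \<partial>I.eP k w) = h w"
      using w f by (simp add: I.nn_integral_eP f_def h_def)
  qed
  also have "\<dots> = (\<integral>\<^sup>+x. h (restrict x {0..<0 + k}) \<partial>I.C 0 N (\<lambda>_. undefined))"
    using assms(2) h by (intro I.nn_integral_C) auto
  finally show ?thesis by (simp add: mu h_def)
qed

subsection \<open>Factorization of quantile processes\<close>

locale monotone_map = recursive_map r for r :: "nat \<Rightarrow> (nat \<Rightarrow> real) \<times> real \<Rightarrow> real" +
  assumes r_mono: "\<And>k w s t. w \<in> space (RN k) \<Longrightarrow> 0 < s \<Longrightarrow> s \<le> t \<Longrightarrow> t < 1 \<Longrightarrow> r k (w, s) \<le> r k (w, t)"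

text \<open>The midpoint of a level set of \<open>f\<close> is written through countable infima and suprema, so it
  depends measurably on any parameter of \<open>f\<close>.\<close>

lemma level_set_midpoint:
  fixes f :: "real \<Rightarrow> real"
  assumes mono: "\<And>s t. 0 < s \<Longrightarrow> s \<le> t \<Longrightarrow> t < 1 \<Longrightarrow> f s \<le> f t"
    and t0: "0 < t0" "t0 < 1"
  defines "lo \<equiv> (INF r\<in>\<rat> \<inter> {0<..<1}. if f t0 \<le> f r then r else 1)"
    and "hi \<equiv> (SUP r\<in>\<rat> \<inter> {0<..<1}. if f r \<le> f t0 then r else 0)"
  shows "0 < (lo + hi) / 2" "(lo + hi) / 2 < 1" "f ((lo + hi) / 2) = f t0"
proof -
  let ?I = "\<rat> \<inter> {0<..<1::real}"
  let ?a = "f t0"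
  have ne: "?I \<noteq> {}"
  proof -
    have "1/2 \<in> ?I" by simp
    then show ?thesis by blast
  qed
  have bb: "bdd_below ((\<lambda>r. if ?a \<le> f r then r else 1) ` ?I)" by (rule bdd_belowI[of _ 0]) auto
  have ba: "bdd_above ((\<lambda>r. if f r \<le> ?a then r else 0) ` ?I)" by (rule bdd_aboveI[of _ 1]) auto
  have lo0: "0 \<le> lo" unfolding lo_def using ne by (intro cINF_greatest) auto
  have hi1: "hi \<le> 1" unfolding hi_def using ne by (intro cSUP_least) auto
  have lot: "lo \<le> t0"
  proof (rule dense_ge)
    fix y assume "t0 < y"
    then obtain r where r: "r \<in> \<rat>" "t0 < r" "r < min y 1"
      using t0 Rats_dense_in_real[of t0 "min y 1"] by auto
    have "lo \<le> (if ?a \<le> f r then r else 1)"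
      unfolding lo_def using r t0 by (intro cINF_lower bb) auto
    also have "\<dots> = r" using mono[of t0 r] r t0 by auto
    finally show "lo \<le> y" using r by auto
  qed
  have thi: "t0 \<le> hi"
  proof (rule dense_le)
    fix y assume "y < t0"
    then obtain r where r: "r \<in> \<rat>" "r < t0" "max y 0 < r"
      using t0 Rats_dense_in_real[of "max y 0" t0] by auto
    have "r = (if f r \<le> ?a then r else 0)" using mono[of r t0] r t0 by auto
    also have "\<dots> \<le> hi"
      unfolding hi_def using r t0 by (intro cSUP_upper ba) auto
    finally show "y \<le> hi" using r by auto
  qed
  let ?c = "(lo + hi) / 2"
  \<comment> \<open>If \<open>lo = hi\<close>, both equal \<open>t0\<close>. Otherwise the midpoint
    lies strictly between them, and rationals \<open>r' < ?c < r\<close> with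
    \<open>f t0 \<le> f r'\<close> and \<open>f r \<le> f t0\<close> squeeze \<open>f ?c\<close>.
    The defaults 1 and 0 cannot supply these rationals because \<open>0 < ?c < 1\<close>.\<close>
  have "0 < ?c \<and> ?c < 1 \<and> f ?c = ?a"
  proof (cases "lo = hi")
    case True
    then have "?c = t0" using lot thi by auto
    then show ?thesis using t0 by simp
  next
    case False
    then have c: "lo < ?c" "?c < hi" using lot thi by auto
    from c(2)[unfolded hi_def less_cSUP_iff[OF ne ba], folded hi_def] obtain r where r: "r \<in> ?I" "?c < (if f r \<le> ?a then r else 0)"
      by blast
    have "f r \<le> ?a" "?c < r" using r c lo0 by (auto split: if_splits)
    moreover from c(1)[unfolded lo_def cINF_less_iff[OF ne bb], folded lo_def] obtain r' where r': "r' \<in> ?I" "(if ?a \<le> f r' then r' else 1) < ?c"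
      by blast
    have "?a \<le> f r'" "r' < ?c" using r' c hi1 by (auto split: if_splits)
    ultimately have "f ?c \<le> ?a" "?a \<le> f ?c"
      using mono[of ?c r] mono[of r' ?c] r(1) r'(1) c lo0 hi1 by auto
    then show ?thesis using c lo0 hi1 by auto
  qed
  then show "0 < ?c" "?c < 1" "f ?c = ?a" by auto
qed

text \<open>By condition (con), the variables \<open>u\<^sub>0, \<dots>, u\<^sub>k\<^sub>-\<^sub>1\<close> may be replaced one after the other by the midpoints
  of their level sets without changing the later coordinates of \<open>Q\<close>. These midpoints are functions
  of the values \<open>Q\<^sub>0, \<dots>, Q\<^sub>k\<^sub>-\<^sub>1\<close>, which makes a separate uniqueness proof unnecessary.\<close>

lemma quantile_process_factorization:
  assumes Q: "quantile_process N Q"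
  obtains q where "monotone_map q" "\<And>u. u \<in> space (unit_cube N) \<Longrightarrow> Q u = path q N u"
proof -
  have Qm [measurable]: "Q \<in> measurable (unit_cube N) (RN N)"
    and tri: "\<And>k u v. k < N \<Longrightarrow> u \<in> space (unit_cube N) \<Longrightarrow> v \<in> space (unit_cube N) \<Longrightarrow>
        (\<And>i. i \<le> k \<Longrightarrow> u i = v i) \<Longrightarrow> Q u k = Q v k"
    using Q unfolding quantile_process_def triangular_def by blast+
  have step: "Q u k \<le> Q (u(k := t)) k \<and>
      (Q u k = Q (u(k := t)) k \<longrightarrow> (\<forall>m. k \<le> m \<and> m < N \<longrightarrow> Q u m = Q (u(k := t)) m))"
    if "u \<in> space (unit_cube N)" "k < N" "0 < t" "t < 1" "u k \<le> t" for u k t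
  proof -
    have "t \<in> {0<..<1}" using that by simp
    with Q that(1,2,5) show ?thesis unfolding quantile_process_def by blast
  qed
  have inc: "\<And>u k t. u \<in> space (unit_cube N) \<Longrightarrow> k < N \<Longrightarrow> 0 < t \<Longrightarrow> t < 1 \<Longrightarrow> u k \<le> t \<Longrightarrow> Q u k \<le> Q (u(k := t)) k"
    using step by blast
  have con: "\<And>u k t m. u \<in> space (unit_cube N) \<Longrightarrow> k < N \<Longrightarrow> 0 < t \<Longrightarrow> t < 1 \<Longrightarrow> u k \<le> t \<Longrightarrow>
        Q u k = Q (u(k := t)) k \<Longrightarrow> k \<le> m \<Longrightarrow> m < N \<Longrightarrow> Q u m = Q (u(k := t)) m"
    using step by blast
  \<comment> \<open>By triangularity the coordinates after \<open>k\<close> do not influence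
    \<open>Q u k\<close>; 1/2 is an arbitrary admissible filler.\<close>
  define ext where "ext k s t = (\<lambda>i\<in>{0..<N}. if i < k then s i else if i = k then t else 1/2 :: real)"
    for k :: nat and s :: "nat \<Rightarrow> real" and t :: real
  have ext_m: "(\<lambda>(s, t). ext k s t) \<in> measurable (unit_cube k \<Otimes>\<^sub>M unif01) (unit_cube N)" if "k < N" for k
  proof -
    have half: "(1/2::real) \<in> space unif01" by (simp add: space_restrict_space)
    have "(\<lambda>z. if i < k then fst z i else if i = k then snd z else 1/2) \<in> measurable (unit_cube k \<Otimes>\<^sub>M unif01) unif01" for i
    proof (cases "i < k")
      case True
      then have "(\<lambda>z. fst z i) \<in> measurable (unit_cube k \<Otimes>\<^sub>M unif01) unif01"
        by (intro measurable_compose[OF measurable_fst] measurable_coord_unit_cube)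
      with True show ?thesis by simp
    next
      case False
      then show ?thesis using half by (cases "i = k") auto
    qed
    then show ?thesis unfolding ext_def unit_cube_def[of N] split_beta by (intro measurable_restrict)
  qed
  have ext_space: "ext k s t \<in> space (unit_cube N)" if "s \<in> space (unit_cube k)" "0 < t" "t < 1" for k s t
    using that by (auto simp: ext_def space_unit_cube PiE_iff)
  define Qk where "Qk k s t = Q (ext k s t) k" for k s t
  have Qk_m: "(\<lambda>(s, t). Qk k s t) \<in> borel_measurable (unit_cube k \<Otimes>\<^sub>M unif01)" if "k < N" for k
    using measurable_compose[OF measurable_compose[OF ext_m[OF that] Qm] measurable_component_singleton[of k "{0..<N}"]] that
    by (simp add: Qk_def split_beta)
  \<comment> \<open>These are \<open>lo\<close> and \<open>hi\<close> of
    \<open>level_set_midpoint\<close> for the function \<open>Qk k s\<close>, with the level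
    \<open>a\<close> as a free argument so that joint measurability in \<open>s\<close> and
    \<open>a\<close> can be stated.\<close>
  define lo where "lo k s a = (INF r\<in>\<rat> \<inter> {0<..<1}. if a \<le> Qk k s r then r else 1)" for k s a
  define hi where "hi k s a = (SUP r\<in>\<rat> \<inter> {0<..<1}. if Qk k s r \<le> a then r else 0)" for k s a
  define c where "c k s a = (lo k s a + hi k s a) / 2" for k s a
  \<comment> \<open>For a level that \<open>Qk k s\<close> does not attain, \<open>c\<close> may
    fall outside the open unit interval; the default keeps \<open>mid k\<close> a map into
    \<open>unif01\<close>.\<close>
  define mid where "mid k z = (if 0 < c k (fst z) (snd z) \<and> c k (fst z) (snd z) < 1 then c k (fst z) (snd z) else 1/2)" for k z
  have cnt: "countable (\<rat> \<inter> {0<..<1::real})" using countable_rat by blast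
  have Qkr_m: "(\<lambda>z. Qk k (fst z) r) \<in> borel_measurable (unit_cube k \<Otimes>\<^sub>M borel)" if "k < N" "0 < r" "r < 1" for k r
  proof -
    have "(\<lambda>z. (fst z, r)) \<in> measurable (unit_cube k \<Otimes>\<^sub>M borel) (unit_cube k \<Otimes>\<^sub>M unif01)"
      using that by (intro measurable_Pair measurable_fst measurable_const) (simp add: space_restrict_space)
    from measurable_compose[OF this Qk_m[OF that(1)]] show ?thesis by simp
  qed
  have lo_m: "(\<lambda>z. lo k (fst z) (snd z)) \<in> borel_measurable (unit_cube k \<Otimes>\<^sub>M borel)" if "k < N" for k
    unfolding lo_def
  proof (rule borel_measurable_cINF_real[OF cnt])
    fix r :: real assume "r \<in> \<rat> \<inter> {0<..<1}"
    then have [measurable]: "(\<lambda>z. Qk k (fst z) r) \<in> borel_measurable (unit_cube k \<Otimes>\<^sub>M borel)"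
      using Qkr_m that by auto
    show "(\<lambda>z. if snd z \<le> Qk k (fst z) r then r else 1) \<in> borel_measurable (unit_cube k \<Otimes>\<^sub>M borel)"
      by measurable
  qed
  have hi_m: "(\<lambda>z. hi k (fst z) (snd z)) \<in> borel_measurable (unit_cube k \<Otimes>\<^sub>M borel)" if "k < N" for k
    unfolding hi_def
  proof (rule borel_measurable_cSUP[OF cnt])
    fix r :: real assume "r \<in> \<rat> \<inter> {0<..<1}"
    then have [measurable]: "(\<lambda>z. Qk k (fst z) r) \<in> borel_measurable (unit_cube k \<Otimes>\<^sub>M borel)"
      using Qkr_m that by auto
    show "(\<lambda>z. if Qk k (fst z) r \<le> snd z then r else 0) \<in> borel_measurable (unit_cube k \<Otimes>\<^sub>M borel)"
      by measurable
  next
    show "bdd_above ((\<lambda>r. if Qk k (fst z) r \<le> snd z then r else 0) ` (\<rat> \<inter> {0<..<1}))" for z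
      by (rule bdd_aboveI[of _ 1]) auto
  qed
  have mid_m: "mid k \<in> measurable (unit_cube k \<Otimes>\<^sub>M borel) unif01" if "k < N" for k
  proof -
    note lo_m[OF that, measurable] hi_m[OF that, measurable]
    have "mid k \<in> borel_measurable (unit_cube k \<Otimes>\<^sub>M borel)"
      unfolding mid_def[abs_def] c_def by measurable
    then show ?thesis
      by (intro measurable_restrict_space2) (auto simp: mid_def)
  qed
  \<comment> \<open>The same recursion run from values to uniforms: the inputs are the values
    \<open>x\<close>, the outputs are midpoints, each computed from the earlier midpoints and the
    current value.\<close>
  define sel where "sel = path mid"
  have sel_m: "sel k \<in> measurable (RN k) (unit_cube k)" if "k \<le> N" for k
    using that
  proof (induction k)
    case 0
    then show ?case by (auto simp: sel_def unit_cube_def space_PiM)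
  next
    case (Suc k)
    have "sel k \<in> measurable (RN (Suc k)) (unit_cube k)"
    proof -
      have "(\<lambda>x. sel k (restrict x {0..<k})) \<in> measurable (RN (Suc k)) (unit_cube k)"
        using Suc by (intro measurable_compose[OF measurable_restrict_subset]) auto
      then show ?thesis by (simp add: sel_def path_restrict)
    qed
    then have "(\<lambda>x. (sel k x, mid k (sel k x, x k))) \<in> measurable (RN (Suc k)) (unit_cube k \<Otimes>\<^sub>M unif01)"
      using Suc.prems by (intro measurable_Pair measurable_compose[OF _ mid_m]) auto
    from measurable_compose[OF this[unfolded unit_cube_def] measurable_fun_upd_Suc]
    have "(\<lambda>x. (sel k x)(k := mid k (sel k x, x k))) \<in> measurable (RN (Suc k)) (unit_cube (Suc k))"
      by (simp add: unit_cube_def)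
    moreover have "sel (Suc k) = (\<lambda>x. (sel k x)(k := mid k (sel k x, x k)))"
      by (rule ext) (simp add: sel_def)
    ultimately show ?case by (simp del: fun_upd_apply)
  qed
  define q where "q k z = (if k < N then Qk k (sel k (fst z)) (snd z) else 0)" for k z
  have "q k \<in> borel_measurable (RN k \<Otimes>\<^sub>M unif01)" for k
  proof (cases "k < N")
    case True
    have "(\<lambda>z. (sel k (fst z), snd z)) \<in> measurable (RN k \<Otimes>\<^sub>M unif01) (unit_cube k \<Otimes>\<^sub>M unif01)"
      using True by (intro measurable_Pair measurable_compose[OF measurable_fst] sel_m measurable_snd) auto
    from measurable_compose[OF this Qk_m[OF True]] True show ?thesis by (simp add: q_def[abs_def])
  qed (simp add: q_def[abs_def])
  moreover have Qk_mono: "Qk k s t \<le> Qk k s t'"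
    if "k < N" "s \<in> space (unit_cube k)" "0 < t" "t \<le> t'" "t' < 1" for k s t t'
  proof -
    have "(ext k s t)(k := t') = ext k s t'" using that by (auto simp: ext_def fun_eq_iff)
    then show ?thesis
      using inc[of "ext k s t" k t'] ext_space[of s k t] that by (auto simp: Qk_def ext_def)
  qed
  have "q k (w, s) \<le> q k (w, t)"
    if "w \<in> space (RN k)" "0 < s" "s \<le> t" "t < 1" for k w s t
    using that measurable_space[OF sel_m[of k], of w] by (auto simp: q_def intro: Qk_mono)
  ultimately have "monotone_map q" by unfold_locales auto
  moreover have "Q u = path q N u" if u: "u \<in> space (unit_cube N)" for u
  proof (rule path_unique)
    define x where "x = Q u"
    have "x \<in> space (RN N)" unfolding x_def by (rule measurable_space[OF Qm u])
    then show "Q u \<in> extensional {0..<N}" by (simp add: x_def space_PiM PiE_def)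
    have u01: "0 < u i" "u i < 1" if "i < N" for i using u that by (auto simp: space_unit_cube PiE_iff)
    have sel_cube: "sel k x \<in> space (unit_cube k)" if "k \<le> N" for k
    proof -
      have "restrict x {0..<k} \<in> space (RN k)" by (simp add: space_PiM)
      from measurable_space[OF sel_m[OF that] this] show ?thesis by (simp add: sel_def path_restrict)
    qed
    \<comment> \<open>A hybrid that leads from \<open>u\<close> (at \<open>rep 0\<close>) to the
      selected midpoints, one variable at a time. The invariant \<open>rep_eq\<close> says that the
      coordinates of \<open>Q\<close> not yet passed are unchanged along the way.\<close>
    define rep where "rep k = (\<lambda>i\<in>{0..<N}. if i < k then sel k x i else u i)" for k
    have rep_cube: "rep k \<in> space (unit_cube N)" if "k \<le> N" for k
      using sel_cube[OF that] u01 by (auto simp: rep_def space_unit_cube PiE_iff)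
    have Qk_rep: "Qk k (sel k x) t = Q ((rep k)(k := t)) k" if "k < N" "0 < t" "t < 1" for k t
      unfolding Qk_def
    proof (rule tri)
      show "ext k (sel k x) t \<in> space (unit_cube N)" using sel_cube that by (intro ext_space) auto
      show "(rep k)(k := t) \<in> space (unit_cube N)" using rep_cube[of k] that
        by (auto simp: space_unit_cube PiE_iff extensional_def)
      show "\<And>i. i \<le> k \<Longrightarrow> ext k (sel k x) t i = ((rep k)(k := t)) i" using that by (auto simp: ext_def rep_def)
    qed fact
    have rep_upd: "(rep k)(k := u k) = rep k" if "k < N" for k using that by (auto simp: rep_def fun_eq_iff)
    have rep_eq: "\<forall>j. k \<le> j \<longrightarrow> j < N \<longrightarrow> Q (rep k) j = Q u j" if "k \<le> N" for k
      using that
    proof (induction k)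
      case 0
      have "rep 0 = u" using u by (auto simp: rep_def space_unit_cube PiE_def extensional_def fun_eq_iff)
      then show ?case by simp
    next
      case (Suc k)
      then have k: "k < N" by simp
      let ?f = "Qk k (sel k x)"
      have fu: "?f (u k) = x k"
        using Qk_rep[OF k u01[OF k]] rep_upd[OF k] Suc k by (simp add: x_def)
      have mid: "0 < c k (sel k x) (x k)" "c k (sel k x) (x k) < 1" "?f (c k (sel k x) (x k)) = x k"
        using level_set_midpoint[of ?f "u k", OF Qk_mono[OF k sel_cube[of k]]] k u01[OF k]
        unfolding fu c_def lo_def hi_def by auto
      define m where "m = mid k (sel k x, x k)"
      have m: "0 < m" "m < 1" "?f m = x k" using mid by (auto simp: m_def mid_def)
      have rS: "rep (Suc k) = (rep k)(k := m)"
        using k by (auto simp: rep_def fun_eq_iff sel_def m_def)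
      have eq: "Q ((rep k)(k := m)) k = Q (rep k) k"
        using Qk_rep[OF k m(1,2)] m(3) fu Qk_rep[OF k u01[OF k]] rep_upd[OF k] by simp
      show ?case
      proof (intro allI impI)
        fix j assume j: "Suc k \<le> j" "j < N"
        \<comment> \<open>Condition (con) only speaks about raising a variable. If the midpoint lies
          below \<open>u k\<close>, it is applied at the midpoint and raises the variable back to
          \<open>u k\<close>.\<close>
        have "Q ((rep k)(k := m)) j = Q (rep k) j"
        proof (cases "rep k k \<le> m")
          case True
          then show ?thesis using con[of "rep k" k m j] rep_cube[of k] k m eq j by auto
        next
          case False
          have rk: "rep k k = u k" using k by (simp add: rep_def)
          have "(rep k)(k := m, k := u k) = rep k" using rep_upd[OF k] by (simp add: fun_upd_upd)
          moreover have "(rep k)(k := m) \<in> space (unit_cube N)" using rep_cube[of "Suc k"] rS k by simp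
          ultimately show ?thesis
            using con[of "(rep k)(k := m)" k "u k" j] k m eq j False u01[OF k] rk by auto
        qed
        then show "Q (rep (Suc k)) j = Q u j" using Suc j rS by simp
      qed
    qed
    show "Q u k = q k (restrict (Q u) {0..<k}, u k)" if k: "k < N" for k
      using rep_eq[of k] Qk_rep[OF k u01[OF k]] rep_upd[OF k] k
      by (simp add: q_def sel_def path_restrict x_def)
  qed
  ultimately show ?thesis by (rule that)
qed

subsection \<open>Conditional quantiles and existence of quantile processes\<close>

lemma real_measure_eqI_lessThan:
  fixes M N :: "real measure"
  assumes "finite_measure M" "sets M = sets borel" "sets N = sets borel"
    and "\<And>c. emeasure M {..<c} = emeasure N {..<c}"
  shows "M = N"
proof (rule measure_eqI_generator_eq)
  interpret finite_measure M by fact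
  let ?E = "range (\<lambda>c::real. {..<c})"
  have "{..<a} \<inter> {..<b} = {..<min a b}" for a b :: real by auto
  then show "Int_stable ?E" by (auto simp: Int_stable_def)
  show "sets M = sigma_sets UNIV ?E" "sets N = sigma_sets UNIV ?E"
    using assms by (simp_all add: borel_Iio)
  show "range (\<lambda>n::nat. {..<real n}) \<subseteq> ?E" by auto
  show "(\<Union>n::nat. {..<real n}) = UNIV" using reals_Archimedean2 by auto
  show "emeasure M {..<real n} \<noteq> \<infinity>" for n by simp
qed (use assms in auto)

text \<open>Writes \<open>{..<c}\<close> as an increasing union of rational half-lines, open or
  closed, so that statements about conditional distribution functions need only countably many
  exceptional null sets.\<close>

lemma incseq_rat_below:
  fixes c :: real
  obtains rs :: "nat \<Rightarrow> rat" where "incseq rs" "\<And>n. real_of_rat (rs n) < c"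
    "\<And>y. y < c \<Longrightarrow> \<exists>n. y < real_of_rat (rs n)"
proof -
  have "\<exists>rs :: nat \<Rightarrow> rat. \<forall>n. (real_of_rat (rs n) < c \<and> c - 1 / real (Suc n) < real_of_rat (rs n)) \<and> rs n \<le> rs (Suc n)"
  proof (rule dependent_nat_choice)
    show "\<exists>x. real_of_rat x < c \<and> c - 1 / real (Suc 0) < real_of_rat x"
      using of_rat_dense[of "c - 1" c] by auto
    fix x n assume "real_of_rat x < c \<and> c - 1 / real (Suc n) < real_of_rat x"
    then have "max (real_of_rat x) (c - 1 / real (Suc (Suc n))) < c" by simp
    then obtain y where "max (real_of_rat x) (c - 1 / real (Suc (Suc n))) < real_of_rat y" "real_of_rat y < c"
      using of_rat_dense by blast
    moreover from this(1) have "x \<le> y"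
      by (simp only: max_less_iff_conj of_rat_less less_imp_le)
    ultimately show "\<exists>y. (real_of_rat y < c \<and> c - 1 / real (Suc (Suc n)) < real_of_rat y) \<and> x \<le> y"
      by (intro exI[of _ y]) (simp only: max_less_iff_conj)
  qed
  then obtain rs :: "nat \<Rightarrow> rat" where rs: "\<And>n. real_of_rat (rs n) < c" "\<And>n. c - 1 / real (Suc n) < real_of_rat (rs n)"
    "\<And>n. rs n \<le> rs (Suc n)" by blast
  have "(\<lambda>n. c - 1 / real (Suc n)) \<longlonglongrightarrow> c - 0"
    by (intro tendsto_diff tendsto_const LIMSEQ_Suc[OF lim_1_over_n])
  then have lim: "(\<lambda>n. c - 1 / real (Suc n)) \<longlonglongrightarrow> c" by simp
  have lim': "(\<lambda>n. real_of_rat (rs n)) \<longlonglongrightarrow> c"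
    by (rule tendsto_sandwich[OF _ _ lim tendsto_const])
      (simp_all only: always_eventually rs less_imp_le simp_thms)
  moreover have "incseq rs" using rs(3) by (rule incseq_SucI)
  moreover have "\<exists>n. y < real_of_rat (rs n)" if "y < c" for y
    using order_tendstoD(1)[OF lim' that] by (auto simp: eventually_sequentially)
  ultimately show ?thesis using rs(1) that by blast
qed

lemma real_measure_eqI_rat:
  fixes M N :: "real measure"
  assumes "finite_measure M" and s: "sets M = sets borel" "sets N = sets borel"
    and eq: "\<And>r. emeasure M {..<real_of_rat r} = emeasure N {..<real_of_rat r}"
  shows "M = N"
proof (rule real_measure_eqI_lessThan)
  fix c :: real
  obtain rs :: "nat \<Rightarrow> rat" where rs: "incseq rs" "\<And>n. real_of_rat (rs n) < c"
    "\<And>y. y < c \<Longrightarrow> \<exists>n. y < real_of_rat (rs n)" by (rule incseq_rat_below) blast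
  have inc: "incseq (\<lambda>n. {..<real_of_rat (rs n)})"
  proof (rule incseq_SucI)
    fix n
    have "real_of_rat (rs n) \<le> real_of_rat (rs (Suc n))"
      using incseq_SucD[OF rs(1)] by (simp only: of_rat_less_eq)
    then show "{..<real_of_rat (rs n)} \<subseteq> {..<real_of_rat (rs (Suc n))}" by auto
  qed
  have c: "{..<c} = (\<Union>n. {..<real_of_rat (rs n)})"
    using rs(2,3) by (auto intro: less_trans)
  have lim: "(SUP n. emeasure L {..<real_of_rat (rs n)}) = emeasure L {..<c}"
    if L: "sets L = sets borel" for L :: "real measure"
    unfolding c
  proof (rule SUP_emeasure_incseq[OF _ inc])
    show "range (\<lambda>n. {..<real_of_rat (rs n)}) \<subseteq> sets L" unfolding L by auto
  qed
  show "emeasure M {..<c} = emeasure N {..<c}"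
    unfolding lim[OF s(1), symmetric] lim[OF s(2), symmetric] eq ..
qed fact+

text \<open>For fixed \<open>A\<close>, the slice sending \<open>B\<close> to the mass of
  \<open>A \<times> B\<close> is a finite measure on the line and is determined by half-lines. This
  gives equality on all rectangles, which generate the product.\<close>

lemma pair_measure_eqI_lessThan:
  fixes P :: "('a \<times> real) measure"
  assumes P: "finite_measure P" "sets P = sets (S \<Otimes>\<^sub>M borel)"
    and P': "finite_measure P'" "sets P' = sets (S \<Otimes>\<^sub>M borel)"
    and eq: "\<And>A c. A \<in> sets S \<Longrightarrow> emeasure P (A \<times> {..<c}) = emeasure P' (A \<times> {..<c})"
  shows "P = P'"
proof -
  have rect: "emeasure P (A \<times> B) = emeasure P' (A \<times> B)" if A: "A \<in> sets S" and B: "B \<in> sets borel" for A B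
  proof -
    let ?D = "\<lambda>P. distr (density P (indicator (A \<times> UNIV))) borel snd"
    have *: "emeasure (?D P) B = emeasure P (A \<times> B)"
      if P: "finite_measure P" "sets P = sets (S \<Otimes>\<^sub>M borel)" and B: "B \<in> sets borel" for P :: "('a \<times> real) measure" and B
    proof -
      have [measurable_cong]: "sets P = sets (S \<Otimes>\<^sub>M borel)" by fact
      have sp: "space P = space S \<times> UNIV" using sets_eq_imp_space_eq[OF P(2)] by (simp add: space_pair_measure)
      have [measurable]: "A \<times> UNIV \<in> sets (S \<Otimes>\<^sub>M borel)" "B \<in> sets borel" using A B by auto
      have "emeasure (?D P) B = (\<integral>\<^sup>+x. indicator (A \<times> UNIV) x * indicator (snd -` B \<inter> space P) x \<partial>P)"
        by (subst emeasure_distr, measurable) (simp add: emeasure_density)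
      also have "\<dots> = (\<integral>\<^sup>+x. indicator (A \<times> B) x \<partial>P)"
        using sets.sets_into_space[OF A] by (intro nn_integral_cong) (auto split: split_indicator simp: sp)
      also have "\<dots> = emeasure P (A \<times> B)" using A by (intro nn_integral_indicator) simp
      finally show ?thesis .
    qed
    have "?D P = ?D P'"
    proof (rule real_measure_eqI_lessThan)
      show "finite_measure (?D P)"
      proof
        have "emeasure (?D P) UNIV = emeasure P (A \<times> UNIV)" using P by (intro *) auto
        then show "emeasure (?D P) (space (?D P)) \<noteq> \<infinity>"
          using finite_measure.emeasure_finite[OF P(1)] by simp
      qed
    qed (use P P' A eq * in auto)
    then show ?thesis using *[OF P B] *[OF P' B] by simp
  qed
  show ?thesis
  proof (rule measure_eqI_generator_eq[OF Int_stable_pair_measure_generator[of S borel]])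
    show "{a \<times> b |a b. a \<in> sets S \<and> b \<in> sets borel} \<subseteq> Pow (space S \<times> space borel)"
      using sets.sets_into_space by fastforce
    show "range (\<lambda>_::nat. space S \<times> UNIV) \<subseteq> {a \<times> b |a b. a \<in> sets S \<and> b \<in> sets (borel :: real measure)}"
      by auto (metis sets.top space_borel)
    show "emeasure P (space S \<times> UNIV) \<noteq> \<infinity>" for i :: nat using finite_measure.emeasure_finite[OF P(1)] by simp
  qed (use P P' rect in \<open>auto simp: sets_pair_measure\<close>)
qed

text \<open>Test with the set where \<open>g < f\<close>. A strict inequality on a set of positive
  measure would make the integrals over it strictly ordered, because the smaller one is finite.
  Inequalities between measures thereby pass to their densities.\<close>

lemma AE_le_if_set_nn_integral_le:
  assumes [measurable]: "f \<in> borel_measurable M" "g \<in> borel_measurable M"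
    and fin: "(\<integral>\<^sup>+x. f x \<partial>M) \<noteq> \<infinity>"
    and le: "\<And>A. A \<in> sets M \<Longrightarrow> (\<integral>\<^sup>+x. f x * indicator A x \<partial>M) \<le> (\<integral>\<^sup>+x. g x * indicator A x \<partial>M)"
  shows "AE x in M. f x \<le> g x"
proof -
  define A where "A = {x \<in> space M. g x < f x}"
  have [measurable]: "A \<in> sets M" by (simp add: A_def)
  have gf: "g x * indicator A x \<le> f x * indicator A x" for x
    by (auto simp: A_def split: split_indicator)
  have "(\<integral>\<^sup>+x. g x * indicator A x \<partial>M) \<le> (\<integral>\<^sup>+x. f x \<partial>M)"
    by (intro nn_integral_mono) (auto simp: A_def split: split_indicator)
  then have "(\<integral>\<^sup>+x. g x * indicator A x \<partial>M) \<noteq> \<infinity>" using fin by (auto simp: top_unique)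
  then have "AE x in M. f x * indicator A x \<le> g x * indicator A x"
    using nn_integral_less[of "\<lambda>x. g x * indicator A x" M "\<lambda>x. f x * indicator A x"] gf le[of A]
    by (auto simp: not_less[symmetric])
  then show ?thesis
    by (rule AE_mp) (auto intro!: AE_I2 simp: A_def not_less split: split_indicator_asm)
qed

text \<open>The conditional distribution function at rational points is a Radon--Nikodym derivative \<open>F r\<close>;
  \<open>H\<close> corrects it on the null set where it is not a distribution function, and \<open>q\<close> is the
  generalized inverse of \<open>H\<close>.\<close>

lemma conditional_quantile:
  fixes P :: "('a \<times> real) measure"
  assumes P: "prob_space P" "sets P = sets (S \<Otimes>\<^sub>M borel)"
  obtains q where "q \<in> borel_measurable (S \<Otimes>\<^sub>M unif01)"
    "\<forall>x\<in>space S. mono_on {0<..<1} (\<lambda>t. q (x, t))"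
    "P = distr (distr P S fst \<Otimes>\<^sub>M unif01) (S \<Otimes>\<^sub>M borel) (\<lambda>z. (fst z, q z))"
proof -
  interpret P: prob_space P by fact
  interpret U: prob_space unif01 by (rule prob_space_unif01)
  have [measurable_cong]: "sets P = sets (S \<Otimes>\<^sub>M borel)" by fact
  have spP: "space P = space S \<times> UNIV" using sets_eq_imp_space_eq[OF P(2)] by (simp add: space_pair_measure)
  define M where "M = distr P S fst"
  have sM [measurable_cong, simp]: "sets M = sets S" and spM [simp]: "space M = space S" by (simp_all add: M_def)
  interpret M: prob_space M unfolding M_def by (rule P.prob_space_distr) measurable
  define \<nu> where "\<nu> r = distr (density P (indicator (space S \<times> {..real_of_rat r}))) S fst" for r
  have \<nu>_sets [simp]: "sets (\<nu> r) = sets S" for r by (simp add: \<nu>_def)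
  have M_em: "emeasure M A = emeasure P (A \<times> UNIV)" if A: "A \<in> sets S" for A
  proof -
    have "fst -` A \<inter> space P = A \<times> UNIV" using sets.sets_into_space[OF A] by (auto simp: spP)
    then show ?thesis unfolding M_def using A by (subst emeasure_distr) auto
  qed
  have \<nu>_em: "emeasure (\<nu> r) A = emeasure P (A \<times> {..real_of_rat r})" if A: "A \<in> sets S" for A r
  proof -
    have [measurable]: "space S \<times> {..real_of_rat r} \<in> sets (S \<Otimes>\<^sub>M borel)" "A \<in> sets S" using A by auto
    have "emeasure (\<nu> r) A = (\<integral>\<^sup>+x. indicator (space S \<times> {..real_of_rat r}) x * indicator (fst -` A \<inter> space P) x \<partial>P)"
      unfolding \<nu>_def by (subst emeasure_distr, measurable) (simp add: emeasure_density)
    also have "\<dots> = (\<integral>\<^sup>+x. indicator (A \<times> {..real_of_rat r}) x \<partial>P)"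
      using sets.sets_into_space[OF A] by (intro nn_integral_cong) (auto split: split_indicator simp: spP)
    also have "\<dots> = emeasure P (A \<times> {..real_of_rat r})" using A by (intro nn_integral_indicator) simp
    finally show ?thesis .
  qed
  have \<nu>_le: "emeasure (\<nu> r) A \<le> emeasure M A" if "A \<in> sets S" for A r
    using that by (auto simp: \<nu>_em M_em intro!: emeasure_mono)
  define F where "F r = RN_deriv M (\<nu> r)" for r
  have F_m [measurable]: "F r \<in> borel_measurable S" for r
    unfolding F_def using borel_measurable_RN_deriv[of M "\<nu> r"] by (simp cong: measurable_cong_sets)
  have "density M (F r) = \<nu> r" for r
    unfolding F_def
  proof (rule M.density_RN_deriv)
    show "absolutely_continuous M (\<nu> r)"
      unfolding absolutely_continuous_def
      using \<nu>_le[of _ r] by (auto simp: null_sets_def)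
        (metis le_zero_eq)
  qed simp
  then have F_int: "(\<integral>\<^sup>+x. F r x * indicator A x \<partial>M) = emeasure P (A \<times> {..real_of_rat r})" if "A \<in> sets S" for A r
    using \<nu>_em[OF that, of r] emeasure_density[of "F r" M A] that by simp
  have F_fin: "(\<integral>\<^sup>+x. F r x \<partial>M) \<noteq> \<infinity>" for r
  proof -
    have "(\<integral>\<^sup>+x. F r x \<partial>M) = (\<integral>\<^sup>+x. F r x * indicator (space S) x \<partial>M)"
      by (intro nn_integral_cong) simp
    also have "\<dots> = emeasure P (space S \<times> {..real_of_rat r})" by (rule F_int) simp
    finally show ?thesis by simp
  qed
  have F_mono: "AE x in M. F r x \<le> F s x" if "r \<le> s" for r s
  proof (rule AE_le_if_set_nn_integral_le[OF _ _ F_fin])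
    have "real_of_rat r \<le> real_of_rat s" using that by (simp add: of_rat_less_eq)
    then have "A \<times> {..real_of_rat r} \<subseteq> A \<times> {..real_of_rat s}" for A :: "'a set" by auto
    then show "(\<integral>\<^sup>+x. F r x * indicator A x \<partial>M) \<le> (\<integral>\<^sup>+x. F s x * indicator A x \<partial>M)" if "A \<in> sets M" for A
      using that by (simp add: F_int emeasure_mono)
  qed auto
  have F_le1: "AE x in M. F r x \<le> 1" for r
    using F_fin
    by (rule AE_le_if_set_nn_integral_le[rotated 2])
      (auto simp: F_int M_em intro!: emeasure_mono)
  have F_top: "AE x in M. 1 \<le> (SUP n::nat. F (of_nat n) x)"
  proof (rule AE_le_if_set_nn_integral_le)
    fix A assume "A \<in> sets M" then have A [measurable]: "A \<in> sets S" by simp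
    have "(\<integral>\<^sup>+x. 1 * indicator A x \<partial>M) = emeasure P (A \<times> UNIV)" by (simp add: M_em)
    also have "A \<times> UNIV = (\<Union>n::nat. A \<times> {..real_of_rat (of_nat n)})"
      by (auto intro: real_arch_simple)
    also have "emeasure P \<dots> = (SUP n::nat. emeasure P (A \<times> {..real_of_rat (of_nat n)}))"
      by (rule SUP_emeasure_incseq[symmetric]) (auto simp: incseq_def)
    also have "\<dots> \<le> (\<integral>\<^sup>+x. (SUP n::nat. F (of_nat n) x) * indicator A x \<partial>M)"
      unfolding F_int[OF A, symmetric]
      by (intro SUP_least nn_integral_mono mult_right_mono SUP_upper) auto
    finally show "(\<integral>\<^sup>+x. 1 * indicator A x \<partial>M) \<le> (\<integral>\<^sup>+x. (SUP n::nat. F (of_nat n) x) * indicator A x \<partial>M)" .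
  qed auto
  have F_bot: "AE x in M. (INF n::nat. F (- of_nat n) x) \<le> 0"
  proof (rule AE_le_if_set_nn_integral_le)
    have *: "(\<integral>\<^sup>+x. (INF n::nat. F (- of_nat n) x) * indicator A x \<partial>M) \<le> 0" if A [measurable]: "A \<in> sets S" for A
    proof -
      have "(\<integral>\<^sup>+x. (INF n::nat. F (- of_nat n) x) * indicator A x \<partial>M) \<le> (INF n::nat. emeasure P (A \<times> {..real_of_rat (- of_nat n)}))"
        unfolding F_int[OF A, symmetric]
        by (intro INF_greatest nn_integral_mono mult_right_mono INF_lower) auto
      also have "\<dots> = emeasure P (\<Inter>n::nat. A \<times> {..real_of_rat (- of_nat n)})"
        by (rule INF_emeasure_decseq) (auto simp: decseq_def of_rat_minus)
      also have "(\<Inter>n::nat. A \<times> {..real_of_rat (- of_nat n)}) = {}"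
      proof -
        have False if "\<forall>n. y \<le> - real n" for y
        proof -
          obtain n where "- y < real n" using reals_Archimedean2 by blast
          with that show False by (metis minus_less_iff not_less)
        qed
        then show ?thesis by (auto simp: of_rat_minus)
      qed
      finally show ?thesis by simp
    qed
    show "(\<integral>\<^sup>+x. (INF n::nat. F (- of_nat n) x) * indicator A x \<partial>M) \<le> (\<integral>\<^sup>+x. 0 * indicator A x \<partial>M)" if "A \<in> sets M" for A
      using *[of A] that by simp
    have "(\<integral>\<^sup>+x. (INF n::nat. F (- of_nat n) x) \<partial>M) = (\<integral>\<^sup>+x. (INF n::nat. F (- of_nat n) x) * indicator (space S) x \<partial>M)"
      by (intro nn_integral_cong) simp
    then show "(\<integral>\<^sup>+x. (INF n::nat. F (- of_nat n) x) \<partial>M) \<noteq> \<infinity>" using *[of "space S"] by simp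
  qed auto
  \<comment> \<open>Monotonicity in the rational argument and the limits 0 and 1 at the two ends are
    what makes the sets \<open>L x t\<close> below nonempty and bounded below for
    \<open>0 < t < 1\<close>.\<close>
  define good where "good x \<longleftrightarrow> (\<forall>r s. r \<le> s \<longrightarrow> F r x \<le> F s x) \<and> (\<forall>r. F r x \<le> 1) \<and>
      1 \<le> (SUP n::nat. F (of_nat n) x) \<and> (INF n::nat. F (- of_nat n) x) \<le> 0" for x
  have [measurable]: "Measurable.pred S good" unfolding good_def by measurable
  have AE_good: "AE x in M. good x"
    unfolding good_def using F_mono F_le1 F_top F_bot by (simp add: AE_all_countable)
  \<comment> \<open>On the exceptional set the distribution function of the point mass at 0 is
    substituted.\<close>
  define H where "H r x = (if good x then F r x else if 0 \<le> r then 1 else 0)" for r x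
  have [measurable]: "H r \<in> borel_measurable S" for r unfolding H_def by measurable
  have H_mono: "H r x \<le> H s x" if "r \<le> s" for r s x using that by (auto simp: H_def good_def)
  have H_le1: "H r x \<le> 1" for r x by (auto simp: H_def good_def)
  have H_int: "(\<integral>\<^sup>+x. H r x * indicator A x \<partial>M) = emeasure P (A \<times> {..real_of_rat r})" if "A \<in> sets S" for A r
    unfolding F_int[OF that, symmetric]
    by (intro nn_integral_cong_AE) (use AE_good in \<open>auto simp: H_def\<close>)
  have H_large: "\<exists>r. ennreal t \<le> H r x" if "t < 1" for t x
  proof (cases "good x")
    case True
    then have "1 \<le> (SUP n::nat. F (of_nat n) x)" by (simp add: good_def)
    moreover have "ennreal t < 1" using that by (simp add: ennreal_less_one_iff)
    ultimately have "ennreal t < (SUP n::nat. F (of_nat n) x)" by order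
    then obtain n :: nat where "ennreal t < F (of_nat n) x" by (auto simp: less_SUP_iff)
    with True show ?thesis by (auto simp: H_def intro!: exI[of _ "of_nat n"])
  next
    case False
    with that show ?thesis by (auto simp: H_def ennreal_le_1 intro!: exI[of _ 0])
  qed
  have H_small: "\<exists>r. H r x < ennreal t" if "0 < t" for t x
  proof (cases "good x")
    case True
    then have "(INF n::nat. F (- of_nat n) x) \<le> 0" by (simp add: good_def)
    moreover have "0 < ennreal t" using that by simp
    ultimately have "(INF n::nat. F (- of_nat n) x) < ennreal t" by order
    then obtain n :: nat where "F (- of_nat n) x < ennreal t" by (auto simp: INF_less_iff)
    with True show ?thesis by (auto simp: H_def intro!: exI[of _ "- of_nat n"])
  next
    case False
    then have "H (-1) x = 0" by (simp add: H_def)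
    with that show ?thesis by (intro exI[of _ "-1"]) simp
  qed
  define L where "L x t = {real_of_rat r |r. ennreal t \<le> H r x}" for x t
  define q where "q z = Inf (L (fst z) (snd z))" for z
  have L_ne: "L x t \<noteq> {}" if "t < 1" for x t using H_large[OF that, of x] by (auto simp: L_def)
  have L_bdd: "bdd_below (L x t)" if t: "0 < t" for x t
  proof -
    obtain s where s: "H s x < ennreal t" using H_small[OF t] by blast
    have "real_of_rat s \<le> real_of_rat r" if "ennreal t \<le> H r x" for r
    proof -
      have "\<not> r \<le> s" using that s H_mono[of r s x] by (meson leD order_trans)
      then show ?thesis by (simp add: of_rat_less_eq)
    qed
    then show ?thesis by (intro bdd_belowI[of _ "real_of_rat s"]) (auto simp: L_def)
  qed
  \<comment> \<open>For a strict inequality the infimum turns into a countable existential. This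
    yields measurability of \<open>q\<close>, and it is the reason for comparing laws on half-lines
    \<open>{..<c}\<close>.\<close>
  have q_less: "q (x, t) < c \<longleftrightarrow> (\<exists>r. real_of_rat r < c \<and> ennreal t \<le> H r x)" if "0 < t" "t < 1" for x t c
    using cInf_less_iff[OF L_ne L_bdd, of t x c] that by (auto simp: q_def L_def)
  have q_m [measurable]: "q \<in> borel_measurable (S \<Otimes>\<^sub>M unif01)"
  proof (subst borel_measurable_iff_less, rule allI)
    fix c :: real
    have "{z \<in> space (S \<Otimes>\<^sub>M unif01). q z < c} =
        {z \<in> space (S \<Otimes>\<^sub>M unif01). \<exists>r. real_of_rat r < c \<and> ennreal (snd z) \<le> H r (fst z)}"
      using q_less by (auto simp: space_pair_measure space_restrict_space)
    also have "\<dots> \<in> sets (S \<Otimes>\<^sub>M unif01)" by measurable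
    finally show "{z \<in> space (S \<Otimes>\<^sub>M unif01). q z < c} \<in> sets (S \<Otimes>\<^sub>M unif01)" .
  qed
  have q_mono: "q (x, s) \<le> q (x, t)" if "0 < s" "s \<le> t" "t < 1" for x s t
    unfolding q_def fst_conv snd_conv
  proof (rule cInf_superset_mono[OF L_ne L_bdd])
    have "ennreal s \<le> ennreal t" using that by (intro ennreal_leI)
    then show "L x t \<subseteq> L x s" by (auto simp: L_def intro: order_trans)
  qed (use that in auto)
  have U_le: "emeasure unif01 {t \<in> space unif01. ennreal t \<le> y} = y" if "y \<le> 1" for y
  proof -
    obtain y' where y': "y = ennreal y'" "0 \<le> y'" "y' \<le> 1"
      using \<open>y \<le> 1\<close> by (cases y) (auto simp: ennreal_le_1 top_unique)
    have "{t \<in> space unif01. ennreal t \<le> y} = (if y' = 1 then {0<..<1} else {0<..y'})"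
      using y' by (auto simp: space_restrict_space)
    moreover have "emeasure unif01 {0<..y'} = y'" if "y' \<noteq> 1"
      using that y' by (subst emeasure_restrict_space) auto
    ultimately show ?thesis using y' U.emeasure_space_1 by (simp add: space_restrict_space)
  qed
  let ?D = "distr (M \<Otimes>\<^sub>M unif01) (S \<Otimes>\<^sub>M borel) (\<lambda>z. (fst z, q z))"
  interpret MU: prob_space "M \<Otimes>\<^sub>M unif01"
    by (rule prob_space_pair[OF M.prob_space_axioms U.prob_space_axioms])
  have "P = ?D"
  proof (rule pair_measure_eqI_lessThan)
    show "finite_measure ?D"
      by (intro prob_space.finite_measure MU.prob_space_distr) measurable
    fix A and c :: real assume A [measurable]: "A \<in> sets S"
    obtain rs :: "nat \<Rightarrow> rat" where rs: "incseq rs" "\<And>n. real_of_rat (rs n) < c"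
      and ex_rs: "\<And>y. y < c \<Longrightarrow> \<exists>n. y < real_of_rat (rs n)" by (rule incseq_rat_below) blast
    let ?B = "\<lambda>n. {z \<in> space (M \<Otimes>\<^sub>M unif01). fst z \<in> A \<and> ennreal (snd z) \<le> H (rs n) (fst z)}"
    have Bm [measurable]: "?B n \<in> sets (M \<Otimes>\<^sub>M unif01)" for n by measurable
    have "emeasure ?D (A \<times> {..<c}) = emeasure (M \<Otimes>\<^sub>M unif01) ((\<lambda>z. (fst z, q z)) -` (A \<times> {..<c}) \<inter> space (M \<Otimes>\<^sub>M unif01))"
      by (rule emeasure_distr) auto
    also have "(\<lambda>z. (fst z, q z)) -` (A \<times> {..<c}) \<inter> space (M \<Otimes>\<^sub>M unif01) = (\<Union>n. ?B n)"
    proof (intro set_eqI iffI)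
      fix z assume z: "z \<in> (\<lambda>z. (fst z, q z)) -` (A \<times> {..<c}) \<inter> space (M \<Otimes>\<^sub>M unif01)"
      then obtain r where r: "real_of_rat r < c" "ennreal (snd z) \<le> H r (fst z)"
        using q_less[of "snd z" "fst z" c] by (auto simp: space_pair_measure space_restrict_space)
      from ex_rs[OF r(1)] obtain n where "real_of_rat r < real_of_rat (rs n)" ..
      then have "ennreal (snd z) \<le> H (rs n) (fst z)"
        using r H_mono[of r "rs n" "fst z"] by (auto simp: of_rat_less)
      with z show "z \<in> (\<Union>n. ?B n)" by auto
    next
      fix z assume "z \<in> (\<Union>n. ?B n)"
      then show "z \<in> (\<lambda>z. (fst z, q z)) -` (A \<times> {..<c}) \<inter> space (M \<Otimes>\<^sub>M unif01)"
        using q_less[of "snd z" "fst z" c] rs(2) by (auto simp: space_pair_measure space_restrict_space)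
    qed
    also have "emeasure (M \<Otimes>\<^sub>M unif01) \<dots> = (SUP n. emeasure (M \<Otimes>\<^sub>M unif01) (?B n))"
    proof (rule SUP_emeasure_incseq[symmetric])
      show "incseq ?B"
      proof (rule incseq_SucI)
        fix n
        have "H (rs n) x \<le> H (rs (Suc n)) x" for x by (rule H_mono[OF incseq_SucD[OF rs(1)]])
        then show "?B n \<subseteq> ?B (Suc n)" by (auto intro: order_trans)
      qed
    qed (use Bm in blast)
    also have "(\<lambda>n. emeasure (M \<Otimes>\<^sub>M unif01) (?B n)) = (\<lambda>n. emeasure P (A \<times> {..real_of_rat (rs n)}))"
    proof
      fix n
      have "emeasure (M \<Otimes>\<^sub>M unif01) (?B n) = (\<integral>\<^sup>+x. emeasure unif01 (Pair x -` ?B n) \<partial>M)"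
        by (rule U.emeasure_pair_measure_alt[OF Bm])
      also have "\<dots> = (\<integral>\<^sup>+x. H (rs n) x * indicator A x \<partial>M)"
      proof (rule nn_integral_cong)
        fix x assume x: "x \<in> space M"
        have "Pair x -` ?B n = (if x \<in> A then {t \<in> space unif01. ennreal t \<le> H (rs n) x} else {})"
          using x by (auto simp: space_pair_measure)
        then show "emeasure unif01 (Pair x -` ?B n) = H (rs n) x * indicator A x"
          using U_le[OF H_le1] by simp
      qed
      also have "\<dots> = emeasure P (A \<times> {..real_of_rat (rs n)})" by (rule H_int[OF A])
      finally show "emeasure (M \<Otimes>\<^sub>M unif01) (?B n) = emeasure P (A \<times> {..real_of_rat (rs n)})" .
    qed
    also have "(SUP n. emeasure P (A \<times> {..real_of_rat (rs n)})) = emeasure P (\<Union>n. A \<times> {..real_of_rat (rs n)})"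
    proof (rule SUP_emeasure_incseq)
      show "incseq (\<lambda>n. A \<times> {..real_of_rat (rs n)})"
      proof (rule incseq_SucI)
        fix n
        have "real_of_rat (rs n) \<le> real_of_rat (rs (Suc n))"
          using incseq_SucD[OF rs(1)] by (simp only: of_rat_less_eq)
        then show "A \<times> {..real_of_rat (rs n)} \<subseteq> A \<times> {..real_of_rat (rs (Suc n))}" by auto
      qed
    qed auto
    also have "(\<Union>n. A \<times> {..real_of_rat (rs n)}) = A \<times> {..<c}"
    proof -
      have "\<exists>n. y \<le> real_of_rat (rs n)" if "y < c" for y using ex_rs[OF that] less_imp_le by blast
      then show ?thesis using rs(2) by (auto intro: order_le_less_trans)
    qed
    finally show "emeasure P (A \<times> {..<c}) = emeasure ?D (A \<times> {..<c})" ..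
  next
    show "finite_measure P" by (rule P.finite_measure_axioms)
    show "sets P = sets (S \<Otimes>\<^sub>M borel)" by fact
    show "sets ?D = sets (S \<Otimes>\<^sub>M borel)" by simp
  qed
  moreover have "\<forall>x\<in>space S. mono_on {0<..<1} (\<lambda>t. q (x, t))"
    using q_mono by (auto intro: mono_onI)
  ultimately show ?thesis using q_m unfolding M_def by (intro that)
qed

section \<open>Monotone recursions as quantile processes\<close>

lemma (in monotone_map) measurable_path: "path r n \<in> measurable (unit_cube n) (RN n)"
  by (rule path_measurable) simp

lemma (in monotone_map) path_coord_measurable: "i < n \<Longrightarrow> (\<lambda>u. path r n u i) \<in> borel_measurable (unit_cube n)"
  using measurable_compose[OF measurable_path measurable_component_singleton[of i "{0..<n}"]] by simp

lemma (in monotone_map) distr_path_eq_law: "distr (unit_cube n) (RN n) (path r n) = law n"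
  by (simp add: law_def)

lemma space_RN: "space (RN k) = extensional {0..<k}"
  by (auto simp: space_PiM PiE_def)

text \<open>Monotonicity gives (inc). For (con), the path sees \<open>u k\<close> only through the
  value of coordinate \<open>k\<close>: once these values agree, the recursion continues
  identically.\<close>

lemma (in monotone_map) quantile_process_path: "quantile_process N (path r N)"
  unfolding quantile_process_def triangular_def
proof (intro conjI allI impI ballI)
  show "path r N \<in> measurable (unit_cube N) (RN N)" by (rule path_measurable) simp
  show "path r N u k = path r N v k" if "k < N" "\<forall>i\<le>k. u i = v i" for k u v
  proof -
    have "path r (Suc k) u = path r (Suc k) v" using that by (intro path_cong) auto
    then show ?thesis using path_stable[OF that(1)] by metis
  qed
  fix u k and t :: real assume u: "u \<in> space (unit_cube N)" and k: "k < N" and t: "t \<in> {0<..<1}" and ut: "u k \<le> t"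
  have low: "path r k (u(k := t)) = path r k u" by (rule path_cong) simp
  have sp: "path r k u \<in> space (RN k)" by (auto simp: space_RN extensional_def path_outside)
  have "0 < u k" using u k by (auto simp: space_unit_cube PiE_iff)
  then show "path r N u k \<le> path r N (u(k := t)) k"
    using path_stable[OF k, of r] low r_mono[OF sp _ ut] t by simp
  fix m assume eq: "path r N u k = path r N (u(k := t)) k" and m: "k \<le> m \<and> m < N"
  have "path r (Suc j) u = path r (Suc j) (u(k := t))" if "k \<le> j" "j < N" for j
    using that
  proof (induction j rule: dec_induct)
    case base
    show ?case using eq low by (simp add: path_stable[OF k] del: fun_upd_apply) (simp only: fun_upd_same)
  next
    case (step j)
    then have IH: "path r (Suc j) u = path r (Suc j) (u(k := t))" by (simp del: path.simps fun_upd_apply)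
    have "u (Suc j) = (u(k := t)) (Suc j)" using step.hyps by simp
    then show ?case by (simp only: path.simps(2)[of r "Suc j"] IH)
  qed
  from this[of m] show "path r N u m = path r N (u(k := t)) m" using m by (metis path_stable)
qed

text \<open>\<open>conditional_quantile\<close> is applied to the joint law of the first
  \<open>k\<close> coordinates and coordinate \<open>k\<close>. Feeding the marginal of the past
  into the resulting \<open>q k\<close> reproduces this joint law, so by induction the law of the
  path is the marginal at every stage.\<close>

lemma ex_monotone_map:
  assumes mu: "prob_space \<mu>" "sets \<mu> = sets (RN N)"
  obtains q where "monotone_map q" "distr (unit_cube N) (RN N) (path q N) = \<mu>"
proof -
  interpret mu: prob_space \<mu> by fact
  have [measurable_cong]: "sets \<mu> = sets (RN N)" by fact
  define pre where "pre k = distr \<mu> (RN k) (\<lambda>x. restrict x {0..<k})" for k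
  have rm: "(\<lambda>x. restrict x {0..<k}) \<in> measurable \<mu> (RN k)" if "k \<le> N" for k
    using mu(2) measurable_restrict_subset[of "{0..<k}" "{0..<N}" "\<lambda>_. borel"] that
    by (simp cong: measurable_cong_sets)
  define P where "P k = distr \<mu> (RN k \<Otimes>\<^sub>M borel) (\<lambda>x. (restrict x {0..<k}, x k))" for k
  have Pm: "(\<lambda>x. (restrict x {0..<k}, x k)) \<in> measurable \<mu> (RN k \<Otimes>\<^sub>M borel)" if "k < N" for k
  proof -
    have "(\<lambda>x. x k) \<in> borel_measurable \<mu>"
      using that mu(2) measurable_component_singleton[of k "{0..<N}" "\<lambda>_. borel"] by (simp cong: measurable_cong_sets)
    then show ?thesis using rm[of k] that by (intro measurable_Pair) auto
  qed
  have ex: "\<exists>q. q \<in> borel_measurable (RN k \<Otimes>\<^sub>M unif01) \<and>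
      (\<forall>x\<in>space (RN k). mono_on {0<..<1} (\<lambda>t. q (x, t))) \<and>
      (k < N \<longrightarrow> P k = distr (pre k \<Otimes>\<^sub>M unif01) (RN k \<Otimes>\<^sub>M borel) (\<lambda>z. (fst z, q z)))" for k
  proof (cases "k < N")
    case True
    have pP: "prob_space (P k)" unfolding P_def by (rule mu.prob_space_distr[OF Pm[OF True]])
    have dP: "distr (P k) (RN k) fst = pre k"
      unfolding P_def pre_def by (subst distr_distr[OF measurable_fst Pm[OF True]]) (simp add: comp_def)
    have sP: "sets (P k) = sets (RN k \<Otimes>\<^sub>M borel)" by (simp add: P_def)
    obtain q where "q \<in> borel_measurable (RN k \<Otimes>\<^sub>M unif01)"
      "\<forall>x\<in>space (RN k). mono_on {0<..<1} (\<lambda>t. q (x, t))"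
      "P k = distr (distr (P k) (RN k) fst \<Otimes>\<^sub>M unif01) (RN k \<Otimes>\<^sub>M borel) (\<lambda>z. (fst z, q z))"
      by (rule conditional_quantile[OF pP sP])
    from this[unfolded dP] show ?thesis by blast
  next
    \<comment> \<open>The locale asks for a map at every index; from \<open>N\<close> on the zero
      map serves.\<close>
    case False
    then show ?thesis by (intro exI[of _ "\<lambda>_. 0"]) (auto intro: mono_onI)
  qed
  from choice[OF allI[OF ex]] obtain q where q': "\<forall>k. q k \<in> borel_measurable (RN k \<Otimes>\<^sub>M unif01) \<and>
      (\<forall>x\<in>space (RN k). mono_on {0<..<1} (\<lambda>t. q k (x, t))) \<and>
      (k < N \<longrightarrow> P k = distr (pre k \<Otimes>\<^sub>M unif01) (RN k \<Otimes>\<^sub>M borel) (\<lambda>z. (fst z, q k z)))"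
    by (rule exE)
  then have q: "\<And>k. q k \<in> borel_measurable (RN k \<Otimes>\<^sub>M unif01)"
    "\<And>k. \<forall>x\<in>space (RN k). mono_on {0<..<1} (\<lambda>t. q k (x, t))"
    "\<And>k. k < N \<Longrightarrow> P k = distr (pre k \<Otimes>\<^sub>M unif01) (RN k \<Otimes>\<^sub>M borel) (\<lambda>z. (fst z, q k z))"
    by simp_all
  interpret monotone_map q
  proof
    show "q k (w, s) \<le> q k (w, t)" if "w \<in> space (RN k)" "0 < s" "s \<le> t" "t < 1" for k w s t
      using mono_onD[OF bspec[OF q(2) that(1)], of s t] that by simp
  qed (rule q(1))
  have "law k = pre k" if "k \<le> N" for k
    using that
  proof (induction k)
    case 0
    have sp: "space (RN 0) = {\<lambda>_. undefined}" by (simp add: space_PiM)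
    show ?case
    proof (rule measure_eqI)
      fix A assume "A \<in> sets (law 0)"
      then have "A \<subseteq> {\<lambda>_. undefined}" using sets.sets_into_space[of A "RN 0"] sp by simp
      then have "A = {} \<or> A = space (law 0)" "space (law 0) = space (pre 0)"
        using sp by (auto simp: law_def pre_def)
      then show "emeasure (law 0) A = emeasure (pre 0) A"
        using prob_space.emeasure_space_1[OF prob_space_law[of 0]]
          prob_space.emeasure_space_1[OF mu.prob_space_distr[OF rm[of 0]]] by (auto simp: pre_def)
    qed (simp add: pre_def)
  next
    case (Suc k)
    then have k: "k < N" and IH: "law k = pre k" by auto
    have spre: "sets (pre k) = sets (RN k)" by (simp add: pre_def)
    have up: "(\<lambda>(w, a). w(k := a)) \<in> measurable (RN k \<Otimes>\<^sub>M borel) (RN (Suc k))"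
      by (rule measurable_fun_upd_Suc)
    have qm: "(\<lambda>z. (fst z, q k z)) \<in> measurable (pre k \<Otimes>\<^sub>M unif01) (RN k \<Otimes>\<^sub>M borel)"
      using spre by (simp cong: measurable_cong_sets)
    have "law (Suc k) = distr (P k) (RN (Suc k)) (\<lambda>(w, a). w(k := a))"
      unfolding q(3)[OF k] law_Suc IH by (subst distr_distr[OF up qm]) (simp add: comp_def)
    also have "\<dots> = pre (Suc k)"
      unfolding P_def pre_def by (subst distr_distr[OF up Pm[OF k]])
        (auto simp: comp_def fun_eq_iff restrict_def less_Suc_eq intro!: arg_cong[where f="distr _ _"])
    finally show ?case .
  qed
  from this[of N] have "law N = pre N" by simp
  also have "pre N = distr \<mu> \<mu> (\<lambda>x. x)"
    unfolding pre_def using mu(2) sets_eq_imp_space_eq[OF mu(2)]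
    by (intro distr_cong) (auto simp: space_RN extensional_restrict)
  finally have "law N = \<mu>" by (simp add: distr_id2)
  then show ?thesis using that[OF monotone_map_axioms] by (simp add: law_def)
qed

text \<open>Existence makes the choice in \<open>quantile_map\<close> meaningful, and the
  factorization turns whichever process was chosen into a path. Later arguments work with this path
  and never with the choice.\<close>

lemma quantile_map_path:
  assumes "prob_space \<mu>" "sets \<mu> = sets (RN N)"
  obtains q where "monotone_map q" "distr (unit_cube N) (RN N) (path q N) = \<mu>"
    "\<And>u. u \<in> space (unit_cube N) \<Longrightarrow> quantile_map N \<mu> u = path q N u"
proof -
  obtain q0 where q0: "monotone_map q0" "distr (unit_cube N) (RN N) (path q0 N) = \<mu>"
    using ex_monotone_map[OF assms] by blast
  have "quantile_process N (quantile_map N \<mu>) \<and> distr (unit_cube N) (RN N) (quantile_map N \<mu>) = \<mu>"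
    unfolding quantile_map_def
    by (rule someI[where x="path q0 N"]) (use q0 monotone_map.quantile_process_path in auto)
  then have qm: "quantile_process N (quantile_map N \<mu>)" "distr (unit_cube N) (RN N) (quantile_map N \<mu>) = \<mu>" by auto
  obtain q where q: "monotone_map q" "\<And>u. u \<in> space (unit_cube N) \<Longrightarrow> quantile_map N \<mu> u = path q N u"
    using quantile_process_factorization[OF qm(1)] by blast
  have "distr (unit_cube N) (RN N) (path q N) = distr (unit_cube N) (RN N) (quantile_map N \<mu>)"
    by (intro distr_cong) (use q(2) in auto)
  then show ?thesis using that[OF q(1) _ q(2)] qm by simp
qed

subsection \<open>Approximation by Lipschitz functions\<close>

text \<open>Distances are measured after applying \<open>arctan\<close>: monotone couplings are not optimal for the concave
  cost of the case \<open>p = 0\<close>, but they are for \<open>\<bar>arctan x - arctan y\<bar>\<close>, which is bounded and induces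
  the same convergence in probability to a fixed limit.\<close>

definition arctan_dist :: "nat \<Rightarrow> (nat \<Rightarrow> real) \<Rightarrow> (nat \<Rightarrow> real) \<Rightarrow> real" where
  "arctan_dist k x y = (\<Sum>i<k. \<bar>arctan (x i) - arctan (y i)\<bar>)"

lemma arctan_dist_nonneg: "0 \<le> arctan_dist k x y"
  by (simp add: arctan_dist_def sum_nonneg)

text \<open>Lipschitz in the past but only measurable in the uniform variable: two processes to be
  compared have different pasts and share \<open>t\<close>. Boundedness makes the class closed under
  products.\<close>

definition bounded_lipschitz :: "nat \<Rightarrow> ((nat \<Rightarrow> real) \<times> real \<Rightarrow> real) \<Rightarrow> bool" where
  "bounded_lipschitz k \<phi> \<longleftrightarrow> \<phi> \<in> borel_measurable (RN k \<Otimes>\<^sub>M unif01) \<and> (\<exists>C. \<forall>z. \<bar>\<phi> z\<bar> \<le> C) \<and>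
     (\<exists>L. \<forall>x y t. \<bar>\<phi> (x, t) - \<phi> (y, t)\<bar> \<le> L * arctan_dist k x y)"

lemma bounded_lipschitzI:
  assumes "\<phi> \<in> borel_measurable (RN k \<Otimes>\<^sub>M unif01)" "\<And>z. \<bar>\<phi> z\<bar> \<le> C"
    "\<And>x y t. \<bar>\<phi> (x, t) - \<phi> (y, t)\<bar> \<le> L * arctan_dist k x y"
  shows "bounded_lipschitz k \<phi>"
  using assms unfolding bounded_lipschitz_def by blast

lemma bounded_lipschitz_measurable:
  "bounded_lipschitz k \<phi> \<Longrightarrow> \<phi> \<in> borel_measurable (RN k \<Otimes>\<^sub>M unif01)"
  by (simp add: bounded_lipschitz_def)

lemma bounded_lipschitz_const: "bounded_lipschitz k (\<lambda>_. c)"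
  by (rule bounded_lipschitzI[where C="\<bar>c\<bar>" and L=0]) auto

lemma bounded_lipschitz_add:
  assumes "bounded_lipschitz k \<phi>" "bounded_lipschitz k \<psi>"
  shows "bounded_lipschitz k (\<lambda>z. \<phi> z + \<psi> z)"
proof -
  obtain C L where 1: "\<And>z. \<bar>\<phi> z\<bar> \<le> C" "\<And>x y t. \<bar>\<phi> (x, t) - \<phi> (y, t)\<bar> \<le> L * arctan_dist k x y"
    using assms(1) by (auto simp: bounded_lipschitz_def)
  obtain C' L' where 2: "\<And>z. \<bar>\<psi> z\<bar> \<le> C'" "\<And>x y t. \<bar>\<psi> (x, t) - \<psi> (y, t)\<bar> \<le> L' * arctan_dist k x y"
    using assms(2) by (auto simp: bounded_lipschitz_def)
  have "\<bar>\<phi> z + \<psi> z\<bar> \<le> C + C'" for z using 1(1)[of z] 2(1)[of z] by linarith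
  moreover have "\<bar>(\<phi> (x, t) + \<psi> (x, t)) - (\<phi> (y, t) + \<psi> (y, t))\<bar> \<le> (L + L') * arctan_dist k x y" for x y t
    using 1(2)[of x t y] 2(2)[of x t y] by (simp add: distrib_right)
  ultimately show ?thesis
    by (rule bounded_lipschitzI[OF borel_measurable_add[OF assms[THEN bounded_lipschitz_measurable]]])
qed

lemma bounded_lipschitz_mult:
  assumes "bounded_lipschitz k \<phi>" "bounded_lipschitz k \<psi>"
  shows "bounded_lipschitz k (\<lambda>z. \<phi> z * \<psi> z)"
proof -
  obtain C L where 1: "\<And>z. \<bar>\<phi> z\<bar> \<le> C" "\<And>x y t. \<bar>\<phi> (x, t) - \<phi> (y, t)\<bar> \<le> L * arctan_dist k x y"
    using assms(1) by (auto simp: bounded_lipschitz_def)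
  obtain C' L' where 2: "\<And>z. \<bar>\<psi> z\<bar> \<le> C'" "\<And>x y t. \<bar>\<psi> (x, t) - \<psi> (y, t)\<bar> \<le> L' * arctan_dist k x y"
    using assms(2) by (auto simp: bounded_lipschitz_def)
  have C: "0 \<le> C" "0 \<le> C'" using 1(1)[of undefined] 2(1)[of undefined] by linarith+
  have "\<bar>\<phi> z * \<psi> z\<bar> \<le> C * C'" for z unfolding abs_mult using 1(1)[of z] 2(1)[of z] C by (intro mult_mono) auto
  moreover have "\<bar>\<phi> (x, t) * \<psi> (x, t) - \<phi> (y, t) * \<psi> (y, t)\<bar> \<le> (C * L' + C' * L) * arctan_dist k x y" for x y t
  proof -
    have "\<phi> (x, t) * \<psi> (x, t) - \<phi> (y, t) * \<psi> (y, t) =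
        \<phi> (x, t) * (\<psi> (x, t) - \<psi> (y, t)) + \<psi> (y, t) * (\<phi> (x, t) - \<phi> (y, t))" by (simp add: algebra_simps)
    also have "\<bar>\<dots>\<bar> \<le> \<bar>\<phi> (x, t)\<bar> * \<bar>\<psi> (x, t) - \<psi> (y, t)\<bar> + \<bar>\<psi> (y, t)\<bar> * \<bar>\<phi> (x, t) - \<phi> (y, t)\<bar>"
      by (metis abs_mult abs_triangle_ineq)
    also have "\<dots> \<le> C * (L' * arctan_dist k x y) + C' * (L * arctan_dist k x y)"
      using 1(1)[of "(x, t)"] 1(2)[of x t y] 2(1)[of "(y, t)"] 2(2)[of x t y] C by (intro add_mono mult_mono) auto
    finally show ?thesis by (simp add: algebra_simps)
  qed
  ultimately show ?thesis
    by (rule bounded_lipschitzI[OF borel_measurable_times[OF assms[THEN bounded_lipschitz_measurable]]])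
qed

abbreviation L1_dist :: "'a measure \<Rightarrow> ('a \<Rightarrow> real) \<Rightarrow> ('a \<Rightarrow> real) \<Rightarrow> ennreal" where
  "L1_dist M f g \<equiv> \<integral>\<^sup>+z. ennreal \<bar>f z - g z\<bar> \<partial>M"

definition approximable :: "nat \<Rightarrow> ((nat \<Rightarrow> real) \<times> real) measure \<Rightarrow> ((nat \<Rightarrow> real) \<times> real \<Rightarrow> real) \<Rightarrow> bool" where
  "approximable k M h \<longleftrightarrow> (\<forall>e>0. \<exists>\<phi>. bounded_lipschitz k \<phi> \<and> L1_dist M h \<phi> < ennreal e)"

lemma approximable_bounded_lipschitz: "bounded_lipschitz k \<phi> \<Longrightarrow> approximable k M \<phi>"
  unfolding approximable_def by (auto intro!: exI[of _ \<phi>])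

lemma L1_dist_add_less:
  assumes [measurable]: "f \<in> borel_measurable M" "f' \<in> borel_measurable M" "g \<in> borel_measurable M" "g' \<in> borel_measurable M"
    and lt: "L1_dist M f g < ennreal (e / 2)" "L1_dist M f' g' < ennreal (e / 2)" and e: "0 < e"
  shows "(\<integral>\<^sup>+z. ennreal \<bar>f z + f' z - (g z + g' z)\<bar> \<partial>M) < ennreal e"
proof -
  have "(\<integral>\<^sup>+z. ennreal \<bar>f z + f' z - (g z + g' z)\<bar> \<partial>M) \<le> (\<integral>\<^sup>+z. ennreal \<bar>f z - g z\<bar> + ennreal \<bar>f' z - g' z\<bar> \<partial>M)"
    by (intro nn_integral_mono) (simp flip: ennreal_plus)
  also have "\<dots> = L1_dist M f g + L1_dist M f' g'"
    by (intro nn_integral_add) measurable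
  also have "\<dots> < ennreal (e / 2) + ennreal (e / 2)" using lt by (intro add_strict_mono)
  also have "\<dots> = ennreal e" using e by (simp flip: ennreal_plus)
  finally show ?thesis .
qed

lemma approximable_close:
  assumes sM: "sets M = sets (RN k \<Otimes>\<^sub>M unif01)" and h: "h \<in> borel_measurable M"
    and "\<And>e. 0 < e \<Longrightarrow> \<exists>h'. h' \<in> borel_measurable M \<and> approximable k M h' \<and> L1_dist M h h' < ennreal e"
  shows "approximable k M h"
  unfolding approximable_def
proof (intro allI impI)
  fix e :: real assume e: "0 < e"
  then obtain h' where h': "h' \<in> borel_measurable M" "approximable k M h'" "L1_dist M h h' < ennreal (e/2)"
    using assms(3)[of "e/2"] by auto
  then obtain \<phi> where \<phi>: "bounded_lipschitz k \<phi>" "L1_dist M h' \<phi> < ennreal (e/2)"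
    using e unfolding approximable_def by (meson half_gt_zero)
  have "\<phi> \<in> borel_measurable M"
    using bounded_lipschitz_measurable[OF \<phi>(1)] sM by (simp cong: measurable_cong_sets)
  from L1_dist_add_less[OF h h'(1) h'(1) this h'(3) \<phi>(2) e] have "L1_dist M h \<phi> < ennreal e" by simp
  then show "\<exists>\<phi>. bounded_lipschitz k \<phi> \<and> L1_dist M h \<phi> < ennreal e"
    using \<phi>(1) by blast
qed

lemma approximable_limit:
  assumes sM: "sets M = sets (RN k \<Otimes>\<^sub>M unif01)" and h: "h \<in> borel_measurable M"
    and s: "\<And>n. s n \<in> borel_measurable M" "\<And>n. approximable k M (s n)"
    and w: "integrable M w" "\<And>n z. z \<in> space M \<Longrightarrow> \<bar>s n z\<bar> \<le> w z" "\<And>z. z \<in> space M \<Longrightarrow> \<bar>h z\<bar> \<le> w z"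
    and lim: "\<And>z. z \<in> space M \<Longrightarrow> (\<lambda>n. s n z) \<longlonglongrightarrow> h z"
  shows "approximable k M h"
proof (rule approximable_close[OF sM h])
  fix e :: real assume e: "0 < e"
  note [measurable] = h s(1)
  have "(\<lambda>n. \<integral>\<^sup>+z. ennreal (norm (h z - s n z)) \<partial>M) \<longlonglongrightarrow> 0"
  proof (rule nn_integral_dominated_convergence_norm[where w=w])
    show "(\<integral>\<^sup>+z. ennreal (w z) \<partial>M) < \<infinity>" using integrableD(2)[OF w(1)] w(1) by (simp add: real_integrable_def top.not_eq_extremum)
  qed (use w lim in auto)
  then have "(\<lambda>n. \<integral>\<^sup>+z. ennreal \<bar>h z - s n z\<bar> \<partial>M) \<longlonglongrightarrow> 0" by simp
  then have "eventually (\<lambda>n. (\<integral>\<^sup>+z. ennreal \<bar>h z - s n z\<bar> \<partial>M) < ennreal e) sequentially"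
    using e by (intro order_tendstoD) auto
  then obtain n where "(\<integral>\<^sup>+z. ennreal \<bar>h z - s n z\<bar> \<partial>M) < ennreal e"
    by (auto simp: eventually_sequentially)
  then show "\<exists>h'. h' \<in> borel_measurable M \<and> approximable k M h' \<and> L1_dist M h h' < ennreal e"
    using s by blast
qed

lemma approximable_add:
  assumes sM: "sets M = sets (RN k \<Otimes>\<^sub>M unif01)" and m [measurable]: "h \<in> borel_measurable M" "h' \<in> borel_measurable M"
    and ap: "approximable k M h" "approximable k M h'"
  shows "approximable k M (\<lambda>z. h z + h' z)"
  unfolding approximable_def
proof (intro allI impI)
  fix e :: real assume e: "0 < e"
  obtain \<phi> where \<phi>: "bounded_lipschitz k \<phi>" "L1_dist M h \<phi> < ennreal (e/2)"
    using e ap(1) unfolding approximable_def by (meson half_gt_zero)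
  obtain \<psi> where \<psi>: "bounded_lipschitz k \<psi>" "L1_dist M h' \<psi> < ennreal (e/2)"
    using e ap(2) unfolding approximable_def by (meson half_gt_zero)
  have "\<phi> \<in> borel_measurable M" "\<psi> \<in> borel_measurable M"
    using bounded_lipschitz_measurable[OF \<phi>(1)] bounded_lipschitz_measurable[OF \<psi>(1)] sM by (simp_all cong: measurable_cong_sets)
  from L1_dist_add_less[OF m this \<phi>(2) \<psi>(2) e]  show "\<exists>\<phi>. bounded_lipschitz k \<phi> \<and> (\<integral>\<^sup>+z. ennreal \<bar>h z + h' z - \<phi> z\<bar> \<partial>M) < ennreal e"
    using bounded_lipschitz_add[OF \<phi>(1) \<psi>(1)] by blast
qed

lemma approximable_mult:
  assumes sM: "sets M = sets (RN k \<Otimes>\<^sub>M unif01)" and m [measurable]: "h \<in> borel_measurable M" "h' \<in> borel_measurable M"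
    and h': "\<And>z. \<bar>h' z\<bar> \<le> B" and ap: "approximable k M h" "approximable k M h'"
  shows "approximable k M (\<lambda>z. h z * h' z)"
  unfolding approximable_def
proof (intro allI impI)
  fix e :: real assume e: "0 < e"
  have B: "0 \<le> B" using h'[of undefined] by linarith
  define d where "d = e / (2 * (B + 1))"
  have d: "0 < d" "B * d \<le> e / 2" using e B by (auto simp: d_def field_simps)
  obtain \<phi> where \<phi>: "bounded_lipschitz k \<phi>" "L1_dist M h \<phi> < ennreal d"
    using d ap(1) unfolding approximable_def by meson
  obtain C where C: "\<And>z. \<bar>\<phi> z\<bar> \<le> C" using \<phi>(1) by (auto simp: bounded_lipschitz_def)
  have C0: "0 \<le> C" using C[of undefined] by linarith
  \<comment> \<open>The bound \<open>C\<close> of \<open>\<phi>\<close> is known only after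
    \<open>\<phi>\<close> has been chosen, so the precision for \<open>h'\<close> is fixed
    second.\<close>
  define d' where "d' = e / (2 * (C + 1))"
  have d': "0 < d'" "C * d' < e / 2" using e C0 by (auto simp: d'_def field_simps)
  obtain \<psi> where \<psi>: "bounded_lipschitz k \<psi>" "L1_dist M h' \<psi> < ennreal d'"
    using d' ap(2) unfolding approximable_def by meson
  have [measurable]: "\<phi> \<in> borel_measurable M" "\<psi> \<in> borel_measurable M"
    using bounded_lipschitz_measurable[OF \<phi>(1)] bounded_lipschitz_measurable[OF \<psi>(1)] sM by (simp_all cong: measurable_cong_sets)
  have "\<bar>h z * h' z - \<phi> z * \<psi> z\<bar> \<le> B * \<bar>h z - \<phi> z\<bar> + C * \<bar>h' z - \<psi> z\<bar>" for z
  proof -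
    have "h z * h' z - \<phi> z * \<psi> z = h' z * (h z - \<phi> z) + \<phi> z * (h' z - \<psi> z)" by (simp add: algebra_simps)
    also have "\<bar>\<dots>\<bar> \<le> \<bar>h' z\<bar> * \<bar>h z - \<phi> z\<bar> + \<bar>\<phi> z\<bar> * \<bar>h' z - \<psi> z\<bar>" by (metis abs_mult abs_triangle_ineq)
    also have "\<dots> \<le> B * \<bar>h z - \<phi> z\<bar> + C * \<bar>h' z - \<psi> z\<bar>" using h'[of z] C[of z] by (intro add_mono mult_right_mono) auto
    finally show ?thesis .
  qed
  then have "(\<integral>\<^sup>+z. ennreal \<bar>h z * h' z - \<phi> z * \<psi> z\<bar> \<partial>M) \<le> (\<integral>\<^sup>+z. ennreal B * ennreal \<bar>h z - \<phi> z\<bar> + ennreal C * ennreal \<bar>h' z - \<psi> z\<bar> \<partial>M)"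
    using B C0 by (intro nn_integral_mono) (simp flip: ennreal_plus ennreal_mult)
  also have "\<dots> = ennreal B * L1_dist M h \<phi> + ennreal C * L1_dist M h' \<psi>"
    by (simp add: nn_integral_add nn_integral_cmult)
  also have "\<dots> \<le> ennreal B * ennreal d + ennreal C * ennreal d'"
    using \<psi> \<phi> by (intro add_mono mult_left_mono) auto
  also have "\<dots> < ennreal e" using e d d' B C0 by (simp flip: ennreal_plus ennreal_mult add: ennreal_less_iff)
  finally show "\<exists>\<phi>. bounded_lipschitz k \<phi> \<and> (\<integral>\<^sup>+z. ennreal \<bar>h z * h' z - \<phi> z\<bar> \<partial>M) < ennreal e"
    using bounded_lipschitz_mult[OF \<phi>(1) \<psi>(1)] by blast
qed

text \<open>Ramps of slope \<open>n\<close> in the \<open>arctan\<close> of coordinate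
  \<open>i\<close>, equal to 1 up to the level \<open>a\<close>, converge pointwise to the
  indicator. Being functions of the \<open>arctan\<close>, they are Lipschitz for
  \<open>arctan_dist\<close>.\<close>

lemma approximable_coord_le:
  assumes sM: "sets M = sets (RN k \<Otimes>\<^sub>M unif01)" and "finite_measure M" and i: "i < k"
  shows "approximable k M (indicator {z \<in> space M. fst z i \<le> a})"
proof -
  interpret finite_measure M by fact
  define \<phi> where "\<phi> n z = max 0 (min 1 (1 - real n * (arctan (fst z i) - arctan a)))" for n and z :: "(nat \<Rightarrow> real) \<times> real"
  have coord [measurable]: "(\<lambda>z. fst z i) \<in> borel_measurable (RN k \<Otimes>\<^sub>M unif01)" using i
    by (intro measurable_compose[OF measurable_fst] measurable_component_singleton) auto
  have \<phi>m: "\<phi> n \<in> borel_measurable (RN k \<Otimes>\<^sub>M unif01)" for n unfolding \<phi>_def[abs_def] by measurable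
  have "bounded_lipschitz k (\<phi> n)" for n
  proof (rule bounded_lipschitzI)
    show "\<bar>\<phi> n z\<bar> \<le> 1" for z by (simp add: \<phi>_def)
    fix x y t
    have "\<bar>\<phi> n (x, t) - \<phi> n (y, t)\<bar> \<le> \<bar>real n * (arctan (x i) - arctan (y i))\<bar>"
      unfolding \<phi>_def by (auto simp: max_def min_def algebra_simps)
    also have "\<dots> = real n * \<bar>arctan (x i) - arctan (y i)\<bar>" by (simp add: abs_mult)
    also have "\<dots> \<le> real n * arctan_dist k x y"
      unfolding arctan_dist_def using i
      by (intro mult_left_mono member_le_sum[of i "{..<k}" "\<lambda>i. \<bar>arctan (x i) - arctan (y i)\<bar>"]) auto
    finally show "\<bar>\<phi> n (x, t) - \<phi> n (y, t)\<bar> \<le> real n * arctan_dist k x y" .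
  qed (rule \<phi>m)
  then have ap: "approximable k M (\<phi> n)" for n by (rule approximable_bounded_lipschitz)
  show ?thesis
  proof (rule approximable_limit[OF sM _ _ ap, where w="\<lambda>_. 1"])
    show "indicator {z \<in> space M. fst z i \<le> a} \<in> borel_measurable M" (is "?f \<in> _")
    proof -
      have "(\<lambda>z. fst z i) \<in> borel_measurable M" using coord sM by (simp cong: measurable_cong_sets)
      then show ?thesis by (intro borel_measurable_indicator) (simp add: borel_measurable_iff_le)
    qed
    show "\<phi> n \<in> borel_measurable M" for n using \<phi>m sM by (simp cong: measurable_cong_sets)
    show "\<bar>\<phi> n z\<bar> \<le> 1" for n z by (simp add: \<phi>_def)
    fix z assume z: "z \<in> space M"
    show "(\<lambda>n. \<phi> n z) \<longlonglongrightarrow> ?f z"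
    proof (cases "fst z i \<le> a")
      case True
      then have "\<phi> n z = 1" for n by (simp add: \<phi>_def arctan_le_iff mult_nonneg_nonpos)
      then show ?thesis using z True by simp
    next
      case False
      then have pos: "0 < arctan (fst z i) - arctan a" by (simp add: arctan_less_iff)
      obtain n0 where n0: "1 / (arctan (fst z i) - arctan a) < real n0" using reals_Archimedean2 by blast
      have "\<phi> n z = 0" if "n0 \<le> n" for n
      proof -
        have "1 / (arctan (fst z i) - arctan a) < real n" using n0 that by linarith
        then have "1 < real n * (arctan (fst z i) - arctan a)" using pos by (simp add: field_simps)
        then show ?thesis by (simp add: \<phi>_def)
      qed
      then have "eventually (\<lambda>n. \<phi> n z = 0) sequentially" by (auto simp: eventually_sequentially)
      then show ?thesis using False by (simp add: tendsto_eventually)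
    qed
  qed (auto simp: indicator_def)
qed

text \<open>The sets with approximable indicator form a \<open>\<sigma>\<close>-algebra:
  intersections by products, complements by linear combinations, countable disjoint unions by
  limits. That it contains all measurable sets follows from measurability of the identity into the
  product space, which may be checked one coordinate at a time.\<close>

lemma approximable_indicator:
  assumes sM: "sets M = sets (RN k \<Otimes>\<^sub>M unif01)" and "finite_measure M" and A: "A \<in> sets M"
  shows "approximable k M (indicator A)"
proof -
  interpret finite_measure M by fact
  define \<A> where "\<A> = {A \<in> sets M. approximable k M (indicator A :: _ \<Rightarrow> real)}"
  have sp: "space M = space (RN k) \<times> space unif01" using sets_eq_imp_space_eq[OF sM] by (simp add: space_pair_measure)
  have one: "approximable k M (\<lambda>_. c)" for c by (intro approximable_bounded_lipschitz bounded_lipschitz_const)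
  have cong: "approximable k M f" if "approximable k M g" "\<And>z. z \<in> space M \<Longrightarrow> f z = g z" for f g
  proof -
    have "L1_dist M f \<phi> = L1_dist M g \<phi>" for \<phi>
      by (intro nn_integral_cong) (simp add: that(2))
    then show ?thesis using that(1) by (simp add: approximable_def)
  qed
  have Int: "A \<inter> B \<in> \<A>" if "A \<in> \<A>" "B \<in> \<A>" for A B
  proof -
    have "approximable k M (\<lambda>z. indicator A z * indicator B z)"
      using that by (intro approximable_mult[OF sM, where B=1]) (auto simp: \<A>_def)
    then have "approximable k M (indicator (A \<inter> B))" by (rule cong) (rule indicator_inter_arith)
    then show ?thesis using that by (auto simp: \<A>_def)
  qed
  have Compl: "space M - A \<in> \<A>" if "A \<in> \<A>" for A
  proof -
    have [measurable]: "A \<in> sets M" using that by (simp add: \<A>_def)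
    have "approximable k M (\<lambda>z. indicator A z * (- 1))"
      using that by (intro approximable_mult[OF sM _ _ _ _ one, where B=1]) (auto simp: \<A>_def)
    then have "approximable k M (\<lambda>z. 1 + indicator A z * (- 1))"
      by (intro approximable_add[OF sM _ _ one]) auto
    then have "approximable k M (indicator (space M - A))"
      by (rule cong) (auto simp: indicator_def)
    then show ?thesis by (simp add: \<A>_def)
  qed
  have fin_Un: "(\<Union>i<n. B i) \<in> \<A>" if "range B \<subseteq> \<A>" for B :: "nat \<Rightarrow> _" and n
  proof (induction n)
    case 0
    have "approximable k M (indicator {})" by (rule cong[OF one[of 0]]) simp
    then show ?case by (simp add: \<A>_def)
  next
    case (Suc n)
    have "B n \<in> \<A>" using that by auto
    then have "space M - ((space M - (\<Union>i<n. B i)) \<inter> (space M - B n)) \<in> \<A>"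
      using Suc by (intro Compl Int)
    moreover have "space M - ((space M - (\<Union>i<n. B i)) \<inter> (space M - B n)) = (\<Union>i<Suc n. B i)"
    proof -
      have "B i \<subseteq> space M" for i using that by (intro sets.sets_into_space) (auto simp: \<A>_def)
      then show ?thesis by (auto simp: less_Suc_eq)
    qed
    ultimately show ?case by simp
  qed
  have sigma: "sigma_algebra (space M) \<A>"
    unfolding sigma_algebra_disjoint_iff algebra_iff_Int
  proof (intro conjI allI impI)
    show "\<A> \<subseteq> Pow (space M)" using sets.space_closed by (auto simp: \<A>_def)
    have "approximable k M (indicator {})" by (rule cong[OF one[of 0]]) simp
    then show "{} \<in> \<A>" by (simp add: \<A>_def)
    show "\<forall>a\<in>\<A>. space M - a \<in> \<A>" using Compl by blast
    show "\<forall>a\<in>\<A>. \<forall>b\<in>\<A>. a \<inter> b \<in> \<A>" using Int by blast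
    fix B :: "nat \<Rightarrow> _" assume B: "range B \<subseteq> \<A>" "disjoint_family B"
    then have Bm: "B i \<in> sets M" for i by (auto simp: \<A>_def)
    have "approximable k M (indicator (\<Union>i. B i))"
    proof (rule approximable_limit[OF sM, where s="\<lambda>n. indicator (\<Union>i<n. B i)" and w="\<lambda>_. 1"])
      show "approximable k M (indicator (\<Union>i<n. B i))" for n using fin_Un[OF B(1)] by (simp add: \<A>_def)
      show "(\<lambda>n. indicator (\<Union>i<n. B i) z) \<longlonglongrightarrow> (indicator (\<Union>i. B i) z :: real)" for z
        by (rule LIMSEQ_indicator_UN)
    qed (use Bm in \<open>auto simp: indicator_def\<close>)
    then show "(\<Union>i. B i) \<in> \<A>" using Bm by (auto simp: \<A>_def)
  qed
  interpret S: sigma_algebra "space M" \<A> by (rule sigma)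
  define \<Sigma> where "\<Sigma> = sigma (space M) \<A>"
  have s\<Sigma>: "sets \<Sigma> = \<A>" "space \<Sigma> = space M"
    unfolding \<Sigma>_def using S.sets_measure_of_eq S.space_closed by (auto simp: S.sigma_sets_eq)
  have "(\<lambda>z. (\<lambda>i. fst z i)) \<in> measurable \<Sigma> (RN k)"
  proof (rule measurable_PiM_single')
    show "(\<lambda>z. fst z i) \<in> borel_measurable \<Sigma>" if "i \<in> {0..<k}" for i
      unfolding borel_measurable_iff_le s\<Sigma>
    proof
      fix a :: real
      have "(\<lambda>z. fst z i) \<in> borel_measurable M" using that sM by (simp cong: measurable_cong_sets)
      then have "{z \<in> space M. fst z i \<le> a} \<in> sets M" by measurable
      then show "{z \<in> space M. fst z i \<le> a} \<in> \<A>"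
        using approximable_coord_le[OF sM \<open>finite_measure M\<close>, of i a] that by (simp add: \<A>_def)
    qed
    show "(\<lambda>z i. fst z i) \<in> space \<Sigma> \<rightarrow> (\<Pi>\<^sub>E i\<in>{0..<k}. space borel)"
      by (auto simp: s\<Sigma> sp space_PiM PiE_def)
  qed
  then have m1: "fst \<in> measurable \<Sigma> (RN k)" by simp
  have m2: "snd \<in> measurable \<Sigma> unif01"
  proof (rule measurableI)
    show "snd z \<in> space unif01" if "z \<in> space \<Sigma>" for z using that by (auto simp: s\<Sigma> sp)
    fix B assume B: "B \<in> sets unif01"
    have Bm: "snd -` B \<inter> space M \<in> sets M"
      using measurable_sets[OF measurable_snd B, of "RN k"] sets_eq_imp_space_eq[OF sM] by (simp add: sM)
    \<comment> \<open>An indicator of a set in the uniform variable does not depend on the past, so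
      its Lipschitz constant is 0.\<close>
    have "bounded_lipschitz k (\<lambda>z. indicator B (snd z))"
    proof (rule bounded_lipschitzI[where C=1 and L=0])
      show "(\<lambda>z. indicator B (snd z)) \<in> borel_measurable (RN k \<Otimes>\<^sub>M unif01)"
        using B by (intro measurable_compose[OF measurable_snd] borel_measurable_indicator)
    qed auto
    then have "approximable k M (indicator (snd -` B \<inter> space M))"
      by (intro cong[OF approximable_bounded_lipschitz]) (auto simp: indicator_def)
    then show "snd -` B \<inter> space \<Sigma> \<in> sets \<Sigma>" using Bm by (simp add: s\<Sigma> \<A>_def)
  qed
  have "(\<lambda>z. (fst z, snd z)) \<in> measurable \<Sigma> (RN k \<Otimes>\<^sub>M unif01)" using m1 m2 by (rule measurable_Pair)
  then have "(\<lambda>z. z) \<in> measurable \<Sigma> (RN k \<Otimes>\<^sub>M unif01)" by simp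
  from measurable_sets[OF this, of A] have "A \<inter> space M \<in> \<A>" using A sM by (simp add: s\<Sigma>)
  moreover have "A \<inter> space M = A" using sets.sets_into_space[OF A] by auto
  ultimately show ?thesis by (simp add: \<A>_def)
qed

lemma approximable_integrable:
  assumes sM: "sets M = sets (RN k \<Otimes>\<^sub>M unif01)" and fM: "finite_measure M" and h: "integrable M h"
  shows "approximable k M h"
  using h
proof (induction rule: integrable_induct)
  case (base A c)
  have "approximable k M (\<lambda>z. indicator A z * c)"
  proof (rule approximable_mult[OF sM])
    show "approximable k M (indicator A)" using base by (intro approximable_indicator[OF sM fM])
    show "approximable k M (\<lambda>_. c)" by (rule approximable_bounded_lipschitz[OF bounded_lipschitz_const])
  qed (use base in auto)
  then show ?case by simp
next
  case (add f g)
  then show ?case by (intro approximable_add[OF sM, of f g]) auto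
next
  case (lim f s)
  show ?case
  proof (rule approximable_limit[OF sM, where s=s and w="\<lambda>z. 2 * \<bar>f z\<bar>"])
    show "(\<lambda>n. s n z) \<longlonglongrightarrow> f z" if "z \<in> space M" for z using lim that by blast
    show "\<bar>s n z\<bar> \<le> 2 * \<bar>f z\<bar>" if "z \<in> space M" for n z using lim(3)[OF that, of n] by simp
  qed (use lim in auto)
qed

subsection \<open>Optimality of monotone couplings and uniqueness of kernels\<close>

text \<open>The distance of two reals is the length of the set of levels that separate them; the
  rest is Fubini.\<close>

lemma nn_integral_abs_diff_layer:
  fixes f g :: "'a \<Rightarrow> real"
  assumes "sigma_finite_measure M" and [measurable]: "f \<in> borel_measurable M" "g \<in> borel_measurable M"
  shows "(\<integral>\<^sup>+x. ennreal \<bar>f x - g x\<bar> \<partial>M) = (\<integral>\<^sup>+t. emeasure M {x \<in> space M. (f x \<le> t) \<noteq> (g x \<le> t)} \<partial>lborel)"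
proof -
  interpret M: sigma_finite_measure M by fact
  interpret pair_sigma_finite M lborel by unfold_locales
  have *: "ennreal \<bar>a - b\<bar> = (\<integral>\<^sup>+t. indicator {t. (a \<le> t) \<noteq> (b \<le> t)} t \<partial>lborel)" for a b :: real
  proof -
    have "{t. (a \<le> t) \<noteq> (b \<le> t)} = {min a b..<max a b}" by auto
    then show ?thesis by (simp add: max_def min_def)
  qed
  have "(\<integral>\<^sup>+x. ennreal \<bar>f x - g x\<bar> \<partial>M) = (\<integral>\<^sup>+x. \<integral>\<^sup>+t. indicator {z \<in> space (M \<Otimes>\<^sub>M lborel). (f (fst z) \<le> snd z) \<noteq> (g (fst z) \<le> snd z)} (x, t) \<partial>lborel \<partial>M)"
    unfolding * by (intro nn_integral_cong) (auto split: split_indicator simp: space_pair_measure)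
  also have "\<dots> = (\<integral>\<^sup>+t. \<integral>\<^sup>+x. indicator {z \<in> space (M \<Otimes>\<^sub>M lborel). (f (fst z) \<le> snd z) \<noteq> (g (fst z) \<le> snd z)} (x, t) \<partial>M \<partial>lborel)"
    by (rule Fubini[symmetric]) measurable
  also have "\<dots> = (\<integral>\<^sup>+t. \<integral>\<^sup>+x. indicator {x \<in> space M. (f x \<le> t) \<noteq> (g x \<le> t)} x \<partial>M \<partial>lborel)"
    by (intro nn_integral_cong) (auto split: split_indicator simp: space_pair_measure)
  also have "\<dots> = (\<integral>\<^sup>+t. emeasure M {x \<in> space M. (f x \<le> t) \<noteq> (g x \<le> t)} \<partial>lborel)"
    by (intro nn_integral_cong nn_integral_indicator) measurable
  finally show ?thesis .
qed

text \<open>By the layer formula it suffices to compare, for each level \<open>t\<close>, the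
  probabilities that exactly one of the two variables is at most \<open>t\<close>. Under any
  coupling this is at least the difference of the two distribution functions at \<open>t\<close>.
  Monotone \<open>f\<close> and \<open>g\<close> attain this bound, since their sublevel sets are
  initial segments of the unit interval and hence nested.\<close>

lemma monotone_coupling_optimal:
  fixes f g :: "real \<Rightarrow> real" and X Y :: "'a \<Rightarrow> real"
  assumes K: "prob_space K" and [measurable]: "X \<in> borel_measurable K" "Y \<in> borel_measurable K"
    "f \<in> borel_measurable unif01" "g \<in> borel_measurable unif01"
    and mono: "mono_on {0<..<1} f" "mono_on {0<..<1} g"
    and X: "distr unif01 borel f = distr K borel X" and Y: "distr unif01 borel g = distr K borel Y"
  shows "(\<integral>\<^sup>+t. ennreal \<bar>f t - g t\<bar> \<partial>unif01) \<le> (\<integral>\<^sup>+z. ennreal \<bar>X z - Y z\<bar> \<partial>K)"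
proof -
  interpret K: prob_space K by fact
  interpret U: prob_space unif01 by (rule prob_space_unif01)
  have level: "U.prob {x \<in> space unif01. f' x \<le> t} = K.prob {z \<in> space K. X' z \<le> t}"
    if "distr unif01 borel f' = distr K borel X'" and [measurable]: "f' \<in> borel_measurable unif01" "X' \<in> borel_measurable K"
    for f' X' and t :: real
  proof -
    have "U.prob {x \<in> space unif01. f' x \<le> t} = measure (distr unif01 borel f') {..t}"
      by (subst measure_distr) (auto intro!: arg_cong[where f="measure _"])
    also have "\<dots> = K.prob {z \<in> space K. X' z \<le> t}"
      unfolding that(1) by (subst measure_distr) (auto intro!: arg_cong[where f="measure _"])
    finally show ?thesis .
  qed
  \<comment> \<open>The case where the sublevel set of the first function is the smaller one; the
    other case follows by exchanging the roles.\<close>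
  have one: "U.prob {x \<in> space unif01. (f' x \<le> t) \<noteq> (g' x \<le> t)} \<le> K.prob {z \<in> space K. (X' z \<le> t) \<noteq> (Y' z \<le> t)}"
    if sub: "{x \<in> space unif01. f' x \<le> t} \<subseteq> {x \<in> space unif01. g' x \<le> t}"
      and ms [measurable]: "f' \<in> borel_measurable unif01" "g' \<in> borel_measurable unif01"
        "X' \<in> borel_measurable K" "Y' \<in> borel_measurable K"
      and X': "distr unif01 borel f' = distr K borel X'" and Y': "distr unif01 borel g' = distr K borel Y'"
    for f' g' X' Y' and t :: real
  proof -
    have "U.prob {x \<in> space unif01. (f' x \<le> t) \<noteq> (g' x \<le> t)}
       = U.prob ({x \<in> space unif01. g' x \<le> t} - {x \<in> space unif01. f' x \<le> t})"
      using sub by (intro arg_cong[where f="measure _"]) auto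
    also have "\<dots> = K.prob {z \<in> space K. Y' z \<le> t} - K.prob {z \<in> space K. X' z \<le> t}"
    proof -
      have "{x \<in> space unif01. g' x \<le> t} \<in> U.events" "{x \<in> space unif01. f' x \<le> t} \<in> U.events"
        by measurable
      from U.finite_measure_Diff[OF this sub] show ?thesis
        by (simp only: level[OF X' ms(1,3)] level[OF Y' ms(2,4)])
    qed
    also have "K.prob {z \<in> space K. Y' z \<le> t} \<le>
        K.prob ({z \<in> space K. X' z \<le> t} \<union> {z \<in> space K. (X' z \<le> t) \<noteq> (Y' z \<le> t)})"
      by (intro K.finite_measure_mono) auto
    also have "\<dots> \<le> K.prob {z \<in> space K. X' z \<le> t} + K.prob {z \<in> space K. (X' z \<le> t) \<noteq> (Y' z \<le> t)}"
      by (intro measure_Un_le) auto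
    finally show ?thesis by simp
  qed
  have "U.prob {x \<in> space unif01. (f x \<le> t) \<noteq> (g x \<le> t)} \<le> K.prob {z \<in> space K. (X z \<le> t) \<noteq> (Y z \<le> t)}" for t
  proof (cases "{x \<in> space unif01. f x \<le> t} \<subseteq> {x \<in> space unif01. g x \<le> t}")
    case True
    then show ?thesis by (rule one) (use X Y in auto)
  next
    case False
    then obtain x where x: "0 < x" "x < 1" "f x \<le> t" "\<not> g x \<le> t" by (auto simp: space_restrict_space)
    have "{x \<in> space unif01. g x \<le> t} \<subseteq> {x \<in> space unif01. f x \<le> t}"
    proof
      fix y assume "y \<in> {x \<in> space unif01. g x \<le> t}"
      then have y: "0 < y" "y < 1" "g y \<le> t" by (auto simp: space_restrict_space)
      have "y \<le> x"
      proof (rule ccontr)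
        assume "\<not> y \<le> x"
        then show False using mono_onD[OF mono(2), of x y] x y by auto
      qed
      then show "y \<in> {x \<in> space unif01. f x \<le> t}"
        using mono_onD[OF mono(1), of y x] x y by (auto simp: space_restrict_space)
    qed
    then have "U.prob {x \<in> space unif01. (g x \<le> t) \<noteq> (f x \<le> t)} \<le> K.prob {z \<in> space K. (Y z \<le> t) \<noteq> (X z \<le> t)}"
      by (rule one) (use X Y in auto)
    then show ?thesis by (simp add: eq_commute)
  qed
  then have "(\<integral>\<^sup>+t. emeasure unif01 {x \<in> space unif01. (f x \<le> t) \<noteq> (g x \<le> t)} \<partial>lborel)
      \<le> (\<integral>\<^sup>+t. emeasure K {z \<in> space K. (X z \<le> t) \<noteq> (Y z \<le> t)} \<partial>lborel)"
    by (intro nn_integral_mono) (simp add: U.emeasure_eq_measure K.emeasure_eq_measure)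
  then show ?thesis
    by (simp add: nn_integral_abs_diff_layer U.sigma_finite_measure_axioms K.sigma_finite_measure_axioms)
qed

text \<open>Both kernels give the same mass to \<open>A \<times> {..<c}\<close> for every measurable
  set \<open>A\<close> of pasts, so their masses of each rational half-line agree almost surely, and
  countably many half-lines determine a measure on the line. Needed because bicausality refers to
  some disintegrations, while the argument uses the kernels \<open>ker\<close> of the
  recursion.\<close>

lemma disintegration_unique:
  fixes \<alpha> \<beta> :: "nat \<Rightarrow> (nat \<Rightarrow> real) \<Rightarrow> real measure"
  assumes a: "disintegration N \<mu> \<alpha>" and b: "disintegration N \<mu> \<beta>" and k: "k < N"
  shows "AE x in \<mu>. \<alpha> k (restrict x {0..<k}) = \<beta> k (restrict x {0..<k})"
proof -
  interpret mu: prob_space \<mu> by (rule disintegration_prob(1)[OF a])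
  have smu: "sets \<mu> = sets (RN N)" by (rule disintegration_prob(2)[OF a])
  have rm [measurable]: "(\<lambda>x. restrict x {0..<k}) \<in> measurable \<mu> (RN k)"
    using smu measurable_restrict_subset[of "{0..<k}" "{0..<N}" "\<lambda>_. borel"] k
    by (simp cong: measurable_cong_sets)
  have em: "(\<lambda>w. emeasure (\<gamma> k w) {..<c}) \<in> borel_measurable (RN k)" if "disintegration N \<mu> \<gamma>" for \<gamma> :: "nat \<Rightarrow> (nat \<Rightarrow> real) \<Rightarrow> real measure" and c
    using measurable_emeasure_kernel[OF disintegration_prob(3)[OF that], of "{..<c}" k] by simp
  let ?M = "distr \<mu> (RN k) (\<lambda>x. restrict x {0..<k})"
  have int: "(\<integral>\<^sup>+w. emeasure (\<gamma> k w) {..<c} * indicator A w \<partial>?M) =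
      (\<integral>\<^sup>+x. indicator A (restrict x {0..<k}) * indicator {..<c} (x k) \<partial>\<mu>)"
    if g: "disintegration N \<mu> \<gamma>" and A [measurable]: "A \<in> sets (RN k)" for \<gamma> :: "nat \<Rightarrow> (nat \<Rightarrow> real) \<Rightarrow> real measure" and c A
  proof -
    have [measurable]: "(\<lambda>w. emeasure (\<gamma> k w) {..<c}) \<in> borel_measurable (RN k)" by (rule em[OF g])
    have "(\<integral>\<^sup>+w. emeasure (\<gamma> k w) {..<c} * indicator A w \<partial>?M) =
       (\<integral>\<^sup>+x. emeasure (\<gamma> k (restrict x {0..<k})) {..<c} * indicator A (restrict x {0..<k}) \<partial>\<mu>)"
      by (rule nn_integral_distr) measurable
    also have "\<dots> = (\<integral>\<^sup>+x. \<integral>\<^sup>+a. (case (restrict x {0..<k}, a) of (w, a) \<Rightarrow> indicator A w * indicator {..<c} a) \<partial>\<gamma> k (restrict x {0..<k}) \<partial>\<mu>)"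
    proof (rule nn_integral_cong)
      fix x assume "x \<in> space \<mu>"
      then have "restrict x {0..<k} \<in> space (RN k)" using measurable_space[OF rm] by blast
      then have "sets (\<gamma> k (restrict x {0..<k})) = sets borel"
        using disintegration_prob(3)[OF g, of k] by (auto dest: subprob_measurableD)
      then show "emeasure (\<gamma> k (restrict x {0..<k})) {..<c} * indicator A (restrict x {0..<k}) =
         (\<integral>\<^sup>+a. (case (restrict x {0..<k}, a) of (w, a) \<Rightarrow> indicator A w * indicator {..<c} a) \<partial>\<gamma> k (restrict x {0..<k}))"
        by (simp add: nn_integral_cmult_indicator mult.commute[of "emeasure _ _"])
    qed
    also have "\<dots> = (\<integral>\<^sup>+x. (case (restrict x {0..<k}, x k) of (w, a) \<Rightarrow> indicator A w * indicator {..<c} a) \<partial>\<mu>)"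
      by (rule nn_integral_disintegration[OF g k, symmetric]) measurable
    finally show ?thesis by simp
  qed
  have fin: "(\<integral>\<^sup>+w. emeasure (\<gamma> k w) {..<c} \<partial>?M) \<noteq> \<infinity>" if g: "disintegration N \<mu> \<gamma>" for \<gamma> :: "nat \<Rightarrow> (nat \<Rightarrow> real) \<Rightarrow> real measure" and c
  proof -
    have "(\<integral>\<^sup>+w. emeasure (\<gamma> k w) {..<c} \<partial>?M) \<le> (\<integral>\<^sup>+w. 1 \<partial>?M)"
      by (rule nn_integral_mono) (use disintegration_prob(4)[OF g, of _ k] in \<open>auto intro!: prob_space.emeasure_le_1\<close>)
    also have "\<dots> = 1" using mu.prob_space_distr[OF rm] by (simp add: prob_space.emeasure_space_1 del: space_distr)
    finally show ?thesis by (auto simp: top_unique)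
  qed
  have "AE w in ?M. emeasure (\<alpha> k w) {..<real_of_rat r} = emeasure (\<beta> k w) {..<real_of_rat r}" for r
  proof -
    have "AE w in ?M. emeasure (\<alpha> k w) {..<real_of_rat r} \<le> emeasure (\<beta> k w) {..<real_of_rat r}"
      by (rule AE_le_if_set_nn_integral_le[OF _ _ fin[OF a]]) (simp_all add: em a b int)
    moreover have "AE w in ?M. emeasure (\<beta> k w) {..<real_of_rat r} \<le> emeasure (\<alpha> k w) {..<real_of_rat r}"
      by (rule AE_le_if_set_nn_integral_le[OF _ _ fin[OF b]]) (simp_all add: em a b int)
    ultimately show ?thesis by eventually_elim (rule antisym)
  qed
  then have "AE w in ?M. \<forall>r. emeasure (\<alpha> k w) {..<real_of_rat r} = emeasure (\<beta> k w) {..<real_of_rat r}"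
    by (simp only: AE_all_countable) simp
  then have "AE x in \<mu>. \<forall>r. emeasure (\<alpha> k (restrict x {0..<k})) {..<real_of_rat r} = emeasure (\<beta> k (restrict x {0..<k})) {..<real_of_rat r}"
    by (rule AE_distrD[OF rm])
  with AE_space show ?thesis
  proof eventually_elim
    case (elim x)
    then have w: "restrict x {0..<k} \<in> space (RN k)" using measurable_space[OF rm] by blast
    show ?case
    proof (rule real_measure_eqI_rat)
      show "finite_measure (\<alpha> k (restrict x {0..<k}))"
        using disintegration_prob(4)[OF a w] by (rule prob_space.finite_measure)
      show "sets (\<alpha> k (restrict x {0..<k})) = sets borel" "sets (\<beta> k (restrict x {0..<k})) = sets borel"
        using disintegration_prob(3)[OF a, of k] disintegration_prob(3)[OF b, of k] w by (auto dest: subprob_measurableD)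
    qed (use elim in blast)
  qed
qed

subsection \<open>Quantile processes under bicausal couplings\<close>

lemma (in recursive_map) law_marginal:
  assumes "k \<le> n"
  shows "distr (law n) (seq_space k) (\<lambda>x. restrict x {0..<k}) = law k"
proof -
  have "distr (law n) (seq_space k) (\<lambda>x. restrict x {0..<k}) =
      distr (unit_cube n) (seq_space k) ((\<lambda>x. restrict x {0..<k}) \<circ> path r n)"
    unfolding law_def using assms path_measurable[of n n]
    by (intro distr_distr measurable_restrict_subset) auto
  also have "(\<lambda>x. restrict x {0..<k}) \<circ> path r n = path r k"
    using assms by (simp add: fun_eq_iff restrict_path del: restrict_apply)
  finally show ?thesis unfolding distr_path[OF assms] .
qed

lemma (in recursive_map) distr_restrict_marginal:
  assumes T: "T \<in> measurable \<pi> (seq_space n)" "distr \<pi> (seq_space n) T = law n"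
    and k: "k \<le> n"
  shows "distr \<pi> (seq_space k) (\<lambda>z. restrict (T z) {0..<k}) = law k"
  unfolding law_marginal[OF k, symmetric] T(2)[symmetric]
  using k by (subst distr_distr[OF measurable_restrict_subset T(1)]) (auto simp: comp_def)

lemma measurable_zip_path:
  "n \<le> m \<Longrightarrow> zip_path n \<in> measurable (RN m \<Otimes>\<^sub>M RN m) (PiM {0..<n} (\<lambda>_. borel :: (real \<times> real) measure))"
  unfolding zip_path_def borel_prod[symmetric]
  by (intro measurable_restrict measurable_Pair measurable_compose[OF measurable_fst]
     measurable_compose[OF measurable_snd] measurable_component_singleton) auto

lemma bicausal_sets:
  assumes "\<pi> \<in> bicausal_couplings N \<mu> \<nu>" "sets \<mu> = sets (RN N)" "sets \<nu> = sets (RN N)"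
  shows "sets \<pi> = sets (RN N \<Otimes>\<^sub>M RN N)"
  using assms by (simp add: bicausal_couplings_def couplings_def cong: sets_pair_measure_cong)

lemma bicausal_marginals:
  assumes "\<pi> \<in> bicausal_couplings N \<mu> \<nu>"
  shows "distr \<pi> \<mu> fst = \<mu>" "distr \<pi> \<nu> snd = \<nu>"
  using assms by (simp_all add: bicausal_couplings_def couplings_def)

lemma bicausal_measurable_fst_snd:
  assumes "\<pi> \<in> bicausal_couplings N \<mu> \<nu>"
  shows "fst \<in> measurable \<pi> \<mu>" "snd \<in> measurable \<pi> \<nu>"
proof -
  have "sets \<pi> = sets (\<mu> \<Otimes>\<^sub>M \<nu>)" using assms by (simp add: bicausal_couplings_def couplings_def)
  then show "fst \<in> measurable \<pi> \<mu>" "snd \<in> measurable \<pi> \<nu>" by (simp_all cong: measurable_cong_sets)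
qed

lemma (in monotone_map) mono_on_arctan_r:
  assumes "w \<in> space (RN k)"
  shows "mono_on {0<..<1} (\<lambda>t. arctan (r k (w, t)))"
  using r_mono[OF assms] by (intro mono_onI) (simp add: arctan_le_iff)

lemma bicausal_coordinate_measurable:
  assumes "monotone_map q" "monotone_map q'"
    and "\<pi> \<in> bicausal_couplings N (recursive_map.law q N) (recursive_map.law q' N)"
  shows "prob_space \<pi>" "fst \<in> measurable \<pi> (RN N)" "snd \<in> measurable \<pi> (RN N)"
    "distr \<pi> (RN N) fst = recursive_map.law q N" "distr \<pi> (RN N) snd = recursive_map.law q' N"
proof -
  interpret q: monotone_map q by fact
  interpret q': monotone_map q' by fact
  note m = bicausal_measurable_fst_snd[OF assms(3)]
  show f: "fst \<in> measurable \<pi> (RN N)" "snd \<in> measurable \<pi> (RN N)"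
    using m by (simp_all cong: measurable_cong_sets)
  have "distr \<pi> (RN N) fst = distr \<pi> (q.law N) fst" "distr \<pi> (RN N) snd = distr \<pi> (q'.law N) snd"
    by (rule distr_cong; simp)+
  then show d: "distr \<pi> (RN N) fst = q.law N" "distr \<pi> (RN N) snd = q'.law N"
    using bicausal_marginals[OF assms(3)] by simp_all
  have "emeasure \<pi> (space \<pi>) = emeasure (distr \<pi> (RN N) fst) (space (RN N))"
    using f by (subst emeasure_distr) (auto intro!: arg_cong[where f="emeasure \<pi>"] dest: measurable_space)
  also have "\<dots> = 1"
    unfolding d using prob_space.emeasure_space_1[OF q.prob_space_law[of N]] sets_eq_imp_space_eq[OF q.sets_law[of N]] by simp
  finally show "prob_space \<pi>" by (rule prob_spaceI)
qed

abbreviation coupling_gap :: "nat \<Rightarrow> ((nat \<Rightarrow> real) \<times> (nat \<Rightarrow> real)) measure \<Rightarrow> ennreal" where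
  "coupling_gap k \<pi> \<equiv> \<integral>\<^sup>+z. ennreal \<bar>arctan (fst z k) - arctan (snd z k)\<bar> \<partial>\<pi>"

abbreviation coupling_dist :: "nat \<Rightarrow> ((nat \<Rightarrow> real) \<times> (nat \<Rightarrow> real)) measure \<Rightarrow> ennreal" where
  "coupling_dist k \<pi> \<equiv> \<integral>\<^sup>+z. ennreal (arctan_dist k (fst z) (snd z)) \<partial>\<pi>"

abbreviation path_gap :: "nat \<Rightarrow> nat \<Rightarrow> (nat \<Rightarrow> (nat \<Rightarrow> real) \<times> real \<Rightarrow> real) \<Rightarrow> (nat \<Rightarrow> (nat \<Rightarrow> real) \<times> real \<Rightarrow> real) \<Rightarrow> ennreal" where
  "path_gap k N q q' \<equiv> \<integral>\<^sup>+u. ennreal \<bar>arctan (path q N u k) - arctan (path q' N u k)\<bar> \<partial>unit_cube N"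

abbreviation path_dist :: "nat \<Rightarrow> nat \<Rightarrow> (nat \<Rightarrow> (nat \<Rightarrow> real) \<times> real \<Rightarrow> real) \<Rightarrow> (nat \<Rightarrow> (nat \<Rightarrow> real) \<times> real \<Rightarrow> real) \<Rightarrow> ennreal" where
  "path_dist k N q q' \<equiv> \<integral>\<^sup>+u. ennreal (arctan_dist k (path q N u) (path q' N u)) \<partial>unit_cube N"

text \<open>Given the pasts, the conditional law of the next pair under \<open>\<pi>\<close> couples
  the two kernels, and the monotone coupling of the same kernels is no more expensive. On the left
  only the new coordinate is recoupled; the pasts remain coupled by \<open>\<pi>\<close>.\<close>

lemma bicausal_step:
  assumes q: "monotone_map q" and q': "monotone_map q'"
    and pi: "\<pi> \<in> bicausal_couplings N (recursive_map.law q N) (recursive_map.law q' N)" and k: "k < N"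
  shows "(\<integral>\<^sup>+z. \<integral>\<^sup>+t. ennreal \<bar>arctan (q k (restrict (fst z) {0..<k}, t)) - arctan (q' k (restrict (snd z) {0..<k}, t))\<bar> \<partial>unif01 \<partial>\<pi>)
     \<le> coupling_gap k \<pi>"
proof -
  interpret q: monotone_map q by fact
  interpret q': monotone_map q' by fact
  obtain \<kappa> \<alpha> \<beta> where dk: "disintegration N (distr \<pi> (seq_space N) (zip_path N)) \<kappa>"
    and da: "disintegration N (q.law N) \<alpha>" and db: "disintegration N (q'.law N) \<beta>"
    and bc: "AE z in \<pi>. \<forall>k<N. \<kappa> k (zip_path k z) \<in>
           couplings (\<alpha> k (restrict (fst z) {0..<k})) (\<beta> k (restrict (snd z) {0..<k}))"
    using pi unfolding bicausal_couplings_def by blast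
  have s\<pi>: "sets \<pi> = sets (RN N \<Otimes>\<^sub>M RN N)" by (rule bicausal_sets[OF pi]) simp_all
  have zipm: "zip_path n \<in> measurable \<pi> (seq_space n)" if "n \<le> N" for n
    using measurable_zip_path[OF that] s\<pi> by (simp cong: measurable_cong_sets)
  have zr: "restrict (zip_path N z) {0..<k} = zip_path k z" for z :: "(nat \<Rightarrow> real) \<times> (nat \<Rightarrow> real)"
    using k by (auto simp: zip_path_def fun_eq_iff)
  have zk: "zip_path N z k = (fst z k, snd z k)" for z :: "(nat \<Rightarrow> real) \<times> (nat \<Rightarrow> real)"
    using k by (simp add: zip_path_def)
  define g where "g = (\<lambda>(w :: nat \<Rightarrow> real \<times> real, ab :: real \<times> real). ennreal \<bar>arctan (fst ab) - arctan (snd ab)\<bar>)"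
  have gm: "g \<in> borel_measurable (seq_space k \<Otimes>\<^sub>M borel)"
    unfolding g_def borel_prod[symmetric] by measurable
  have inner: "(\<lambda>w. \<integral>\<^sup>+ab. g (w, ab) \<partial>\<kappa> k w) \<in> borel_measurable (seq_space k)"
    by (rule nn_integral_measurable_subprob_algebra2[OF _ disintegration_prob(3)[OF dk]]) (use gm in simp)
  have "coupling_gap k \<pi>
    = (\<integral>\<^sup>+x. g (restrict x {0..<k}, x k) \<partial>distr \<pi> (seq_space N) (zip_path N))"
  proof (subst nn_integral_distr[OF zipm[OF order_refl]])
    have "(\<lambda>x. (restrict x {0..<k}, x k)) \<in> measurable (seq_space N) (seq_space k \<Otimes>\<^sub>M (borel :: (real \<times> real) measure))"
      using k by (intro measurable_Pair measurable_restrict_subset measurable_component_singleton) auto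
    from measurable_compose[OF this gm]
    show "(\<lambda>x. g (restrict x {0..<k}, x k)) \<in> borel_measurable (distr \<pi> (seq_space N) (zip_path N))"
      by simp
  qed (simp_all add: zk g_def)
  also have "\<dots> = (\<integral>\<^sup>+x. \<integral>\<^sup>+a. g (restrict x {0..<k}, a) \<partial>\<kappa> k (restrict x {0..<k}) \<partial>distr \<pi> (seq_space N) (zip_path N))"
    by (rule nn_integral_disintegration[OF dk k gm])
  also have "\<dots> = (\<integral>\<^sup>+z. \<integral>\<^sup>+a. g (zip_path k z, a) \<partial>\<kappa> k (zip_path k z) \<partial>\<pi>)"
  proof (subst nn_integral_distr[OF zipm[OF order_refl]])
    have "(\<lambda>x. restrict x {0..<k}) \<in> measurable (seq_space N) (PiM {0..<k} (\<lambda>_. borel :: (real \<times> real) measure))"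
      using k by (intro measurable_restrict_subset) auto
    from measurable_compose[OF this inner]
    show "(\<lambda>x. \<integral>\<^sup>+a. g (restrict x {0..<k}, a) \<partial>\<kappa> k (restrict x {0..<k})) \<in>
        borel_measurable (distr \<pi> (seq_space N) (zip_path N))" by simp
  qed (simp_all add: zr)
  finally have total: "coupling_gap k \<pi>
     = (\<integral>\<^sup>+z. \<integral>\<^sup>+a. g (zip_path k z, a) \<partial>\<kappa> k (zip_path k z) \<partial>\<pi>)" .
  \<comment> \<open>Uniqueness replaces the unspecified \<open>\<alpha>\<close> and
    \<open>\<beta>\<close> by the kernels of the recursions; the exceptional null sets are pulled
    back along the two marginals of \<open>\<pi>\<close>.\<close>
  have "AE x in distr \<pi> (q.law N) fst. \<alpha> k (restrict x {0..<k}) = q.ker k (restrict x {0..<k})"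
    unfolding bicausal_marginals(1)[OF pi] by (rule disintegration_unique[OF da q.disintegration_law k])
  then have ae1: "AE z in \<pi>. \<alpha> k (restrict (fst z) {0..<k}) = q.ker k (restrict (fst z) {0..<k})"
    by (rule AE_distrD[OF bicausal_measurable_fst_snd(1)[OF pi]])
  have "AE x in distr \<pi> (q'.law N) snd. \<beta> k (restrict x {0..<k}) = q'.ker k (restrict x {0..<k})"
    unfolding bicausal_marginals(2)[OF pi] by (rule disintegration_unique[OF db q'.disintegration_law k])
  then have ae2: "AE z in \<pi>. \<beta> k (restrict (snd z) {0..<k}) = q'.ker k (restrict (snd z) {0..<k})"
    by (rule AE_distrD[OF bicausal_measurable_fst_snd(2)[OF pi]])
  have "AE z in \<pi>. (\<integral>\<^sup>+t. ennreal \<bar>arctan (q k (restrict (fst z) {0..<k}, t)) - arctan (q' k (restrict (snd z) {0..<k}, t))\<bar> \<partial>unif01)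
     \<le> (\<integral>\<^sup>+a. g (zip_path k z, a) \<partial>\<kappa> k (zip_path k z))"
    using AE_space bc ae1 ae2
  proof eventually_elim
    case (elim z)
    let ?x = "restrict (fst z) {0..<k}" and ?y = "restrict (snd z) {0..<k}"
    define K where "K = \<kappa> k (zip_path k z)"
    have xy: "?x \<in> space (RN k)" "?y \<in> space (RN k)" by (simp_all add: space_RN)
    have w: "zip_path k z \<in> space (seq_space k)" using measurable_space[OF zipm elim(1)] k by simp
    have pK: "prob_space K" unfolding K_def by (rule disintegration_prob(4)[OF dk w])
    have sK [measurable_cong]: "sets K = sets (borel \<Otimes>\<^sub>M borel)"
      using disintegration_prob(3)[OF dk, of k] w unfolding K_def borel_prod by (auto dest: subprob_measurableD)
    have "K \<in> couplings (q.ker k ?x) (q'.ker k ?y)" using elim k unfolding K_def by metis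
    then have c: "distr K (q.ker k ?x) fst = q.ker k ?x" "distr K (q'.ker k ?y) snd = q'.ker k ?y"
      by (simp_all add: couplings_def)
    \<comment> \<open>As \<open>arctan\<close> is increasing, composing it with a quantile function
      gives a quantile function of the image law, so one-dimensional optimality still
      applies.\<close>
    have push: "distr unif01 borel (\<lambda>t. arctan (s k (v, t))) = distr (recursive_map.ker s k v) borel arctan"
      if "monotone_map s" "v \<in> space (RN k)" for s v
    proof -
      interpret s: monotone_map s by fact
      show ?thesis unfolding s.ker_def using s.r_section_measurable[OF that(2)]
        by (subst distr_distr) (auto simp: comp_def)
    qed
    have "distr unif01 borel (\<lambda>t. arctan (q k (?x, t))) = distr (distr K (q.ker k ?x) fst) borel arctan"
      using push[OF q xy(1)] c by simp
    also have "\<dots> = distr K borel (\<lambda>ab. arctan (fst ab))"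
      by (subst distr_distr) (auto simp: comp_def q.ker_def)
    finally have 1: "distr unif01 borel (\<lambda>t. arctan (q k (?x, t))) = distr K borel (\<lambda>ab. arctan (fst ab))" .
    have "distr unif01 borel (\<lambda>t. arctan (q' k (?y, t))) = distr (distr K (q'.ker k ?y) snd) borel arctan"
      using push[OF q' xy(2)] c by simp
    also have "\<dots> = distr K borel (\<lambda>ab. arctan (snd ab))"
      by (subst distr_distr) (auto simp: comp_def q'.ker_def)
    finally have 2: "distr unif01 borel (\<lambda>t. arctan (q' k (?y, t))) = distr K borel (\<lambda>ab. arctan (snd ab))" .
    have "(\<integral>\<^sup>+t. ennreal \<bar>arctan (q k (?x, t)) - arctan (q' k (?y, t))\<bar> \<partial>unif01)
        \<le> (\<integral>\<^sup>+ab. ennreal \<bar>arctan (fst ab) - arctan (snd ab)\<bar> \<partial>K)"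
      using q.r_section_measurable[OF xy(1)] q'.r_section_measurable[OF xy(2)]
      by (intro monotone_coupling_optimal[OF pK _ _ _ _ q.mono_on_arctan_r[OF xy(1)] q'.mono_on_arctan_r[OF xy(2)] 1 2])
         measurable
    then show ?case by (simp add: g_def K_def)
  qed
  then show ?thesis unfolding total by (rule nn_integral_mono_AE)
qed

lemma arctan_abs_le2: "\<bar>arctan x\<bar> \<le> 2"
  using arctan_bounded[of x] pi_less_4 by linarith

text \<open>The constant \<open>L\<close> depends on \<open>q\<close> and \<open>e\<close> but not on \<open>q'\<close>: it is the Lipschitz constant of an
  approximation of \<open>q k\<close>.\<close>

lemma key_estimate:
  assumes q: "monotone_map q" and k: "k < N" and e: "0 < e"
  obtains L where "0 \<le> L"
    "\<And>q' \<pi>. monotone_map q' \<Longrightarrow> \<pi> \<in> bicausal_couplings N (recursive_map.law q N) (recursive_map.law q' N) \<Longrightarrow>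
      path_gap k N q q'
       \<le> ennreal e + ennreal L * path_dist k N q q'
          + coupling_gap k \<pi>
          + ennreal e + ennreal L * coupling_dist k \<pi>"
proof -
  interpret q: monotone_map q by fact
  interpret U: prob_space unif01 by (rule prob_space_unif01)
  define h where "h = (\<lambda>z. arctan (q k z))"
  have hm [measurable]: "h \<in> borel_measurable (RN k \<Otimes>\<^sub>M unif01)" unfolding h_def by measurable
  let ?M = "q.law k \<Otimes>\<^sub>M unif01"
  interpret M: prob_space ?M by (intro prob_space_pair q.prob_space_law prob_space_unif01)
  have sM: "sets ?M = sets (RN k \<Otimes>\<^sub>M unif01)" by simp
  have "integrable ?M h"
    by (rule M.integrable_const_bound[of _ 2]) (auto simp: h_def arctan_abs_le2)
  then have "approximable k ?M h" by (rule approximable_integrable[OF sM M.finite_measure_axioms])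
  then obtain \<phi> where \<phi>: "bounded_lipschitz k \<phi>" and close: "L1_dist ?M h \<phi> < ennreal e"
    using e unfolding approximable_def by blast
  have \<phi>m [measurable]: "\<phi> \<in> borel_measurable (RN k \<Otimes>\<^sub>M unif01)" by (rule bounded_lipschitz_measurable[OF \<phi>])
  obtain L0 where L0: "\<And>x y t. \<bar>\<phi> (x, t) - \<phi> (y, t)\<bar> \<le> L0 * arctan_dist k x y"
    using \<phi> by (auto simp: bounded_lipschitz_def)
  \<comment> \<open>Made nonnegative so that it can be moved in and out of
    \<open>ennreal\<close>.\<close>
  define L where "L = max 0 L0"
  have L: "0 \<le> L" and lip: "\<bar>\<phi> (x, t) - \<phi> (y, t)\<bar> \<le> L * arctan_dist k x y" for x y t
    using order_trans[OF L0 mult_right_mono[of L0 L, OF _ arctan_dist_nonneg]] by (auto simp: L_def)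
  have close': "(\<integral>\<^sup>+w. \<integral>\<^sup>+t. ennreal \<bar>h (w, t) - \<phi> (w, t)\<bar> \<partial>unif01 \<partial>q.law k) \<le> ennreal e"
    using close by (subst U.nn_integral_fst) auto
  show ?thesis
  proof (rule that[OF L])
    fix q' \<pi> assume q': "monotone_map q'" and pi: "\<pi> \<in> bicausal_couplings N (q.law N) (recursive_map.law q' N)"
    interpret q': monotone_map q' by fact
    define h' where "h' = (\<lambda>z. arctan (q' k z))"
    have hm' [measurable]: "h' \<in> borel_measurable (RN k \<Otimes>\<^sub>M unif01)" unfolding h'_def by measurable
    have res: "(\<lambda>x. restrict x {0..<k}) \<in> measurable (RN N) (RN k)"
      using k by (intro measurable_restrict_subset) auto
    note bm = bicausal_coordinate_measurable[OF q q' pi]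
    note xm [measurable] = measurable_compose[OF bm(2) res] and ym [measurable] = measurable_compose[OF bm(3) res]
    have fl: "distr \<pi> (RN k) (\<lambda>z. restrict (fst z) {0..<k}) = q.law k"
      using q.distr_restrict_marginal[OF bm(2,4)] k by simp
    have sl: "distr \<pi> (RN k) (\<lambda>z. restrict (snd z) {0..<k}) = q'.law k"
      using q'.distr_restrict_marginal[OF bm(3,5)] k by simp
    have adr: "arctan_dist k (restrict x {0..<k}) (restrict y {0..<k}) = arctan_dist k x y" for x y
      by (simp add: arctan_dist_def)
    have m3: "(\<lambda>z. ennreal (arctan_dist k (fst z) (snd z))) \<in> borel_measurable \<pi>"
      unfolding arctan_dist_def using k
      by (intro measurable_compose[OF _ measurable_ennreal] borel_measurable_sum borel_measurable_abs borel_measurable_diff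
        borel_measurable_arctan measurable_compose[OF bm(2)] measurable_compose[OF bm(3)] measurable_component_singleton) auto
    \<comment> \<open>Under \<open>\<pi>\<close>, pass from \<open>h' (y, t)\<close> to
      \<open>h (x, t)\<close>, then to \<open>\<phi> (x, t)\<close>, then to
      \<open>\<phi> (y, t)\<close>. The three steps cost the gap bounded in
      \<open>bicausal_step\<close>, the approximation error under the law of \<open>q\<close>, and
      the Lipschitz bound.\<close>
    have second: "(\<integral>\<^sup>+w. \<integral>\<^sup>+t. ennreal \<bar>h' (w, t) - \<phi> (w, t)\<bar> \<partial>unif01 \<partial>q'.law k) \<le>
        coupling_gap k \<pi> + ennreal e
        + ennreal L * coupling_dist k \<pi>"
    proof -
      let ?x = "\<lambda>z. restrict (fst z) {0..<k}" and ?y = "\<lambda>z. restrict (snd z) {0..<k}"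
      have "(\<integral>\<^sup>+w. \<integral>\<^sup>+t. ennreal \<bar>h' (w, t) - \<phi> (w, t)\<bar> \<partial>unif01 \<partial>q'.law k) =
        (\<integral>\<^sup>+z. \<integral>\<^sup>+t. ennreal \<bar>h' (?y z, t) - \<phi> (?y z, t)\<bar> \<partial>unif01 \<partial>\<pi>)"
        unfolding sl[symmetric] by (rule nn_integral_distr[OF ym]) measurable
      also have "\<dots> \<le> (\<integral>\<^sup>+z. (\<integral>\<^sup>+t. ennreal \<bar>h (?x z, t) - h' (?y z, t)\<bar> \<partial>unif01)
          + (\<integral>\<^sup>+t. ennreal \<bar>h (?x z, t) - \<phi> (?x z, t)\<bar> \<partial>unif01) + ennreal L * ennreal (arctan_dist k (fst z) (snd z)) \<partial>\<pi>)"
      proof (rule nn_integral_mono)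
        fix z
        have sp: "?x z \<in> space (RN k)" "?y z \<in> space (RN k)" by (simp_all add: space_RN)
        have ms: "(\<lambda>t. h (?x z, t)) \<in> borel_measurable unif01" "(\<lambda>t. h' (?y z, t)) \<in> borel_measurable unif01"
          "(\<lambda>t. \<phi> (?x z, t)) \<in> borel_measurable unif01"
          by (rule measurable_compose[OF measurable_Pair1'[OF sp(1)] hm] measurable_compose[OF measurable_Pair1'[OF sp(2)] hm']
            measurable_compose[OF measurable_Pair1'[OF sp(1)] \<phi>m])+
        have "(\<integral>\<^sup>+t. ennreal \<bar>h' (?y z, t) - \<phi> (?y z, t)\<bar> \<partial>unif01) \<le>
          (\<integral>\<^sup>+t. ennreal \<bar>h (?x z, t) - h' (?y z, t)\<bar> + ennreal \<bar>h (?x z, t) - \<phi> (?x z, t)\<bar> + ennreal (L * arctan_dist k (fst z) (snd z)) \<partial>unif01)"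
        proof (rule nn_integral_mono)
          fix t
          show "ennreal \<bar>h' (?y z, t) - \<phi> (?y z, t)\<bar> \<le> ennreal \<bar>h (?x z, t) - h' (?y z, t)\<bar> + ennreal \<bar>h (?x z, t) - \<phi> (?x z, t)\<bar> + ennreal (L * arctan_dist k (fst z) (snd z))"
            using lip[of "?x z" t "?y z"] unfolding adr
            by (subst ennreal_plus[symmetric] | simp add: L arctan_dist_nonneg del: ennreal_plus)+
        qed
        also have "\<dots> = (\<integral>\<^sup>+t. ennreal \<bar>h (?x z, t) - h' (?y z, t)\<bar> \<partial>unif01)
          + (\<integral>\<^sup>+t. ennreal \<bar>h (?x z, t) - \<phi> (?x z, t)\<bar> \<partial>unif01) + ennreal L * ennreal (arctan_dist k (fst z) (snd z))"
          using ms by (simp add: nn_integral_add emeasure_restrict_space ennreal_mult L arctan_dist_nonneg)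
        finally show "(\<integral>\<^sup>+t. ennreal \<bar>h' (?y z, t) - \<phi> (?y z, t)\<bar> \<partial>unif01) \<le> \<dots>" .
      qed
      also have "\<dots> = (\<integral>\<^sup>+z. \<integral>\<^sup>+t. ennreal \<bar>h (?x z, t) - h' (?y z, t)\<bar> \<partial>unif01 \<partial>\<pi>)
          + (\<integral>\<^sup>+z. \<integral>\<^sup>+t. ennreal \<bar>h (?x z, t) - \<phi> (?x z, t)\<bar> \<partial>unif01 \<partial>\<pi>) + ennreal L * coupling_dist k \<pi>"
      proof -
        have m1: "(\<lambda>z. \<integral>\<^sup>+t. ennreal \<bar>h (?x z, t) - h' (?y z, t)\<bar> \<partial>unif01) \<in> borel_measurable \<pi>"
          by measurable
        have m2: "(\<lambda>z. \<integral>\<^sup>+t. ennreal \<bar>h (?x z, t) - \<phi> (?x z, t)\<bar> \<partial>unif01) \<in> borel_measurable \<pi>"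
          by measurable
        show ?thesis using m1 m2 m3 by (simp add: nn_integral_add nn_integral_cmult)
      qed
      also have "(\<integral>\<^sup>+z. \<integral>\<^sup>+t. ennreal \<bar>h (?x z, t) - \<phi> (?x z, t)\<bar> \<partial>unif01 \<partial>\<pi>) =
          (\<integral>\<^sup>+w. \<integral>\<^sup>+t. ennreal \<bar>h (w, t) - \<phi> (w, t)\<bar> \<partial>unif01 \<partial>q.law k)"
        unfolding fl[symmetric] by (rule nn_integral_distr[OF xm, symmetric]) measurable
      also note close'
      also have "(\<integral>\<^sup>+z. \<integral>\<^sup>+t. ennreal \<bar>h (?x z, t) - h' (?y z, t)\<bar> \<partial>unif01 \<partial>\<pi>) \<le>
          coupling_gap k \<pi>"
        unfolding h_def h'_def by (rule bicausal_step[OF q q' pi k])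
      finally show ?thesis by (simp add: add_mono)
    qed
    let ?X = "path q N" and ?Y = "path q' N"
    have pm [measurable]: "path q k \<in> measurable (unit_cube N) (RN k)" "path q' k \<in> measurable (unit_cube N) (RN k)"
      using k by (auto intro: q.path_measurable q'.path_measurable)
    have um [measurable]: "(\<lambda>u. u k) \<in> measurable (unit_cube N) unif01" by (rule measurable_coord_unit_cube[OF k])
    have XY: "path q N u k = q k (path q k u, u k)" "path q' N u k = q' k (path q' k u, u k)" for u
      using k by (simp_all add: path_nth restrict_path)
    have adp: "arctan_dist k (path q k u) (path q' k u) = arctan_dist k (path q N u) (path q' N u)" for u
      using k adr[of "path q N u" "path q' N u"] by (simp add: restrict_path)
    have adm: "(\<lambda>u. ennreal (arctan_dist k (path q N u) (path q' N u))) \<in> borel_measurable (unit_cube N)"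
    proof -
      have "(\<lambda>u. path s N u i) \<in> borel_measurable (unit_cube N)" if "monotone_map s" "i < k" for s i
        using that k by (intro monotone_map.path_coord_measurable) auto
      then show ?thesis unfolding arctan_dist_def using q q'
        by (intro measurable_compose[OF _ measurable_ennreal] borel_measurable_sum borel_measurable_abs borel_measurable_diff
          borel_measurable_arctan) auto
    qed
    \<comment> \<open>Now under common uniforms: from \<open>h\<close> to \<open>\<phi>\<close> at
      the past of \<open>q\<close>, across to the past of \<open>q'\<close> by the Lipschitz bound,
      and from \<open>\<phi>\<close> to \<open>h'\<close> there. The last distance is the one
      bounded in \<open>second\<close>.\<close>
    have "path_gap k N q q' \<le>
      (\<integral>\<^sup>+u. ennreal \<bar>h (path q k u, u k) - \<phi> (path q k u, u k)\<bar> + ennreal L * ennreal (arctan_dist k (path q N u) (path q' N u))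
         + ennreal \<bar>h' (path q' k u, u k) - \<phi> (path q' k u, u k)\<bar> \<partial>unit_cube N)"
    proof (rule nn_integral_mono)
      fix u
      have "\<bar>arctan (path q N u k) - arctan (path q' N u k)\<bar> \<le> \<bar>h (path q k u, u k) - \<phi> (path q k u, u k)\<bar>
          + L * arctan_dist k (path q N u) (path q' N u) + \<bar>h' (path q' k u, u k) - \<phi> (path q' k u, u k)\<bar>"
        using lip[of "path q k u" "u k" "path q' k u"] unfolding XY adp h_def h'_def by linarith
      then have "ennreal \<bar>arctan (path q N u k) - arctan (path q' N u k)\<bar> \<le> ennreal (\<bar>h (path q k u, u k) - \<phi> (path q k u, u k)\<bar>
          + L * arctan_dist k (path q N u) (path q' N u) + \<bar>h' (path q' k u, u k) - \<phi> (path q' k u, u k)\<bar>)"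
        by (rule ennreal_leI)
      then show "ennreal \<bar>arctan (path q N u k) - arctan (path q' N u k)\<bar> \<le> ennreal \<bar>h (path q k u, u k) - \<phi> (path q k u, u k)\<bar> + ennreal L * ennreal (arctan_dist k (path q N u) (path q' N u))
         + ennreal \<bar>h' (path q' k u, u k) - \<phi> (path q' k u, u k)\<bar>"
        by (simp add: L arctan_dist_nonneg ennreal_mult)
    qed
    also have "\<dots> = (\<integral>\<^sup>+u. ennreal \<bar>h (path q k u, u k) - \<phi> (path q k u, u k)\<bar> \<partial>unit_cube N)
        + ennreal L * path_dist k N q q'
        + (\<integral>\<^sup>+u. ennreal \<bar>h' (path q' k u, u k) - \<phi> (path q' k u, u k)\<bar> \<partial>unit_cube N)"
    proof -
      have m1: "(\<lambda>u. ennreal \<bar>h (path q k u, u k) - \<phi> (path q k u, u k)\<bar>) \<in> borel_measurable (unit_cube N)" by measurable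
      have m2: "(\<lambda>u. ennreal \<bar>h' (path q' k u, u k) - \<phi> (path q' k u, u k)\<bar>) \<in> borel_measurable (unit_cube N)" by measurable
      show ?thesis using m1 m2 adm by (simp add: nn_integral_add nn_integral_cmult)
    qed
    also have "(\<integral>\<^sup>+u. ennreal \<bar>h (path q k u, u k) - \<phi> (path q k u, u k)\<bar> \<partial>unit_cube N) =
        (\<integral>\<^sup>+w. \<integral>\<^sup>+t. ennreal \<bar>h (w, t) - \<phi> (w, t)\<bar> \<partial>unif01 \<partial>q.law k)"
      by (rule q.nn_integral_path[OF k]) measurable
    also have "(\<integral>\<^sup>+u. ennreal \<bar>h' (path q' k u, u k) - \<phi> (path q' k u, u k)\<bar> \<partial>unit_cube N) =
        (\<integral>\<^sup>+w. \<integral>\<^sup>+t. ennreal \<bar>h' (w, t) - \<phi> (w, t)\<bar> \<partial>unif01 \<partial>q'.law k)"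
      by (rule q'.nn_integral_path[OF k]) measurable
    also note close'
    also note second
    finally show "path_gap k N q q'
       \<le> ennreal e + ennreal L * path_dist k N q q'
          + coupling_gap k \<pi>
          + ennreal e + ennreal L * coupling_dist k \<pi>"
      by (simp add: add_mono add.assoc)
  qed
qed

subsection \<open>The Minkowski inequality and the cost\<close>

text \<open>Integrating this and choosing \<open>\<theta>\<close> proportional to the norm of the second summand gives the
  Minkowski inequality.\<close>

lemma abs_add_powr_le:
  fixes a b p \<theta> :: real
  assumes p: "1 \<le> p" and \<theta>: "0 < \<theta>" "\<theta> < 1"
  shows "\<bar>a + b\<bar> powr p \<le> (1 - \<theta>) powr (1 - p) * \<bar>a\<bar> powr p + \<theta> powr (1 - p) * \<bar>b\<bar> powr p"
proof -
  have ge1: "1 \<le> s powr (1 - p)" if "0 < s" "s < 1" for s :: real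
    using powr_mono'[of "1 - p" 0 s] that p by simp
  have weight: "s * (x / s) powr p = s powr (1 - p) * x powr p" if "0 < s" "0 < x" for s x :: real
    using that by (simp add: powr_divide powr_diff)
  consider "a = 0" | "b = 0" | "a \<noteq> 0" "b \<noteq> 0" by blast
  then show ?thesis
  proof cases
    case 1
    then show ?thesis using mult_right_mono[OF ge1[OF \<theta>], of "\<bar>b\<bar> powr p"] by simp
  next
    case 2
    then show ?thesis using mult_right_mono[OF ge1[of "1 - \<theta>"], of "\<bar>a\<bar> powr p"] \<theta> by simp
  next
    case 3
    have "\<bar>a + b\<bar> powr p \<le> (\<bar>a\<bar> + \<bar>b\<bar>) powr p" using p by (intro powr_mono2) auto
    \<comment> \<open>Written as a convex combination with weights \<open>1 - \<theta>\<close> and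
      \<open>\<theta>\<close>, so that convexity produces the factors with exponent
      \<open>1 - p\<close>.\<close>
    also have "\<bar>a\<bar> + \<bar>b\<bar> = (1 - \<theta>) *\<^sub>R (\<bar>a\<bar> / (1 - \<theta>)) + \<theta> *\<^sub>R (\<bar>b\<bar> / \<theta>)" using \<theta> by simp
    also have "\<dots> powr p \<le> (1 - \<theta>) * (\<bar>a\<bar> / (1 - \<theta>)) powr p + \<theta> * (\<bar>b\<bar> / \<theta>) powr p"
      using 3 \<theta> by (intro convex_onD[OF powr_convex[OF p]]) auto
    also have "\<dots> = (1 - \<theta>) powr (1 - p) * \<bar>a\<bar> powr p + \<theta> powr (1 - p) * \<bar>b\<bar> powr p"
      using 3 \<theta> weight[of "1 - \<theta>" "\<bar>a\<bar>"] weight[of \<theta> "\<bar>b\<bar>"] by simp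
    finally show ?thesis .
  qed
qed

lemma powr_diff_mult_self: "0 \<le> x \<Longrightarrow> x powr (1 - p) * x powr p = (x :: real)"
  by (cases "x = 0") (simp_all flip: powr_add)

lemma minkowski_integral:
  fixes f g :: "'a \<Rightarrow> nat \<Rightarrow> real"
  assumes p: "1 \<le> p"
    and [measurable]: "\<And>i. i < N \<Longrightarrow> (\<lambda>x. f x i) \<in> borel_measurable M" "\<And>i. i < N \<Longrightarrow> (\<lambda>x. g x i) \<in> borel_measurable M"
    and f: "integrable M (\<lambda>x. \<Sum>i = 0..<N. \<bar>f x i\<bar> powr p)" and g: "integrable M (\<lambda>x. \<Sum>i = 0..<N. \<bar>g x i\<bar> powr p)"
  shows "integrable M (\<lambda>x. \<Sum>i = 0..<N. \<bar>f x i + g x i\<bar> powr p)" (is "integrable M ?H")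
    and "(\<integral>x. (\<Sum>i = 0..<N. \<bar>f x i + g x i\<bar> powr p) \<partial>M) powr (1 / p)
      \<le> (\<integral>x. (\<Sum>i = 0..<N. \<bar>f x i\<bar> powr p) \<partial>M) powr (1 / p) + (\<integral>x. (\<Sum>i = 0..<N. \<bar>g x i\<bar> powr p) \<partial>M) powr (1 / p)"
proof -
  let ?F = "\<lambda>x. \<Sum>i = 0..<N. \<bar>f x i\<bar> powr p" and ?G = "\<lambda>x. \<Sum>i = 0..<N. \<bar>g x i\<bar> powr p"
  have bound: "?H x \<le> (1 - \<theta>) powr (1 - p) * ?F x + \<theta> powr (1 - p) * ?G x" if "0 < \<theta>" "\<theta> < 1" for \<theta> x
    unfolding sum_distrib_left sum.distrib[symmetric] by (intro sum_mono abs_add_powr_le p that)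
  have H0: "0 \<le> ?H x" "0 \<le> ?F x" "0 \<le> ?G x" for x by (auto intro: sum_nonneg)
  have Hm: "?H \<in> borel_measurable M" by (intro borel_measurable_sum) measurable
  show H: "integrable M ?H"
  proof (rule Bochner_Integration.integrable_bound)
    show "integrable M (\<lambda>x. (1 - 1/2) powr (1 - p) * ?F x + (1/2) powr (1 - p) * ?G x)"
      by (intro Bochner_Integration.integrable_add integrable_mult_right f g)
    show "AE x in M. norm (?H x) \<le> norm ((1 - 1/2) powr (1 - p) * ?F x + (1/2) powr (1 - p) * ?G x)"
    proof (rule AE_I2)
      fix x
      have "0 \<le> (1 - 1/2) powr (1 - p) * ?F x + (1/2) powr (1 - p) * ?G x"
        using H0[of x] by (intro add_nonneg_nonneg mult_nonneg_nonneg) auto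
      then show "norm (?H x) \<le> norm ((1 - 1/2) powr (1 - p) * ?F x + (1/2) powr (1 - p) * ?G x)"
        using bound[of "1/2" x] H0[of x] by simp
    qed
  qed (rule Hm)
  let ?a = "(\<integral>x. ?F x \<partial>M) powr (1 / p)" and ?b = "(\<integral>x. ?G x \<partial>M) powr (1 / p)"
  show "(\<integral>x. ?H x \<partial>M) powr (1 / p) \<le> ?a + ?b"
  proof (rule field_le_epsilon)
    fix e :: real assume e: "0 < e"
    \<comment> \<open>The extra \<open>e / 2\<close> keeps \<open>A\<close> and \<open>B\<close>
      positive, and hence \<open>\<theta>\<close> strictly between 0 and 1, even if one of the norms
      vanishes.\<close>
    define A where "A = ?a + e / 2"
    define B where "B = ?b + e / 2"
    have AB: "0 < A" "0 < B" using e by (auto simp: A_def B_def add_nonneg_pos)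
    have root: "I \<le> (I powr (1 / p) + e / 2) powr p" if "0 \<le> I" for I :: real
    proof -
      have "I = (I powr (1 / p)) powr p" using that p by (simp add: powr_powr)
      also have "\<dots> \<le> (I powr (1 / p) + e / 2) powr p" using p e by (intro powr_mono2) auto
      finally show ?thesis .
    qed
    have IF: "(\<integral>x. ?F x \<partial>M) \<le> A powr p" and IG: "(\<integral>x. ?G x \<partial>M) \<le> B powr p"
      unfolding A_def B_def using H0 by (intro root integral_nonneg_AE AE_I2; simp)+
    \<comment> \<open>With this choice the two weighted terms become \<open>A\<close> and
      \<open>B\<close> times the common factor \<open>(A + B) powr (p - 1)\<close>, and their sum is
      \<open>(A + B) powr p\<close>.\<close>
    define \<theta> where "\<theta> = B / (A + B)"
    have \<theta>: "0 < \<theta>" "\<theta> < 1" "1 - \<theta> = A / (A + B)" using AB by (auto simp: \<theta>_def field_simps)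
    have part: "(C / (A + B)) powr (1 - p) * C powr p = C * (A + B) powr (p - 1)" if "0 < C" for C
    proof -
      have "(C / (A + B)) powr (1 - p) = C powr (1 - p) / (A + B) powr (1 - p)"
        using that AB by (simp add: powr_divide)
      also have "\<dots> = C powr (1 - p) * (A + B) powr (p - 1)"
        using powr_minus_divide[of "A + B" "1 - p"] by simp
      finally show ?thesis using powr_diff_mult_self[of C p] that by (simp add: algebra_simps)
    qed
    have "(\<integral>x. ?H x \<partial>M) \<le> (\<integral>x. (1 - \<theta>) powr (1 - p) * ?F x + \<theta> powr (1 - p) * ?G x \<partial>M)"
      by (intro integral_mono H Bochner_Integration.integrable_add integrable_mult_right f g bound \<theta>)
    also have "\<dots> = (1 - \<theta>) powr (1 - p) * (\<integral>x. ?F x \<partial>M) + \<theta> powr (1 - p) * (\<integral>x. ?G x \<partial>M)"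
      using f g by (subst Bochner_Integration.integral_add) (auto simp del: sum_distrib_left)
    also have "\<dots> \<le> (1 - \<theta>) powr (1 - p) * A powr p + \<theta> powr (1 - p) * B powr p"
      using IF IG by (intro add_mono mult_left_mono) auto
    also have "\<dots> = (A + B) * (A + B) powr (p - 1)"
      unfolding \<theta>(3) unfolding \<theta>_def using AB by (simp add: part distrib_right)
    also have "\<dots> = (A + B) powr p" using AB by (simp add: powr_diff)
    finally have "(\<integral>x. ?H x \<partial>M) powr (1 / p) \<le> ((A + B) powr p) powr (1 / p)"
      using H0 p by (intro powr_mono2 integral_nonneg_AE AE_I2) auto
    also have "\<dots> = A + B" using AB p by (simp add: powr_powr)
    finally show "(\<integral>x. ?H x \<partial>M) powr (1 / p) \<le> ?a + ?b + e" by (simp add: A_def B_def)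
  qed
qed

section \<open>The cost, its integrability, and arctan distances\<close>

lemma abs_arctan_diff_le: "\<bar>arctan x - arctan y\<bar> \<le> \<bar>x - y\<bar>"
proof -
  have *: "arctan b - arctan a \<le> b - a" if ab: "a < b" for a b
  proof -
    obtain z where "arctan b - arctan a = (b - a) * inverse (1 + z\<^sup>2)"
      using MVT2[OF ab, of arctan "\<lambda>z. inverse (1 + z\<^sup>2)"] DERIV_arctan by blast
    moreover have "inverse (1 + z\<^sup>2) \<le> 1" by (simp add: inverse_le_1_iff)
    ultimately show ?thesis using mult_left_mono[of "inverse (1 + z\<^sup>2)" 1 "b - a"] ab by simp
  qed
  show ?thesis
    using *[of x y] *[of y x] arctan_less_iff[of x y] arctan_less_iff[of y x] by (cases x y rule: linorder_cases) auto
qed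

lemma cost_nonneg: "0 \<le> cost p N x y"
  by (simp add: cost_def sum_nonneg L2_set_nonneg)

lemma cost_commute: "cost p N x y = cost p N y x"
  by (simp add: cost_def L2_set_def power2_commute abs_minus_commute)

lemma cost_eq_0_iff: "cost p N x y = 0 \<longleftrightarrow> (\<forall>i<N. x i = y i)"
proof -
  have "min (L2_set (\<lambda>i. x i - y i) {0..<N}) 1 = 0 \<longleftrightarrow> L2_set (\<lambda>i. x i - y i) {0..<N} = 0"
    using L2_set_nonneg[of "\<lambda>i. x i - y i" "{0..<N}"] by (auto simp: min_def)
  then show ?thesis
    by (auto simp: cost_def L2_set_eq_0_iff sum_nonneg_eq_0_iff)
qed

text \<open>The affine form can be integrated directly and plays the part of Markov's inequality.
  For \<open>p = 0\<close> the constant 4 bounds the left side where the cost is truncated at 1;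
  elsewhere the cost dominates the difference. For \<open>p \<ge> 1\<close> a difference
  \<open>d > \<eta>\<close> satisfies \<open>d = d powr (1 - p) * d powr p \<le> \<eta> powr (1 - p)
  * d powr p\<close>.\<close>

lemma arctan_diff_le_cost:
  assumes p: "p = 0 \<or> 1 \<le> p" and \<eta>: "0 < \<eta>"
  obtains C where "0 \<le> C" "\<And>x y k. k < N \<Longrightarrow> \<bar>arctan (x k) - arctan (y k)\<bar> \<le> \<eta> + C * cost p N x y"
proof (cases "p = 0")
  case True
  have "\<bar>arctan (x k) - arctan (y k)\<bar> \<le> \<eta> + 4 * cost p N x y" if k: "k < N" for x y k
  proof -
    have "\<bar>arctan (x k) - arctan (y k)\<bar> \<le> 4" using arctan_abs_le2[of "x k"] arctan_abs_le2[of "y k"] by linarith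
    moreover have "\<bar>arctan (x k) - arctan (y k)\<bar> \<le> \<bar>x k - y k\<bar>" by (rule abs_arctan_diff_le)
    moreover have "\<bar>x k - y k\<bar> \<le> L2_set (\<lambda>i. x i - y i) {0..<N}"
      using member_le_L2_set[of "{0..<N}" k "\<lambda>i. \<bar>x i - y i\<bar>"] k by (simp add: L2_set_def)
    ultimately show ?thesis using True \<eta> by (auto simp: cost_def min_def)
  qed
  then show ?thesis by (intro that[of 4]) auto
next
  case False
  with p have p: "1 \<le> p" by simp
  have "\<bar>arctan (x k) - arctan (y k)\<bar> \<le> \<eta> + \<eta> powr (1 - p) * cost p N x y" if k: "k < N" for x y k
  proof -
    let ?d = "\<bar>x k - y k\<bar>"
    have c: "?d powr p \<le> cost p N x y"
      unfolding cost_def using False k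
      by (simp add: member_le_sum[of k "{0..<N}" "\<lambda>i. \<bar>x i - y i\<bar> powr p"])
    have "?d \<le> \<eta> + \<eta> powr (1 - p) * ?d powr p"
    proof (cases "?d \<le> \<eta>")
      case False
      then have "?d powr (1 - p) \<le> \<eta> powr (1 - p)" using \<eta> p by (intro powr_mono2') auto
      then have "?d powr (1 - p) * ?d powr p \<le> \<eta> powr (1 - p) * ?d powr p" by (rule mult_right_mono) simp
      then show ?thesis using \<eta> by (simp add: powr_diff_mult_self)
    qed (simp add: add_increasing2)
    also have "\<dots> \<le> \<eta> + \<eta> powr (1 - p) * cost p N x y" using c by (intro add_left_mono mult_left_mono) auto
    finally show ?thesis using abs_arctan_diff_le[of "x k" "y k"] by linarith
  qed
  then show ?thesis by (intro that[of "\<eta> powr (1 - p)"]) auto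
qed

lemma measurable_cost:
  assumes "X \<in> measurable \<Omega> (RN N)" "Y \<in> measurable \<Omega> (RN N)"
  shows "(\<lambda>w. cost p N (X w) (Y w)) \<in> borel_measurable \<Omega>"
proof -
  have [measurable]: "(\<lambda>w. X w i) \<in> borel_measurable \<Omega>" "(\<lambda>w. Y w i) \<in> borel_measurable \<Omega>" if "i \<in> {0..<N}" for i
    using that assms by (auto intro!: measurable_compose[OF _ measurable_component_singleton])
  show ?thesis unfolding cost_def L2_set_def
    by (cases "p = 0") (simp_all, measurable)
qed

text \<open>The Bochner integral of a non-integrable function is 0, so small or vanishing mean costs
  carry information only once integrability is known.\<close>

lemma integrable_cost:
  assumes "p = 0 \<or> 1 \<le> p" and \<Omega>: "prob_space \<Omega>" and XY: "X \<in> measurable \<Omega> (RN N)" "Y \<in> measurable \<Omega> (RN N)"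
    and "distr \<Omega> (RN N) X \<in> prob_measures p N" "distr \<Omega> (RN N) Y \<in> prob_measures p N"
  shows "integrable \<Omega> (\<lambda>w. cost p N (X w) (Y w))"
proof (cases "p = 0")
  case True
  interpret prob_space \<Omega> by fact
  show ?thesis

  proof (rule integrable_const_bound)
    show "AE w in \<Omega>. norm (cost p N (X w) (Y w)) \<le> 1" using True by (auto simp: cost_def L2_set_nonneg)
  qed (rule measurable_cost[OF XY])
next
  case False
  then have p: "1 \<le> p" using assms by simp
  have m: "(\<lambda>w. X w i) \<in> borel_measurable \<Omega>" "(\<lambda>w. - Y w i) \<in> borel_measurable \<Omega>" if "i < N" for i
    using that XY by (auto intro!: measurable_compose[OF _ measurable_component_singleton])
  have nm: "(\<lambda>x. \<Sum>i = 0..<N. \<bar>x i\<bar> powr p) \<in> borel_measurable (RN N)" by measurable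
  have "integrable \<Omega> (\<lambda>w. \<Sum>i = 0..<N. \<bar>X w i\<bar> powr p)"
    using assms(5) False integrable_distr_eq[OF XY(1) nm] by (simp add: prob_measures_def)
  moreover have "integrable \<Omega> (\<lambda>w. \<Sum>i = 0..<N. \<bar>- Y w i\<bar> powr p)"
    using assms(6) False integrable_distr_eq[OF XY(2) nm] by (simp add: prob_measures_def)
  ultimately have "integrable \<Omega> (\<lambda>w. \<Sum>i = 0..<N. \<bar>X w i + - Y w i\<bar> powr p)"
    by (intro minkowski_integral(1)[OF p m])
  then show ?thesis using False by (simp add: cost_def)
qed

text \<open>The zipped pair is the path of a recursion \<open>r\<close> with values in
  \<open>real \<times> real\<close>, so \<open>disintegration_law\<close> supplies its
  disintegration. The kernel of \<open>r\<close> at a pair of pasts is the law of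
  \<open>(q k (x, t), q' k (y, t))\<close> for one uniform \<open>t\<close>, which couples the two
  kernels.\<close>

lemma path_coupling_bicausal:
  assumes q: "monotone_map q" and q': "monotone_map q'"
  shows "distr (unit_cube N) (RN N \<Otimes>\<^sub>M RN N) (\<lambda>u. (path q N u, path q' N u))
    \<in> bicausal_couplings N (recursive_map.law q N) (recursive_map.law q' N)"
proof -
  interpret q: monotone_map q by fact
  interpret q': monotone_map q' by fact
  define r where "r k z = (q k (\<lambda>i\<in>{0..<k}. fst (fst z i), snd z), q' k (\<lambda>i\<in>{0..<k}. snd (fst z i), snd z))"
    for k and z :: "(nat \<Rightarrow> real \<times> real) \<times> real"
  have proj: "(\<lambda>z. (\<lambda>i\<in>{0..<k}. g (fst z i), snd z)) \<in>
      measurable (seq_space k \<Otimes>\<^sub>M unif01) (RN k \<Otimes>\<^sub>M unif01)"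
    if "g \<in> borel_measurable borel" for k and g :: "real \<times> real \<Rightarrow> real"
    by (intro measurable_Pair measurable_restrict measurable_snd measurable_compose[OF _ that]
       measurable_compose[OF measurable_fst] measurable_component_singleton)
  have fs: "fst \<in> borel_measurable (borel :: (real \<times> real) measure)" "snd \<in> borel_measurable (borel :: (real \<times> real) measure)"
    unfolding borel_prod[symmetric] by simp_all
  interpret r: recursive_map r
  proof
    fix k
    show "r k \<in> borel_measurable (seq_space k \<Otimes>\<^sub>M unif01)"
      unfolding borel_prod[symmetric] r_def[abs_def]
      using measurable_compose[OF proj[OF fs(1)] q.r_measurable] measurable_compose[OF proj[OF fs(2)] q'.r_measurable]
      by (intro measurable_Pair) (simp_all add: borel_prod)
  qed
  have pm: "path q N \<in> measurable (unit_cube N) (RN N)" "path q' N \<in> measurable (unit_cube N) (RN N)"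
    by (auto intro: q.path_measurable q'.path_measurable)
  have pp: "(\<lambda>u. (path q N u, path q' N u)) \<in> measurable (unit_cube N) (RN N \<Otimes>\<^sub>M RN N)"
    using pm by (rule measurable_Pair)
  let ?\<pi> = "distr (unit_cube N) (RN N \<Otimes>\<^sub>M RN N) (\<lambda>u. (path q N u, path q' N u))"
  have zip: "zip_path N (path q N u, path q' N u) = path r N u" for u
  proof (rule path_unique)
    show "zip_path N (path q N u, path q' N u) \<in> extensional {0..<N}" by (simp add: zip_path_def)
    fix k assume k: "k < N"
    have "(\<lambda>i\<in>{0..<k}. fst (restrict (zip_path N (path q N u, path q' N u)) {0..<k} i)) = restrict (path q N u) {0..<k}"
      "(\<lambda>i\<in>{0..<k}. snd (restrict (zip_path N (path q N u, path q' N u)) {0..<k} i)) = restrict (path q' N u) {0..<k}"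
      using k by (auto simp: zip_path_def fun_eq_iff)
    then show "zip_path N (path q N u, path q' N u) k = r k (restrict (zip_path N (path q N u, path q' N u)) {0..<k}, u k)"
      using k by (simp add: r_def zip_path_def flip: path_nth)
  qed
  have d1: "distr ?\<pi> (seq_space N) (zip_path N) = r.law N"
    unfolding r.law_def by (subst distr_distr[OF measurable_zip_path[OF order_refl] pp]) (simp add: comp_def zip)
  have sets: "sets ?\<pi> = sets (q.law N \<Otimes>\<^sub>M q'.law N)" by (simp cong: sets_pair_measure_cong)
  have f: "distr ?\<pi> (q.law N) fst = q.law N"
  proof -
    have "distr ?\<pi> (q.law N) fst = distr (unit_cube N) (q.law N) (\<lambda>u. path q N u)"
      using pp by (subst distr_distr) (auto simp: comp_def cong: measurable_cong_sets)
    also have "\<dots> = q.law N" unfolding q.law_def by (rule distr_cong) simp_all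
    finally show ?thesis .
  qed
  have s: "distr ?\<pi> (q'.law N) snd = q'.law N"
  proof -
    have "distr ?\<pi> (q'.law N) snd = distr (unit_cube N) (q'.law N) (\<lambda>u. path q' N u)"
      using pp by (subst distr_distr) (auto simp: comp_def cong: measurable_cong_sets)
    also have "\<dots> = q'.law N" unfolding q'.law_def by (rule distr_cong) simp_all
    finally show ?thesis .
  qed
  have ker: "r.ker k (zip_path k z) \<in> couplings (q.ker k (restrict (fst z) {0..<k})) (q'.ker k (restrict (snd z) {0..<k}))"
    for k and z :: "(nat \<Rightarrow> real) \<times> (nat \<Rightarrow> real)"
  proof -
    let ?x = "restrict (fst z) {0..<k}" and ?y = "restrict (snd z) {0..<k}"
    have xy: "?x \<in> space (RN k)" "?y \<in> space (RN k)" by (simp_all add: space_RN)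
    have "(\<lambda>i\<in>{0..<k}. fst (zip_path k z i)) = ?x" "(\<lambda>i\<in>{0..<k}. snd (zip_path k z i)) = ?y"
      by (auto simp: zip_path_def fun_eq_iff)
    then have k: "r.ker k (zip_path k z) = distr unif01 borel (\<lambda>t. (q k (?x, t), q' k (?y, t)))"
      by (simp add: r.ker_def r_def)
    note m = q.r_section_measurable[OF xy(1)] q'.r_section_measurable[OF xy(2)]
    have pm: "(\<lambda>t. (q k (?x, t), q' k (?y, t))) \<in> measurable unif01 (borel :: (real \<times> real) measure)"
      unfolding borel_prod[symmetric] using m by (rule measurable_Pair)
    show ?thesis
      unfolding couplings_def
    proof (intro CollectI conjI)
      show "sets (r.ker k (zip_path k z)) = sets (q.ker k ?x \<Otimes>\<^sub>M q'.ker k ?y)"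
      proof -
        have "sets (q.ker k ?x \<Otimes>\<^sub>M q'.ker k ?y) = sets (borel \<Otimes>\<^sub>M borel)"
          by (rule sets_pair_measure_cong) (simp_all add: q.ker_def q'.ker_def)
        also have "\<dots> = sets borel" by (rule arg_cong[OF borel_prod])
        finally show ?thesis by (simp add: r.ker_def)
      qed
      have "distr (distr unif01 borel (\<lambda>t. (q k (?x, t), q' k (?y, t)))) borel fst = q.ker k ?x"
        unfolding q.ker_def by (subst distr_distr[OF fs(1) pm]) (simp add: comp_def)
      then show "distr (r.ker k (zip_path k z)) (q.ker k ?x) fst = q.ker k ?x"
        unfolding k by (subst distr_cong[OF refl, of _ borel]) (simp_all add: q.ker_def)
      have "distr (distr unif01 borel (\<lambda>t. (q k (?x, t), q' k (?y, t)))) borel snd = q'.ker k ?y"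
        unfolding q'.ker_def by (subst distr_distr[OF fs(2) pm]) (simp add: comp_def)
      then show "distr (r.ker k (zip_path k z)) (q'.ker k ?y) snd = q'.ker k ?y"
        unfolding k by (subst distr_cong[OF refl, of _ borel]) (simp_all add: q'.ker_def)
    qed
  qed
  show ?thesis
    unfolding bicausal_couplings_def mem_Collect_eq
  proof (intro conjI exI)
    show "?\<pi> \<in> couplings (q.law N) (q'.law N)" unfolding couplings_def using sets f s by blast
    show "disintegration N (distr ?\<pi> (seq_space N) (zip_path N)) r.ker"
      unfolding d1 by (rule r.disintegration_law)
    show "disintegration N (q.law N) q.ker" by (rule q.disintegration_law)
    show "disintegration N (q'.law N) q'.ker" by (rule q'.disintegration_law)
    show "AE z in ?\<pi>. \<forall>k<N. r.ker k (zip_path k z) \<in>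
       couplings (q.ker k (restrict (fst z) {0..<k})) (q'.ker k (restrict (snd z) {0..<k}))"
      using ker by simp
  qed
qed

subsection \<open>The Knothe--Rosenblatt distance\<close>

lemma prob_measures_quantile_map:
  assumes "\<mu> \<in> prob_measures p N"
  obtains q where "monotone_map q" "recursive_map.law q N = \<mu>"
    "\<And>u. u \<in> space (unit_cube N) \<Longrightarrow> quantile_map N \<mu> u = path q N u"
proof -
  have "prob_space \<mu>" "sets \<mu> = sets (RN N)" using assms by (auto simp: prob_measures_def)
  then obtain q where q: "monotone_map q" "distr (unit_cube N) (RN N) (path q N) = \<mu>"
    "\<And>u. u \<in> space (unit_cube N) \<Longrightarrow> quantile_map N \<mu> u = path q N u"
    by (rule quantile_map_path) blast
  interpret monotone_map q by fact
  show ?thesis using q by (intro that) (auto simp: law_def)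
qed

lemma quantile_map_measurable:
  assumes "\<mu> \<in> prob_measures p N"
  shows "quantile_map N \<mu> \<in> measurable (unit_cube N) (RN N)"
    and "distr (unit_cube N) (RN N) (quantile_map N \<mu>) = \<mu>"
proof -
  obtain q where q: "monotone_map q" "recursive_map.law q N = \<mu>"
    "\<And>u. u \<in> space (unit_cube N) \<Longrightarrow> quantile_map N \<mu> u = path q N u"
    by (rule prob_measures_quantile_map[OF assms]) blast
  interpret monotone_map q by fact
  show "quantile_map N \<mu> \<in> measurable (unit_cube N) (RN N)"
    using path_measurable[OF order_refl, of N] q(3) by (subst measurable_cong) auto
  have "distr (unit_cube N) (RN N) (quantile_map N \<mu>) = law N"
    unfolding law_def by (rule distr_cong) (use q(3) in auto)
  then show "distr (unit_cube N) (RN N) (quantile_map N \<mu>) = \<mu>" using q(2) by simp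
qed

lemma integrable_cost_quantile_map:
  assumes "p = 0 \<or> 1 \<le> p" "\<mu> \<in> prob_measures p N" "\<nu> \<in> prob_measures p N"
  shows "integrable (unit_cube N) (\<lambda>u. cost p N (quantile_map N \<mu> u) (quantile_map N \<nu> u))"
  using assms by (intro integrable_cost prob_space_unit_cube) (simp_all add: quantile_map_measurable)

lemma root_p_nonneg: "0 \<le> c \<Longrightarrow> 0 \<le> root_p p c"
  by (simp add: root_p_def)

lemma root_p_eq_0_iff: "p = 0 \<or> 1 \<le> p \<Longrightarrow> root_p p c = 0 \<longleftrightarrow> c = 0"
  by (auto simp: root_p_def)

text \<open>\<open>KR\<close> is the metric of \<open>L^p\<close>, or for \<open>p = 0\<close> the
  truncated one of convergence in probability, pulled back along \<open>quantile_map N\<close>.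
  Distinct measures are separated because each is the image of the cube under its quantile
  process.\<close>

lemma Metric_space_KR:
  assumes p: "p = 0 \<or> 1 \<le> p"
  shows "Metric_space (prob_measures p N) (KR p N)"
proof
  show "0 \<le> KR p N \<mu> \<nu>" for \<mu> \<nu>
    unfolding KR_def by (intro root_p_nonneg integral_nonneg_AE AE_I2 cost_nonneg)
  show "KR p N \<mu> \<nu> = KR p N \<nu> \<mu>" for \<mu> \<nu>
    unfolding KR_def by (subst cost_commute) simp
next
  fix \<mu> \<nu> assume \<mu>: "\<mu> \<in> prob_measures p N" and \<nu>: "\<nu> \<in> prob_measures p N"
  let ?X = "quantile_map N \<mu>" and ?Y = "quantile_map N \<nu>"
  show "KR p N \<mu> \<nu> = 0 \<longleftrightarrow> \<mu> = \<nu>"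
  proof
    assume "KR p N \<mu> \<nu> = 0"
    then have "(\<integral>u. cost p N (?X u) (?Y u) \<partial>unit_cube N) = 0"
      using p by (simp add: KR_def root_p_eq_0_iff)
    then have "AE u in unit_cube N. cost p N (?X u) (?Y u) = 0"
      using integrable_cost_quantile_map[OF p \<mu> \<nu>] by (subst (asm) integral_nonneg_eq_0_iff_AE) (auto simp: cost_nonneg)
    with AE_space have eq: "AE u in unit_cube N. ?X u = ?Y u"
    proof eventually_elim
      case (elim u)
      then have "?X u \<in> extensional {0..<N}" "?Y u \<in> extensional {0..<N}"
        using measurable_space[OF quantile_map_measurable(1)[OF \<mu>]] measurable_space[OF quantile_map_measurable(1)[OF \<nu>]]
        by (auto simp: space_RN)
      then show ?case using elim by (auto simp: cost_eq_0_iff intro: extensionalityI)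
    qed
    have "\<mu> = distr (unit_cube N) (RN N) ?X" by (simp add: quantile_map_measurable[OF \<mu>])
    also have "\<dots> = distr (unit_cube N) (RN N) ?Y"
      using eq quantile_map_measurable[OF \<mu>] quantile_map_measurable[OF \<nu>] by (intro distr_cong_AE) auto
    also have "\<dots> = \<nu>" by (simp add: quantile_map_measurable[OF \<nu>])
    finally show "\<mu> = \<nu>" .
  next
    assume "\<mu> = \<nu>"
    moreover have "cost p N x x = 0" for x by (simp add: cost_eq_0_iff)
    ultimately show "KR p N \<mu> \<nu> = 0" using p by (simp add: KR_def root_p_eq_0_iff)
  qed
  fix \<rho> assume \<rho>: "\<rho> \<in> prob_measures p N"
  let ?Z = "quantile_map N \<rho>"
  note i = integrable_cost_quantile_map[OF p]
  show "KR p N \<mu> \<rho> \<le> KR p N \<mu> \<nu> + KR p N \<nu> \<rho>"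
  proof (cases "p = 0")
    case True
    have tri: "cost p N x z \<le> cost p N x y + cost p N y z" for x y z
    proof -
      have "L2_set (\<lambda>i. x i - z i) {0..<N} \<le> L2_set (\<lambda>i. x i - y i) {0..<N} + L2_set (\<lambda>i. y i - z i) {0..<N}"
        using L2_set_triangle_ineq[of "\<lambda>i. x i - y i" "\<lambda>i. y i - z i" "{0..<N}"] by simp
      moreover have "min c 1 \<le> min a 1 + min b 1" if "c \<le> a + b" "0 \<le> a" "0 \<le> b" for a b c :: real
        using that by (auto simp: min_def)
      ultimately show ?thesis using True by (simp add: cost_def L2_set_nonneg)
    qed
    have "(\<integral>u. cost p N (?X u) (?Z u) \<partial>unit_cube N) \<le> (\<integral>u. cost p N (?X u) (?Y u) + cost p N (?Y u) (?Z u) \<partial>unit_cube N)"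
      by (rule integral_mono[OF i[OF \<mu> \<rho>] Bochner_Integration.integrable_add[OF i[OF \<mu> \<nu>] i[OF \<nu> \<rho>]] tri])
    also have "\<dots> = (\<integral>u. cost p N (?X u) (?Y u) \<partial>unit_cube N) + (\<integral>u. cost p N (?Y u) (?Z u) \<partial>unit_cube N)"
      by (rule Bochner_Integration.integral_add[OF i[OF \<mu> \<nu>] i[OF \<nu> \<rho>]])
    finally show ?thesis using True by (simp add: KR_def root_p_def)
  next
    case False
    then have p1: "1 \<le> p" using p by simp
    have c: "cost p N x y = (\<Sum>i = 0..<N. \<bar>x i - y i\<bar> powr p)" for x y using False by (simp add: cost_def)
    have co: "(\<lambda>u. quantile_map N m u i) \<in> borel_measurable (unit_cube N)" if "m \<in> prob_measures p N" "i < N" for m i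
      using quantile_map_measurable[OF that(1)] that(2) by (auto intro!: measurable_compose[OF _ measurable_component_singleton])
    have "(\<integral>u. (\<Sum>i = 0..<N. \<bar>(?X u i - ?Y u i) + (?Y u i - ?Z u i)\<bar> powr p) \<partial>unit_cube N) powr (1 / p)
      \<le> (\<integral>u. (\<Sum>i = 0..<N. \<bar>?X u i - ?Y u i\<bar> powr p) \<partial>unit_cube N) powr (1 / p)
        + (\<integral>u. (\<Sum>i = 0..<N. \<bar>?Y u i - ?Z u i\<bar> powr p) \<partial>unit_cube N) powr (1 / p)"
      using \<mu> \<nu> \<rho>
      by (intro minkowski_integral(2)[OF p1 _ _ i[OF \<mu> \<nu>, unfolded c] i[OF \<nu> \<rho>, unfolded c]] borel_measurable_diff co)
    then show ?thesis using False by (simp add: KR_def root_p_def c)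
  qed
qed

section \<open>Bounding \<open>AW\<close> by \<open>KR\<close>\<close>

abbreviation mean_cost :: "real \<Rightarrow> nat \<Rightarrow> ((nat \<Rightarrow> real) \<times> (nat \<Rightarrow> real)) measure \<Rightarrow> real" where
  "mean_cost p N \<pi> \<equiv> \<integral>z. cost p N (fst z) (snd z) \<partial>\<pi>"

lemma bicausal_nonneg_integral: "0 \<le> (mean_cost p N \<pi>)"
  by (intro integral_nonneg_AE AE_I2 cost_nonneg)

lemma bdd_below_bicausal_costs:
  "bdd_below ((\<lambda>\<pi>. root_p p (mean_cost p N \<pi>)) ` bicausal_couplings N \<mu> \<nu>)"
  by (rule bdd_belowI[of _ 0]) (auto intro: root_p_nonneg bicausal_nonneg_integral)

text \<open>Besides the bound \<open>AW \<le> KR\<close>, this shows that bicausal couplings exist,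
  so that the infimum in \<open>AW\<close> is not taken over the empty set and near-optimal
  couplings can be picked.\<close>

lemma KR_attained:
  assumes "\<mu> \<in> prob_measures p N" "\<nu> \<in> prob_measures p N"
  obtains \<pi> where "\<pi> \<in> bicausal_couplings N \<mu> \<nu>" "root_p p (mean_cost p N \<pi>) = KR p N \<mu> \<nu>"
proof -
  obtain q where q: "monotone_map q" "recursive_map.law q N = \<mu>"
    "\<And>u. u \<in> space (unit_cube N) \<Longrightarrow> quantile_map N \<mu> u = path q N u"
    by (rule prob_measures_quantile_map[OF assms(1)]) blast
  obtain q' where q': "monotone_map q'" "recursive_map.law q' N = \<nu>"
    "\<And>u. u \<in> space (unit_cube N) \<Longrightarrow> quantile_map N \<nu> u = path q' N u"
    by (rule prob_measures_quantile_map[OF assms(2)]) blast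
  interpret q: monotone_map q by fact
  interpret q': monotone_map q' by fact
  let ?\<pi> = "distr (unit_cube N) (RN N \<Otimes>\<^sub>M RN N) (\<lambda>u. (path q N u, path q' N u))"
  have pp: "(\<lambda>u. (path q N u, path q' N u)) \<in> measurable (unit_cube N) (RN N \<Otimes>\<^sub>M RN N)"
    by (rule measurable_Pair[OF q.path_measurable[OF order_refl] q'.path_measurable[OF order_refl]])
  have "(mean_cost p N ?\<pi>) = (\<integral>u. cost p N (path q N u) (path q' N u) \<partial>unit_cube N)"
    by (subst integral_distr[OF pp measurable_cost[OF measurable_fst measurable_snd]]) simp
  also have "\<dots> = (\<integral>u. cost p N (quantile_map N \<mu> u) (quantile_map N \<nu> u) \<partial>unit_cube N)"
    by (rule Bochner_Integration.integral_cong) (simp_all add: q(3) q'(3))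
  finally show ?thesis
    using path_coupling_bicausal[OF q(1) q'(1), of N] by (intro that[of ?\<pi>]) (simp_all add: q(2) q'(2) KR_def)
qed

lemma AW_le_KR:
  assumes "\<mu> \<in> prob_measures p N" "\<nu> \<in> prob_measures p N"
  shows "AW p N \<mu> \<nu> \<le> KR p N \<mu> \<nu>"
proof -
  obtain \<pi> where \<pi>: "\<pi> \<in> bicausal_couplings N \<mu> \<nu>" "root_p p (mean_cost p N \<pi>) = KR p N \<mu> \<nu>"
    by (rule KR_attained[OF assms])
  have "AW p N \<mu> \<nu> \<le> root_p p (mean_cost p N \<pi>)"
    unfolding AW_def by (rule cINF_lower[OF bdd_below_bicausal_costs \<pi>(1)])
  then show ?thesis by (simp only: \<pi>(2))
qed

section \<open>From small adapted cost to convergence of quantile processes\<close>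

lemma tendsto_0_ennrealI:
  fixes f :: "nat \<Rightarrow> ennreal"
  assumes "\<And>e. 0 < e \<Longrightarrow> eventually (\<lambda>n. f n \<le> ennreal e) sequentially"
  shows "f \<longlonglongrightarrow> 0"
proof (rule order_tendstoI)
  fix a :: ennreal assume "0 < a"
  then obtain e where e: "0 < e" "ennreal e < a"
  proof (cases a)
    case (real r)
    with \<open>0 < a\<close> show ?thesis by (intro that[of "r / 2"]) (auto simp: ennreal_less_iff)
  next
    case top
    then show ?thesis by (intro that[of 1]) auto
  qed
  from assms[OF e(1)] show "eventually (\<lambda>n. f n < a) sequentially"
    by eventually_elim (rule order_le_less_trans[OF _ e(2)])
qed simp

lemma nn_integral_arctan_dist:
  assumes "\<And>i. i < k \<Longrightarrow> (\<lambda>w. X w i) \<in> borel_measurable M" "\<And>i. i < k \<Longrightarrow> (\<lambda>w. Y w i) \<in> borel_measurable M"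
  shows "(\<integral>\<^sup>+w. ennreal (arctan_dist k (X w) (Y w)) \<partial>M) = (\<Sum>i<k. \<integral>\<^sup>+w. ennreal \<bar>arctan (X w i) - arctan (Y w i)\<bar> \<partial>M)"
proof -
  have "(\<integral>\<^sup>+w. ennreal (arctan_dist k (X w) (Y w)) \<partial>M) = (\<integral>\<^sup>+w. (\<Sum>i<k. ennreal \<bar>arctan (X w i) - arctan (Y w i)\<bar>) \<partial>M)"
    by (simp add: arctan_dist_def)
  also have "\<dots> = (\<Sum>i<k. \<integral>\<^sup>+w. ennreal \<bar>arctan (X w i) - arctan (Y w i)\<bar> \<partial>M)"
    using assms by (intro nn_integral_sum) auto
  finally show ?thesis .
qed

text \<open>The order of choices matters: \<open>e\<close> fixes the constant \<open>L\<close> of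
  \<open>key_estimate\<close> for all \<open>n\<close> at once, and only then does \<open>n\<close>
  grow and remove the terms multiplied by \<open>L\<close>. The term \<open>path_dist k\<close>
  involves earlier coordinates only, so strong induction applies.\<close>

lemma arctan_convergence:
  assumes p: "p = 0 \<or> 1 \<le> p" and q: "monotone_map q" and r: "\<And>n::nat. monotone_map (r n)"
    and P: "recursive_map.law q N \<in> prob_measures p N" "\<And>n. recursive_map.law (r n) N \<in> prob_measures p N"
    and pi: "\<And>n. \<pi> n \<in> bicausal_couplings N (recursive_map.law q N) (recursive_map.law (r n) N)"
    and lim: "(\<lambda>n. mean_cost p N (\<pi> n)) \<longlonglongrightarrow> 0" and k: "k < N"
  shows "(\<lambda>n. path_gap k N q (r n)) \<longlonglongrightarrow> 0"
proof -
  note bm = bicausal_coordinate_measurable[OF q r pi]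
  have ic: "integrable (\<pi> n) (\<lambda>z. cost p N (fst z) (snd z))" for n
    using P by (intro integrable_cost[OF p bm(1,2,3)]) (simp_all add: bm)
  define A where "A i n = coupling_gap i (\<pi> n)" for i n
  define D where "D i n = path_gap i N q (r n)" for i n
  have A0: "A i \<longlonglongrightarrow> 0" if i: "i < N" for i
  proof (rule tendsto_0_ennrealI)
    fix e :: real assume e: "0 < e"
    then have "0 < e / 2" by simp
    then obtain C where C: "0 \<le> C" "\<And>x y k. k < N \<Longrightarrow> \<bar>arctan (x k) - arctan (y k)\<bar> \<le> e / 2 + C * cost p N x y"
      by (rule arctan_diff_le_cost[OF p]) blast
    have le: "A i n \<le> ennreal (e / 2 + C * (mean_cost p N (\<pi> n)))" for n
    proof -
      interpret prob_space "\<pi> n" by (rule bm(1))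
      have "A i n \<le> (\<integral>\<^sup>+z. ennreal (e / 2 + C * cost p N (fst z) (snd z)) \<partial>\<pi> n)"
        unfolding A_def by (intro nn_integral_mono ennreal_leI C(2) i)
      also have "\<dots> = ennreal (\<integral>z. e / 2 + C * cost p N (fst z) (snd z) \<partial>\<pi> n)"
        using e C(1) ic[of n] by (intro nn_integral_eq_integral AE_I2) (auto simp: cost_nonneg)
      also have "(\<integral>z. e / 2 + C * cost p N (fst z) (snd z) \<partial>\<pi> n) = e / 2 + C * (mean_cost p N (\<pi> n))"
        using ic[of n] by (simp add: prob_space)
      finally show ?thesis .
    qed
    have "(\<lambda>n. C * (mean_cost p N (\<pi> n))) \<longlonglongrightarrow> C * 0"
      by (rule tendsto_mult[OF tendsto_const lim])
    then have "eventually (\<lambda>n. C * (mean_cost p N (\<pi> n)) < e / 2) sequentially"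
      using e by (intro order_tendstoD(2)[where a="e/2"]) auto
    then show "eventually (\<lambda>n. A i n \<le> ennreal e) sequentially"
    proof eventually_elim
      case (elim n)
      have "A i n \<le> ennreal (e / 2 + C * (mean_cost p N (\<pi> n)))" by (rule le)
      also have "\<dots> \<le> ennreal e" using elim by (intro ennreal_leI) simp
      finally show ?case .
    qed
  qed
  have coordm: "(\<lambda>z. fst z i) \<in> borel_measurable (\<pi> n)" "(\<lambda>z. snd z i) \<in> borel_measurable (\<pi> n)" if "i < N" for i n
    using measurable_compose[OF bm(2)[of n] measurable_component_singleton[of i "{0..<N}"]]
      measurable_compose[OF bm(3)[of n] measurable_component_singleton[of i "{0..<N}"]] that by simp_all
  have "D k \<longlonglongrightarrow> 0"
    using k
  proof (induction k rule: less_induct)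
    case (less k)
    show ?case
    proof (rule tendsto_0_ennrealI)
      fix e :: real assume e: "0 < e"
      then have "0 < e / 4" by simp
      then obtain L where L: "0 \<le> L" "\<And>q' \<pi>. monotone_map q' \<Longrightarrow> \<pi> \<in> bicausal_couplings N (recursive_map.law q N) (recursive_map.law q' N) \<Longrightarrow>
        path_gap k N q q'
         \<le> ennreal (e / 4) + ennreal L * path_dist k N q q'
            + coupling_gap k \<pi>
            + ennreal (e / 4) + ennreal L * coupling_dist k \<pi>"
        by (rule key_estimate[OF q less.prems]) blast
      \<comment> \<open>\<open>R\<close> collects the terms that vanish as \<open>n\<close> grows;
        the two approximation errors \<open>e / 4\<close> stay outside and add up to
        \<open>e / 2\<close>.\<close>
      define R where "R n = ennreal L * (\<Sum>i<k. D i n) + A k n + ennreal L * (\<Sum>i<k. A i n)" for n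
      have DR: "D k n \<le> ennreal (e / 2) + R n" for n
      proof -
        have s1: "path_dist k N q (r n) = (\<Sum>i<k. D i n)"
          unfolding D_def using less.prems by (intro nn_integral_arctan_dist monotone_map.path_coord_measurable q r) auto
        have s2: "coupling_dist k (\<pi> n) = (\<Sum>i<k. A i n)"
          unfolding A_def using less.prems by (intro nn_integral_arctan_dist coordm) auto
        have "ennreal (e / 4) + ennreal (e / 4) = ennreal (e / 2)"
          using e by (subst ennreal_plus[symmetric]) auto
        then show ?thesis
          using L(2)[OF r[of n] pi[of n]] unfolding s1 s2 unfolding R_def D_def[symmetric] A_def[symmetric]
          by (simp add: ac_simps) (simp add: add.assoc[symmetric])
      qed
      have "(\<lambda>n. \<Sum>i<k. D i n) \<longlonglongrightarrow> (\<Sum>i<k. 0)" "(\<lambda>n. \<Sum>i<k. A i n) \<longlonglongrightarrow> (\<Sum>i<k. 0)"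
        using less by (intro tendsto_sum less.IH A0; simp)+
      then have "R \<longlonglongrightarrow> ennreal L * (\<Sum>i<k. 0) + 0 + ennreal L * (\<Sum>i<k. 0)"
        unfolding R_def using less.prems by (intro tendsto_add ennreal_tendsto_cmult A0) auto
      then have "R \<longlonglongrightarrow> 0" by simp
      then have "eventually (\<lambda>n. R n < ennreal (e / 2)) sequentially"
        using e by (intro order_tendstoD(2)[where a="ennreal (e/2)"]) auto
      then show "eventually (\<lambda>n. D k n \<le> ennreal e) sequentially"
      proof eventually_elim
        case (elim n)
        have "D k n \<le> ennreal (e / 2) + R n" by (rule DR)
        also have "\<dots> \<le> ennreal (e / 2) + ennreal (e / 2)" using elim by (intro add_left_mono) simp
        also have "\<dots> = ennreal e" using e by (subst ennreal_plus[symmetric]) auto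
        finally show ?case .
      qed
    qed
  qed
  then show ?thesis unfolding D_def .
qed

text \<open>Apply Fatou's lemma to \<open>2\<^sup>p\<^sup>-\<^sup>1 (\<bar>X\<bar>\<^sup>p + \<bar>Y\<^sub>n\<bar>\<^sup>p) - \<bar>X - Y\<^sub>n\<bar>\<^sup>p \<ge> 0\<close>.\<close>

lemma Fatou_contradiction:
  fixes X :: "'a \<Rightarrow> nat \<Rightarrow> real" and Y :: "nat \<Rightarrow> 'a \<Rightarrow> nat \<Rightarrow> real"
  assumes p: "1 \<le> p" and m: "\<And>i. i < N \<Longrightarrow> (\<lambda>w. X w i) \<in> borel_measurable M" "\<And>n i. i < N \<Longrightarrow> (\<lambda>w. Y n w i) \<in> borel_measurable M"
    and F: "integrable M (\<lambda>w. \<Sum>i = 0..<N. \<bar>X w i\<bar> powr p)" "\<And>n. integrable M (\<lambda>w. \<Sum>i = 0..<N. \<bar>Y n w i\<bar> powr p)"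
    and AE: "AE w in M. \<forall>i<N. (\<lambda>n. Y n w i) \<longlonglongrightarrow> X w i"
    and b: "b \<longlonglongrightarrow> (\<integral>w. (\<Sum>i = 0..<N. \<bar>X w i\<bar> powr p) \<partial>M)" "\<And>n. (\<integral>w. (\<Sum>i = 0..<N. \<bar>Y n w i\<bar> powr p) \<partial>M) \<le> b n"
    and \<epsilon>: "0 < \<epsilon>" "\<And>n. \<epsilon> \<le> (\<integral>w. (\<Sum>i = 0..<N. \<bar>X w i - Y n w i\<bar> powr p) \<partial>M)"
  shows False
proof -
  let ?F = "\<lambda>w. \<Sum>i = 0..<N. \<bar>X w i\<bar> powr p" and ?G = "\<lambda>n w. \<Sum>i = 0..<N. \<bar>Y n w i\<bar> powr p"
    and ?H = "\<lambda>n w. \<Sum>i = 0..<N. \<bar>X w i - Y n w i\<bar> powr p"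
  \<comment> \<open>This is \<open>2^(p-1)\<close>, the constant of \<open>abs_add_powr_le\<close>
    at \<open>\<theta> = 1/2\<close>.\<close>
  define K where "K = (1/2) powr (1 - p)"
  have K: "0 \<le> K" by (simp add: K_def)
  have le: "?H n w \<le> K * (?F w + ?G n w)" for n w
  proof -
    have "?H n w \<le> (\<Sum>i = 0..<N. K * \<bar>X w i\<bar> powr p + K * \<bar>Y n w i\<bar> powr p)"
      using abs_add_powr_le[OF p, of "1/2" "X w _" "- Y n w _"] by (intro sum_mono) (simp add: K_def)
    then show ?thesis by (simp add: sum.distrib sum_distrib_left distrib_left)
  qed
  have H: "integrable M (?H n)" for n
    using minkowski_integral(1)[OF p, of N X M "\<lambda>w i. - Y n w i"] m F by auto
  define g where "g n w = K * (?F w + ?G n w) - ?H n w" for n w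
  have gi: "integrable M (g n)" for n
    unfolding g_def by (intro Bochner_Integration.integrable_diff integrable_mult_right Bochner_Integration.integrable_add F H)
  have g0: "0 \<le> g n w" for n w using le by (simp add: g_def)
  have lim: "AE w in M. (\<lambda>n. g n w) \<longlonglongrightarrow> K * (?F w + ?F w)"
    using AE
  proof eventually_elim
    case (elim w)
    have pw: "(\<lambda>n. \<bar>Z n\<bar> powr p) \<longlonglongrightarrow> \<bar>z\<bar> powr p" if "Z \<longlonglongrightarrow> z" for Z :: "nat \<Rightarrow> real" and z
      using p that by (intro tendsto_powr' tendsto_rabs tendsto_const) auto
    have "(\<lambda>n. ?G n w) \<longlonglongrightarrow> ?F w" using elim by (intro tendsto_sum pw) auto
    moreover have "(\<lambda>n. ?H n w) \<longlonglongrightarrow> (\<Sum>i = 0..<N. \<bar>X w i - X w i\<bar> powr p)"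
      using elim by (intro tendsto_sum pw tendsto_diff tendsto_const) auto
    ultimately have "(\<lambda>n. g n w) \<longlonglongrightarrow> K * (?F w + ?F w) - (\<Sum>i = 0..<N. \<bar>X w i - X w i\<bar> powr p)"
      unfolding g_def by (intro tendsto_diff tendsto_mult tendsto_add tendsto_const)
    then show ?case by simp
  qed
  let ?m = "\<integral>w. ?F w \<partial>M"
  have Ig: "(\<integral>w. g n w \<partial>M) \<le> K * (?m + b n) - \<epsilon>" for n
  proof -
    have "(\<integral>w. g n w \<partial>M) = K * (?m + (\<integral>w. ?G n w \<partial>M)) - (\<integral>w. ?H n w \<partial>M)"
      unfolding g_def using F H by (subst Bochner_Integration.integral_diff) (auto simp del: sum_distrib_left)
    also have "\<dots> \<le> K * (?m + b n) - \<epsilon>"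
      using b(2)[of n] \<epsilon>(2)[of n] K by (intro diff_mono mult_left_mono add_left_mono) auto
    finally show ?thesis .
  qed
  have blim: "(\<lambda>n. K * (?m + b n) - \<epsilon>) \<longlonglongrightarrow> K * (?m + ?m) - \<epsilon>"
    by (rule tendsto_diff[OF tendsto_mult[OF tendsto_const tendsto_add[OF tendsto_const b(1)]] tendsto_const])
  have "ennreal (K * (?m + ?m)) = (\<integral>\<^sup>+w. ennreal (K * (?F w + ?F w)) \<partial>M)"
    using F K by (subst nn_integral_eq_integral) (auto intro!: AE_I2 mult_nonneg_nonneg add_nonneg_nonneg sum_nonneg simp del: sum_distrib_left)
  also have "\<dots> = (\<integral>\<^sup>+w. liminf (\<lambda>n. ennreal (g n w)) \<partial>M)"
  proof (rule nn_integral_cong_AE)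
    show "AE w in M. ennreal (K * (?F w + ?F w)) = liminf (\<lambda>n. ennreal (g n w))"
      using lim by eventually_elim (rule lim_imp_Liminf[OF trivial_limit_sequentially tendsto_ennrealI, symmetric])
  qed
  also have "\<dots> \<le> liminf (\<lambda>n. \<integral>\<^sup>+w. ennreal (g n w) \<partial>M)"
  proof (rule nn_integral_liminf)
    show "(\<lambda>w. ennreal (g n w)) \<in> borel_measurable M" for n
      using borel_measurable_integrable[OF gi] by (rule measurable_compose) simp
  qed
  also have "\<dots> \<le> liminf (\<lambda>n. ennreal (K * (?m + b n) - \<epsilon>))"
  proof (rule Liminf_mono, rule always_eventually, rule allI)
    fix n
    have "(\<integral>\<^sup>+w. ennreal (g n w) \<partial>M) = ennreal (\<integral>w. g n w \<partial>M)"
      by (rule nn_integral_eq_integral[OF gi]) (simp add: g0)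
    then show "(\<integral>\<^sup>+w. ennreal (g n w) \<partial>M) \<le> ennreal (K * (?m + b n) - \<epsilon>)"
      using ennreal_leI[OF Ig[of n]] by simp
  qed
  also have "liminf (\<lambda>n. ennreal (K * (?m + b n) - \<epsilon>)) = ennreal (K * (?m + ?m) - \<epsilon>)"
    by (rule lim_imp_Liminf[OF trivial_limit_sequentially tendsto_ennrealI[OF blim]])
  finally have *: "ennreal (K * (?m + ?m)) \<le> ennreal (K * (?m + ?m) - \<epsilon>)" .
  \<comment> \<open>\<open>ennreal\<close> sends negative numbers to 0, so \<open>*\<close>
    contradicts \<open>0 < \<epsilon>\<close> only once its right-hand side is known to come from a
    nonnegative real.\<close>
  have "0 \<le> K * (?m + b n) - \<epsilon>" for n
  proof -
    have "0 \<le> (\<integral>w. g n w \<partial>M)" by (rule integral_nonneg_AE) (simp add: g0)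
    then show ?thesis using Ig[of n] by linarith
  qed
  then have "0 \<le> K * (?m + ?m) - \<epsilon>"
    by (intro LIMSEQ_le_const[OF blim]) auto
  then show False using * \<epsilon>(1) by (simp add: ennreal_le_iff)
qed

text \<open>Stated as a contradiction because the lower bound \<open>\<epsilon>\<close> is inherited
  by subsequences. Convergence of the arctan distances in \<open>L^1\<close> gives almost sure
  convergence along a subsequence; dominated convergence then settles \<open>p = 0\<close>, and
  Fatou with control of the moments settles \<open>p \<ge> 1\<close>.\<close>

lemma KR_convergence:
  assumes p: "p = 0 \<or> 1 \<le> p" and q: "monotone_map q" and r: "\<And>n::nat. monotone_map (r n)"
    and P: "recursive_map.law q N \<in> prob_measures p N" "\<And>n. recursive_map.law (r n) N \<in> prob_measures p N"
    and pi: "\<And>n. \<pi> n \<in> bicausal_couplings N (recursive_map.law q N) (recursive_map.law (r n) N)"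
    and lim: "(\<lambda>n. mean_cost p N (\<pi> n)) \<longlonglongrightarrow> 0"
    and \<epsilon>: "0 < \<epsilon>" "\<And>n. \<epsilon> \<le> (\<integral>u. cost p N (path q N u) (path (r n) N u) \<partial>unit_cube N)"
  shows False
proof -
  interpret C: prob_space "unit_cube N" by (rule prob_space_unit_cube)
  note pathm = monotone_map.measurable_path and coordm = monotone_map.path_coord_measurable
    and dp = monotone_map.distr_path_eq_law
  define U where "U n u = arctan_dist N (path q N u) (path (r n) N u)" for n u
  have Um: "U n \<in> borel_measurable (unit_cube N)" for n
    unfolding U_def arctan_dist_def
  proof (intro borel_measurable_sum borel_measurable_abs borel_measurable_diff)
    have am: "arctan \<in> borel_measurable borel" by measurable
    show "(\<lambda>u. arctan (path q N u i)) \<in> borel_measurable (unit_cube N)"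
      "(\<lambda>u. arctan (path (r n) N u i)) \<in> borel_measurable (unit_cube N)" if "i \<in> {..<N}" for i
      using that by (auto intro!: measurable_compose[OF coordm am] q r)
  qed
  have U0: "0 \<le> U n u" for n u by (simp add: U_def arctan_dist_nonneg)
  have Ui: "integrable (unit_cube N) (U n)" for n
  proof (rule C.integrable_const_bound[OF _ Um])
    have "\<bar>arctan a - arctan b\<bar> \<le> 4" for a b using arctan_abs_le2[of a] arctan_abs_le2[of b] by linarith
    then have "U n u \<le> 4 * real N" for u
      unfolding U_def arctan_dist_def
      using sum_bounded_above[of "{..<N}" "\<lambda>i. \<bar>arctan (path q N u i) - arctan (path (r n) N u i)\<bar>" "4 :: real"]
      by (simp add: mult.commute)
    then show "AE u in unit_cube N. norm (U n u) \<le> 4 * real N" using U0 by simp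
  qed
  have "(\<lambda>n. \<integral>\<^sup>+u. ennreal (U n u) \<partial>unit_cube N) \<longlonglongrightarrow> (\<Sum>i<N. 0)"
  proof -
    have "(\<integral>\<^sup>+u. ennreal (U n u) \<partial>unit_cube N) = (\<Sum>i<N. \<integral>\<^sup>+u. ennreal \<bar>arctan (path q N u i) - arctan (path (r n) N u i)\<bar> \<partial>unit_cube N)" for n
      unfolding U_def by (intro nn_integral_arctan_dist coordm q r)
    then show ?thesis
      by (simp only:) (intro tendsto_sum arctan_convergence[OF p q r P pi lim]; simp)
  qed
  moreover have "(\<integral>\<^sup>+u. ennreal (U n u) \<partial>unit_cube N) = ennreal (\<integral>u. norm (U n u) \<partial>unit_cube N)" for n
    using Ui[of n] by (subst nn_integral_eq_integral) (auto simp: U0)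
  ultimately have "(\<lambda>n. ennreal (\<integral>u. norm (U n u) \<partial>unit_cube N)) \<longlonglongrightarrow> ennreal 0" by simp
  then have "(\<lambda>n. \<integral>u. norm (U n u) \<partial>unit_cube N) \<longlonglongrightarrow> 0"
    by (subst (asm) tendsto_ennreal_iff) (auto intro!: always_eventually integral_nonneg_AE)
  then obtain \<sigma> where \<sigma>: "strict_mono \<sigma>" "AE u in unit_cube N. (\<lambda>n. U (\<sigma> n) u) \<longlonglongrightarrow> 0"
    using tendsto_L1_AE_subseq[of "unit_cube N" U, OF Ui] by blast
  have AE: "AE u in unit_cube N. \<forall>i<N. (\<lambda>n. path (r (\<sigma> n)) N u i) \<longlonglongrightarrow> path q N u i"
    using \<sigma>(2)
  proof eventually_elim
    case (elim u)
    show ?case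
    proof (intro allI impI)
      fix i assume i: "i < N"
      have "\<bar>arctan (path q N u i) - arctan (path (r (\<sigma> n)) N u i)\<bar> \<le> U (\<sigma> n) u" for n
        unfolding U_def arctan_dist_def using i
        by (intro member_le_sum[of i "{..<N}" "\<lambda>i. \<bar>arctan (path q N u i) - arctan (path (r (\<sigma> n)) N u i)\<bar>"]) auto
      then have "(\<lambda>n. \<bar>arctan (path q N u i) - arctan (path (r (\<sigma> n)) N u i)\<bar>) \<longlonglongrightarrow> 0"
        by (intro tendsto_sandwich[OF _ _ tendsto_const elim]) auto
      then have "(\<lambda>n. arctan (path q N u i) - arctan (path (r (\<sigma> n)) N u i)) \<longlonglongrightarrow> 0"
        by (simp add: tendsto_rabs_zero_iff)
      then have "(\<lambda>n. arctan (path q N u i) - (arctan (path q N u i) - arctan (path (r (\<sigma> n)) N u i))) \<longlonglongrightarrow> arctan (path q N u i) - 0"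
        by (rule tendsto_diff[OF tendsto_const])
      then have "(\<lambda>n. arctan (path (r (\<sigma> n)) N u i)) \<longlonglongrightarrow> arctan (path q N u i)" by simp
      \<comment> \<open>The limit is the \<open>arctan\<close> of a real number, where
        \<open>tan\<close> is continuous, so the transformation can be undone.\<close>
      then have "(\<lambda>n. tan (arctan (path (r (\<sigma> n)) N u i))) \<longlonglongrightarrow> tan (arctan (path q N u i))"
        by (rule isCont_tendsto_compose[OF isCont_tan[OF cos_arctan_not_zero]])
      then show "(\<lambda>n. path (r (\<sigma> n)) N u i) \<longlonglongrightarrow> path q N u i" by (simp add: tan_arctan)
    qed
  qed
  show False
  proof (cases "p = 0")
    case True
    have "(\<lambda>n. \<integral>u. cost p N (path q N u) (path (r (\<sigma> n)) N u) \<partial>unit_cube N) \<longlonglongrightarrow> (\<integral>u. 0 \<partial>unit_cube N)"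
    proof (rule integral_dominated_convergence[where w="\<lambda>_. 1"])
      show "AE u in unit_cube N. (\<lambda>n. cost p N (path q N u) (path (r (\<sigma> n)) N u)) \<longlonglongrightarrow> 0"
        using AE
      proof eventually_elim
        case (elim u)
        have "(\<lambda>n. min (sqrt (\<Sum>i = 0..<N. (path q N u i - path (r (\<sigma> n)) N u i)\<^sup>2)) 1)
            \<longlonglongrightarrow> min (sqrt (\<Sum>i = 0..<N. (path q N u i - path q N u i)\<^sup>2)) 1"
          using elim
          by (intro tendsto_min tendsto_const tendsto_real_sqrt tendsto_sum tendsto_power tendsto_diff) auto
        then show ?case using True by (simp add: cost_def L2_set_def)
      qed
      show "(\<lambda>u. cost p N (path q N u) (path (r (\<sigma> n)) N u)) \<in> borel_measurable (unit_cube N)" for n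
        by (intro measurable_cost pathm q r)
      show "AE u in unit_cube N. norm (cost p N (path q N u) (path (r (\<sigma> n)) N u)) \<le> 1" for n
        using True by (auto simp: cost_def L2_set_nonneg)
    qed auto
    then have "\<epsilon> \<le> 0" using \<epsilon>(2) by (intro LIMSEQ_le_const[of _ 0]) auto
    with \<epsilon>(1) show False by simp
  next
    case False
    then have p1: "1 \<le> p" using p by simp
    note bm = bicausal_coordinate_measurable[OF q r pi]
    let ?S = "\<lambda>x. \<Sum>i = 0..<N. \<bar>x i\<bar> powr p"
    have Sm: "?S \<in> borel_measurable (RN N)" by measurable
    have Si: "integrable (recursive_map.law q N) ?S" "integrable (recursive_map.law (r n) N) ?S" for n
      using P False by (auto simp: prob_measures_def)
    have cmp: "(\<lambda>z. fst z i) \<in> borel_measurable (\<pi> n)" "(\<lambda>z. snd z i) \<in> borel_measurable (\<pi> n)" if "i < N" for i n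
      using measurable_compose[OF bm(2)[of n] measurable_component_singleton[of i "{0..<N}"]]
        measurable_compose[OF bm(3)[of n] measurable_component_singleton[of i "{0..<N}"]] that by simp_all
    define m where "m = (\<integral>u. ?S (path q N u) \<partial>unit_cube N)"
    define c where "c n = (mean_cost p N (\<pi> n))" for n
    \<comment> \<open>Minkowski under \<open>\<pi> n\<close>, applied to
      \<open>y = x + (y - x)\<close>, bounds the moment of the second marginal by
      \<open>b n\<close>. Moments depend on the marginals only, so the bound carries over to the
      paths on the cube.\<close>
    define b where "b n = (m powr (1 / p) + c n powr (1 / p)) powr p" for n
    have m0: "0 \<le> m" unfolding m_def by (intro integral_nonneg_AE AE_I2 sum_nonneg) auto
    have c0: "0 \<le> c n" for n unfolding c_def by (rule bicausal_nonneg_integral)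
    have mq: "m = (\<integral>x. ?S x \<partial>recursive_map.law q N)"
      unfolding m_def dp[OF q, symmetric] by (rule integral_distr[OF pathm[OF q] Sm, symmetric])
    have le: "(\<integral>u. ?S (path (r n) N u) \<partial>unit_cube N) \<le> b n" for n
    proof -
      have "(\<integral>u. ?S (path (r n) N u) \<partial>unit_cube N) = (\<integral>x. ?S x \<partial>recursive_map.law (r n) N)"
        unfolding dp[OF r, symmetric] by (rule integral_distr[OF pathm[OF r] Sm, symmetric])
      also have "\<dots> = (\<integral>z. ?S (snd z) \<partial>\<pi> n)"
        unfolding bm(5)[of n, symmetric] by (rule integral_distr[OF bm(3) Sm])
      finally have eq: "(\<integral>u. ?S (path (r n) N u) \<partial>unit_cube N) = (\<integral>z. ?S (snd z) \<partial>\<pi> n)" .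
      have i1: "integrable (\<pi> n) (\<lambda>z. ?S (fst z))"
        using Si(1) unfolding bm(4)[of n, symmetric] by (subst (asm) integrable_distr_eq[OF bm(2) Sm])
      have i2: "integrable (\<pi> n) (\<lambda>z. \<Sum>i = 0..<N. \<bar>snd z i - fst z i\<bar> powr p)"
        using integrable_cost[OF p bm(1,2,3)[of n]] P bm(4,5)[of n] False by (simp add: cost_def abs_minus_commute)
      have "(\<integral>z. (\<Sum>i = 0..<N. \<bar>fst z i + (snd z i - fst z i)\<bar> powr p) \<partial>\<pi> n) powr (1 / p)
        \<le> (\<integral>z. ?S (fst z) \<partial>\<pi> n) powr (1 / p) + (\<integral>z. (\<Sum>i = 0..<N. \<bar>snd z i - fst z i\<bar> powr p) \<partial>\<pi> n) powr (1 / p)"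
        by (intro minkowski_integral(2)[OF p1 _ _ i1 i2] borel_measurable_diff cmp)
      also have "(\<integral>z. ?S (fst z) \<partial>\<pi> n) = m"
        unfolding mq bm(4)[of n, symmetric] by (rule integral_distr[OF bm(2) Sm, symmetric])
      also have "(\<integral>z. (\<Sum>i = 0..<N. \<bar>snd z i - fst z i\<bar> powr p) \<partial>\<pi> n) = c n"
        unfolding c_def using False by (simp add: cost_def abs_minus_commute)
      finally have le: "(\<integral>z. ?S (snd z) \<partial>\<pi> n) powr (1 / p) \<le> m powr (1 / p) + c n powr (1 / p)" by simp
      have "0 \<le> (\<integral>z. ?S (snd z) \<partial>\<pi> n)" by (intro integral_nonneg_AE AE_I2 sum_nonneg) auto
      then have "(\<integral>z. ?S (snd z) \<partial>\<pi> n) = ((\<integral>z. ?S (snd z) \<partial>\<pi> n) powr (1 / p)) powr p"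
        using p1 by (simp add: powr_powr)
      also have "\<dots> \<le> b n" unfolding b_def using le p1 by (intro powr_mono2) auto
      finally show ?thesis unfolding eq .
    qed
    have "b \<longlonglongrightarrow> m"
    proof -
      have cl: "(\<lambda>n. c n powr (1 / p)) \<longlonglongrightarrow> 0 powr (1 / p)"
        using lim p1 c0 by (intro tendsto_powr' tendsto_const) (auto simp: c_def)
      have "b \<longlonglongrightarrow> (m powr (1 / p) + 0 powr (1 / p)) powr p"
        unfolding b_def using p1
        by (intro tendsto_powr'[OF tendsto_add[OF tendsto_const cl] tendsto_const]) auto
      then show ?thesis using m0 p1 by (simp add: powr_powr)
    qed
    then have bl: "(\<lambda>n. b (\<sigma> n)) \<longlonglongrightarrow> m" using LIMSEQ_subseq_LIMSEQ[OF _ \<sigma>(1), of b m] by (simp add: comp_def)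
    have ip: "integrable (unit_cube N) (\<lambda>u. ?S (path s N u))" if "monotone_map s" "integrable (recursive_map.law s N) ?S" for s
      using that(2) unfolding dp[OF that(1), symmetric] by (subst (asm) integrable_distr_eq[OF pathm[OF that(1)] Sm])
    show False
    proof (rule Fatou_contradiction[OF p1 coordm[OF q] coordm[OF r] ip[OF q Si(1)] ip[OF r Si(2)] AE])
      show "(\<lambda>n. b (\<sigma> n)) \<longlonglongrightarrow> (\<integral>u. ?S (path q N u) \<partial>unit_cube N)" using bl by (simp add: m_def)
      show "(\<integral>u. ?S (path (r (\<sigma> n)) N u) \<partial>unit_cube N) \<le> b (\<sigma> n)" for n by (rule le)
      show "\<epsilon> \<le> (\<integral>u. (\<Sum>i = 0..<N. \<bar>path q N u i - path (r (\<sigma> n)) N u i\<bar> powr p) \<partial>unit_cube N)" for n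
        using \<epsilon>(2)[of "\<sigma> n"] False by (simp add: cost_def)
    qed (simp_all add: \<epsilon>(1))
  qed
qed

section \<open>Comparison of the two topologies\<close>

lemma root_p_less_imp:
  assumes "p = 0 \<or> 1 \<le> p" "0 \<le> c" "d \<le> 1" "root_p p c < d"
  shows "c < d"
proof (cases "p = 0")
  case False
  with assms have p: "1 \<le> p" by simp
  then have "c powr (1 / p) < d" using assms False by (simp add: root_p_def)
  then have "(c powr (1 / p)) powr p < d powr p" using p by (intro powr_less_mono2) auto
  moreover have "(c powr (1 / p)) powr p = c" using assms(2) p by (simp add: powr_powr)
  moreover have "0 \<le> d" using assms False \<open>c powr (1 / p) < d\<close> powr_ge_zero[of c "1 / p"] by linarith
  \<comment> \<open>Here \<open>d \<le> 1\<close> enters; it lets the bound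
    \<open>1 / (n + 1)\<close> on the distance serve as a bound on the mean cost for every
    \<open>p\<close>.\<close>
  then have "d powr p \<le> d powr 1" using powr_mono'[OF p, of d] assms(3) by simp
  ultimately show ?thesis using \<open>0 \<le> d\<close> by simp
qed (use assms in \<open>simp add: root_p_def\<close>)

lemma root_p_ge_imp:
  assumes "p = 0 \<or> 1 \<le> p" "0 < e"
  obtains e' where "0 < e'" "\<And>c. 0 \<le> c \<Longrightarrow> e \<le> root_p p c \<Longrightarrow> e' \<le> c"
proof (cases "p = 0")
  case True
  then show ?thesis using assms by (intro that[of e]) (auto simp: root_p_def)
next
  case False
  with assms have p: "1 \<le> p" by simp
  have "e powr p \<le> c" if "0 \<le> c" "e \<le> root_p p c" for c
  proof -
    have "e powr p \<le> (c powr (1 / p)) powr p"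
      using that assms(2) p False by (intro powr_mono2) (auto simp: root_p_def)
    then show ?thesis using that p by (simp add: powr_powr)
  qed
  then show ?thesis using assms(2) by (intro that[of "e powr p"]) auto
qed

text \<open>If it fails, there are measures whose \<open>AW\<close> distance to \<open>\<mu>\<close>
  is below \<open>1 / (n + 1)\<close> while \<open>KR\<close> stays at least \<open>e\<close>.
  Couplings that nearly attain the infimum in \<open>AW\<close> then form a sequence excluded by
  \<open>KR_convergence\<close>.\<close>

lemma AW_small_imp_KR_small:
  assumes p: "p = 0 \<or> 1 \<le> p" and \<mu>: "\<mu> \<in> prob_measures p N" and e: "0 < e"
  shows "\<exists>d>0. \<forall>\<nu>\<in>prob_measures p N. AW p N \<mu> \<nu> < d \<longrightarrow> KR p N \<mu> \<nu> < e"
proof (rule ccontr)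
  assume neg: "\<not> ?thesis"
  obtain e' where e': "0 < e'" "\<And>c. 0 \<le> c \<Longrightarrow> e \<le> root_p p c \<Longrightarrow> e' \<le> c"
    by (rule root_p_ge_imp[OF p e]) blast
  obtain q where q: "monotone_map q" "recursive_map.law q N = \<mu>"
    "\<And>u. u \<in> space (unit_cube N) \<Longrightarrow> quantile_map N \<mu> u = path q N u"
    by (rule prob_measures_quantile_map[OF \<mu>]) blast
  \<comment> \<open>Recursion and coupling are bundled into one pair because the conditions link
    them; a single use of choice then gives both sequences.\<close>
  define bad where "bad n x \<longleftrightarrow> monotone_map (fst x) \<and> recursive_map.law (fst x) N \<in> prob_measures p N \<and>
      snd x \<in> bicausal_couplings N (recursive_map.law q N) (recursive_map.law (fst x) N) \<and>
      mean_cost p N (snd x) \<le> 1 / real (Suc n) \<and>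
      e' \<le> (\<integral>u. cost p N (path q N u) (path (fst x) N u) \<partial>unit_cube N)" for n x
  have "\<exists>x. bad n x" for n
  proof -
    have "0 < 1 / real (Suc n)" by simp
    then obtain \<nu> where \<nu>: "\<nu> \<in> prob_measures p N" "AW p N \<mu> \<nu> < 1 / real (Suc n)" "e \<le> KR p N \<mu> \<nu>"
      using neg by (meson not_less)
    obtain r where r: "monotone_map r" "recursive_map.law r N = \<nu>"
      "\<And>u. u \<in> space (unit_cube N) \<Longrightarrow> quantile_map N \<nu> u = path r N u"
      by (rule prob_measures_quantile_map[OF \<nu>(1)]) blast
    obtain \<pi>0 where "\<pi>0 \<in> bicausal_couplings N \<mu> \<nu>" by (rule KR_attained[OF \<mu> \<nu>(1)])
    then have ne: "bicausal_couplings N \<mu> \<nu> \<noteq> {}" by blast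
    obtain \<pi> where \<pi>: "\<pi> \<in> bicausal_couplings N \<mu> \<nu>" "root_p p (mean_cost p N \<pi>) < 1 / real (Suc n)"
      using \<nu>(2) unfolding AW_def cINF_less_iff[OF ne bdd_below_bicausal_costs] by blast
    have small: "(mean_cost p N \<pi>) < 1 / real (Suc n)"
      by (rule root_p_less_imp[OF p bicausal_nonneg_integral _ \<pi>(2)]) simp
    have "(\<integral>u. cost p N (quantile_map N \<mu> u) (quantile_map N \<nu> u) \<partial>unit_cube N) =
        (\<integral>u. cost p N (path q N u) (path r N u) \<partial>unit_cube N)"
      by (rule Bochner_Integration.integral_cong) (simp_all add: q(3) r(3))
    then have "e \<le> root_p p (\<integral>u. cost p N (path q N u) (path r N u) \<partial>unit_cube N)"
      using \<nu>(3) by (simp add: KR_def)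
    then have "e' \<le> (\<integral>u. cost p N (path q N u) (path r N u) \<partial>unit_cube N)"
      by (intro e'(2) integral_nonneg_AE AE_I2 cost_nonneg)
    then show ?thesis using r(1,2) \<nu>(1) \<pi>(1) small q(2) by (intro exI[of _ "(r, \<pi>)"]) (simp add: bad_def)
  qed
  then have "\<forall>n. \<exists>x. bad n x" ..
  from choice[OF this] obtain x where x: "\<forall>n. bad n (x n)" by (rule exE)
  define r where "r n = fst (x n)" for n
  define \<pi> where "\<pi> n = snd (x n)" for n
  have r: "\<And>n. monotone_map (r n)" "\<And>n. recursive_map.law (r n) N \<in> prob_measures p N"
      "\<And>n. \<pi> n \<in> bicausal_couplings N (recursive_map.law q N) (recursive_map.law (r n) N)"
      "\<And>n. (mean_cost p N (\<pi> n)) \<le> 1 / real (Suc n)"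
      "\<And>n. e' \<le> (\<integral>u. cost p N (path q N u) (path (r n) N u) \<partial>unit_cube N)"
    using x by (simp_all add: r_def \<pi>_def bad_def)
  have "(\<lambda>n. mean_cost p N (\<pi> n)) \<longlonglongrightarrow> 0"
    using r(4) bicausal_nonneg_integral
    by (intro tendsto_sandwich[OF _ _ tendsto_const LIMSEQ_Suc[OF lim_1_over_n]]) auto
  then show False
    using \<mu> by (intro KR_convergence[OF p q(1) r(1) _ r(2,3) _ e'(1) r(5)]) (simp_all add: q(2))
qed

theorem theorem1p4:
  fixes N :: nat and p :: real
  assumes "p = 0 \<or> 1 \<le> p"
  shows "Metric_space (prob_measures p N) (KR p N) \<and>
         Metric_space.mtopology (prob_measures p N) (KR p N) = adapted_weak_topology p N"
proof
  let ?S = "prob_measures p N"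
  show m: "Metric_space ?S (KR p N)" by (rule Metric_space_KR[OF assms])
  have "openin (dist_topology ?S (KR p N)) W \<longleftrightarrow> openin (dist_topology ?S (AW p N)) W" for W
    unfolding openin_dist_topology
  proof (intro conj_cong refl ball_cong)
    fix \<mu> assume "W \<subseteq> ?S" "\<mu> \<in> W"
    then have \<mu>: "\<mu> \<in> ?S" by blast
    show "(\<exists>r>0. \<forall>\<nu>\<in>?S. KR p N \<mu> \<nu> < r \<longrightarrow> \<nu> \<in> W) \<longleftrightarrow> (\<exists>r>0. \<forall>\<nu>\<in>?S. AW p N \<mu> \<nu> < r \<longrightarrow> \<nu> \<in> W)"
    proof
      assume "\<exists>r>0. \<forall>\<nu>\<in>?S. KR p N \<mu> \<nu> < r \<longrightarrow> \<nu> \<in> W"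
      then show "\<exists>r>0. \<forall>\<nu>\<in>?S. AW p N \<mu> \<nu> < r \<longrightarrow> \<nu> \<in> W"
        using AW_small_imp_KR_small[OF assms \<mu>] by meson
    next
      assume "\<exists>r>0. \<forall>\<nu>\<in>?S. AW p N \<mu> \<nu> < r \<longrightarrow> \<nu> \<in> W"
      then show "\<exists>r>0. \<forall>\<nu>\<in>?S. KR p N \<mu> \<nu> < r \<longrightarrow> \<nu> \<in> W"
        using AW_le_KR[OF \<mu>] by (meson order_le_less_trans)
    qed
  qed
  then show "Metric_space.mtopology ?S (KR p N) = adapted_weak_topology p N"
    by (simp add: adapted_weak_topology_def topology_eq flip: dist_topology_eq_mtopology[OF m])
qed

end
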